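(* Let the geometric assumption, the CutFEM stability assumption and the covering assumption (all defined in the context) hold, let the local and coarse solves be exact, and prescribe $\gamma=\gamma(p)\in(0,1]$ and an admissible $\gamma_D=\gamma_D(p)$. Let $N_O(d)=5^d$, and let $C_{\mathrm{sd}}(p)$ and $C_{\mathrm{pr}}$ be the constants described in the context. Then, uniformly in $\ell$ and in the position of $\Gamma$ relative to the meshes: (i) (additive) The operator $P_{\mathrm{ad}}=\sum_{j=0}^J P_j$ satisfies, for all $v\in V_\ell$, $$C_{\mathrm{sd}}(p)^{-1}A_\ell(v,v)\le A_\ell(P_{\mathrm{ad}}v,v)\le (N_O(d)+1)\,A_\ell(v,v),\qquad \kappa(P_{\mathrm{ad}})\le (N_O(d)+1)\,C_{\mathrm{sd}}(p).$$ (ii) (multiplicative) The error operator $E_{\mathrm{TG}}:=(I-P_J)\cdots(I-P_1)(I-P_0)$ (coarse correction first, then one multiplicative sweep of exact patch solves in any fixed order; the reversed and the symmetrized $V(1,1)$ orderings obey the same bound) satisfies $$\|E_{\mathrm{TG}}\|_{A_\ell}^2\le 1-\frac{1}{(2N_O(d)^2+1)\,C_{\mathrm{sd}}(p)}<1 .$$ (iii) (rediscretized coarse solve) Let $T_0:=C_{\mathrm{pr}}^{-2}\,\mathcal I_\ell\,\mathcal R_\ell$, where $\mathcal R_\ell u\in V_{\ell-1}$ is defined by $A_{\ell-1}(\mathcal R_\ell u,z)=A_\ell(u,\mathcal I_\ell z)$ for all $z\in V_{\ell-1}$. Then $\widetilde E_{\mathrm{TG}}:=(I-P_J)\cdots(I-P_1)(I-T_0)$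 satisfies $$\|\widetilde E_{\mathrm{TG}}\|_{A_\ell}^2\le\tilde\eta^2:=1-\frac{1}{(2N_O(d)^2+1)(1+C_{\mathrm{pr}}^2)\,C_{\mathrm{sd}}(p)}<1 .$$ In particular the stationary two-level iteration converges, and the symmetrized method is a preconditioner with cut-independent condition number, for every polynomial degree $p$ and every cut configuration admitted by the geometric assumption.
   Context: Meshes and spaces. $d\in\{2,3\}$, $p\ge1$; $\Omega\subset\mathbb R^d$ is a bounded domain with boundary $\Gamma$ and outward unit normal $n$. $\mathcal M_0,\dots,\mathcal M_L$ are nested Cartesian background grids covering $\Omega$: the cells of $\mathcal M_\ell$ are closed axis-parallel cubes of edge $h_\ell$, and $\mathcal M_\ell$ is the uniform dyadic refinement of $\mathcal M_{\ell-1}$, so $h_\ell=h_{\ell-1}/2$. Active cells: $\mathcal M_{\ell,\Omega}=\{K\in\mathcal M_\ell:K\cap\Omega\ne\emptyset\}$; $\Omega_\ell$ is their union. Cut (intersected) cells are those meeting $\Gamma$. $\mathbb Q_p(K)$: polynomials of degree at most $p$ in each variable. $V_\ell$: continuous functions on $\Omega_\ell$ that are in $\mathbb Q_p(K)$ on each active cell $K$, with nodal (Lagrange) basis $\phi_{\ell,i}$ at the tensor-product Gauss–Lobatto nodes $x_{\ell,i}$. $\mathbb F_G=\mathbb F_G^\ell$: faces shared by two active cells at least one of which is cut. Forms. $A_\ell=a_\ell+g_\ell$ with $a_\ell(u,v)=(\nabla u,\nabla v)_\Omega-(\partial_n u,v)_\Gamma-(u,\partial_n v)_\Gamma+\gamma_D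 h_\ell^{-1}(u,v)_\Gamma$ and $g_\ell(u,v)=\gamma\sum_{F\in\mathbb F_G}\sum_{k=1}^p\frac{h_\ell^{2k-1}}{(k!)^2}(\llbracket\partial_n^k u\rrbracket,\llbracket\partial_n^k v\rrbracket)_F$, $\gamma\in(0,1]$ (on $F$, $n$ is a fixed unit normal and $\llbracket\cdot\rrbracket$ the jump). $\gamma,\gamma_D$ are the same on all levels. $\|v\|_{A_\ell}^2:=A_\ell(v,v)$, and $\|\cdot\|_{A_\ell}$ of an operator on $V_\ell$ is the induced operator norm. The prolongation $\mathcal I_\ell:V_{\ell-1}\to V_\ell$ is restriction of functions to $\Omega_\ell$ (identity on functions). Geometric assumption. $\Gamma$ is $C^2$ with positive reach $\delta_0>0$ (the closest-point projection onto $\Gamma$ is well defined and $C^1$ in the tube of radius $\delta_0$). On every level, if $\Gamma$ meets a cell $K$, then $\Gamma\cap K$ is a single curve (surface) intersecting $\partial K$ exactly twice (in a single closed curve if $d=3$), each closed face is intersected at most once, and $K\setminus\Gamma$ has exactly two connected components. $\Gamma$ contains no mesh vertex of any $\mathcal M_\ell$, $\Omega_\ell\subseteq\Omega_{\ell-1}$ for all $\ell$, and $c_R h_{\ell-1}\le\delta_0$ on every level used, with $c_R=24d+10\sqrt d$. CutFEM stability assumption. With $N_\ell(v)^2:=\|\nabla v\|_{0,\Omega}^2+h_\ell\|\partial_n v\|_{0,\Gamma}^2+h_\ell^{-1}\|v\|_{0,\Gamma}^2+g_\ell(v,v)$, one has for $u,v\in V_\ell$: $c_A N_\ell(v)^2\le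 A_\ell(v,v)$, $A_\ell(u,v)\le C_A N_\ell(u)N_\ell(v)$, and $|v|_{1,\Omega_\ell\setminus\Omega}^2\le C(|v|_{1,\Omega}^2+g_\ell(v,v))$, where $c_A,C_A,C>0$ are independent of $\ell$ and of the cut configuration. $\gamma_D$ is admissible if this assumption holds for it. Patches. Admissible vertices $\vartheta_1,\dots,\vartheta_J$ of $\mathcal M_\ell$: all grid vertices in $\Omega$ and all exterior vertices with at least one cut adjacent cell. $\widehat\omega_j$: union of the $2^d$ background cells sharing $\vartheta_j$; $\omega_j$: union of the active cells in $\widehat\omega_j$. For a basis function $\phi_{\ell,i}$, $\omega(i)$ is the union of all active cells containing $x_{\ell,i}$. Local spaces: $V^{\mathrm D}_{\ell,j}=\operatorname{span}\{\phi_{\ell,i}:x_{\ell,i}\in\operatorname{int}\widehat\omega_j\}$ (classical) or $V^{\mathrm{FR}}_{\ell,j}=\operatorname{span}\{\phi_{\ell,i}:\omega(i)\subseteq\omega_j\}$ (full residual); $V_{\ell,j}$ denotes either. The coarse space is $V_{\ell,0}:=\mathcal I_\ell V_{\ell-1}$. For $j=0,\dots,J$, $P_j:V_\ell\to V_{\ell,j}$ is the $A_\ell$-orthogonal projection: $A_\ell(P_jv,w)=A_\ell(v,w)$ for all $w\in V_{\ell,j}$. Covering assumption. For each nodal basis function $\phi_{\ell,i}$ of $V_\ell$ there is $j\in\{1,\dots,J\}$ with $\phi_{\ell,i}\in V_{\ell,j}$. Constants. $C_{\mathrm{pr}}$ is a constant, independent of $\ell$ and of the cut configuration, with $\|\mathcal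 I_\ell v\|_{A_\ell}\le C_{\mathrm{pr}}\|v\|_{A_{\ell-1}}$ for all $v\in V_{\ell-1}$. $C_{\mathrm{sd}}(p)$ is a constant, independent of $\ell$ and of the cut configuration, such that every $v\in V_\ell$ can be written $v=\sum_{j=0}^Jv_j$, $v_j\in V_{\ell,j}$, $v_0=\mathcal I_\ell\widehat v_0$, $\widehat v_0\in V_{\ell-1}$, with $\sum_{j=0}^J\|v_j\|_{A_\ell}^2\le C_{\mathrm{sd}}(p)\|v\|_{A_\ell}^2$ and $\|\widehat v_0\|_{A_{\ell-1}}^2\le C_{\mathrm{sd}}(p)\|v\|_{A_\ell}^2$. Under the stated assumptions the paper proves that both constants exist. *)

theory Defs
  imports "HOL-Analysis.Analysis"
begin

section \<open>Surface measure and the boundary of the domain\<close>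

text \<open>Spherical normalisation, so that on a hyperplane of dimension \<open>s\<close> this is Lebesgue outer
  measure.\<close>

definition hausdorff_outer :: "real \<Rightarrow> 'a::metric_space set \<Rightarrow> ennreal" where
  "hausdorff_outer s A =
     (SUP \<delta>\<in>{0<..}. INF U\<in>{U :: nat \<Rightarrow> 'a set. A \<subseteq> (\<Union>i. U i) \<and>
                                (\<forall>i. bounded (U i) \<and> diameter (U i) \<le> \<delta>)}.
        (\<Sum>i. ennreal (unit_ball_vol s * (diameter (U i) / 2) powr s)))"

definition surface_measure :: "(real^'n) measure" where
  "surface_measure = measure_of UNIV (sets borel) (hausdorff_outer (real CARD('n) - 1))"

text \<open>\<open>G\<close> is the gradient of \<open>\<psi>\<close> and \<open>H\<close> its Hessian.\<close>

definition C2_defining_function ::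
    "(real^'n) set \<Rightarrow> (real^'n) set \<Rightarrow> (real^'n \<Rightarrow> real) \<Rightarrow> (real^'n \<Rightarrow> real^'n) \<Rightarrow> bool" where
  "C2_defining_function \<Omega> U \<psi> G \<longleftrightarrow>
     open U \<and>
     (\<forall>x\<in>U. GDERIV \<psi> x :> G x \<and> G x \<noteq> 0) \<and>
     (\<exists>H :: real^'n \<Rightarrow> real^'n^'n.
        continuous_on U H \<and> (\<forall>x\<in>U. (G has_derivative (\<lambda>v. H x *v v)) (at x))) \<and>
     \<Omega> \<inter> U = {x \<in> U. \<psi> x < 0} \<and>
     frontier \<Omega> \<inter> U = {x \<in> U. \<psi> x = 0}"

definition C2_boundary :: "(real^'n) set \<Rightarrow> bool" where
  "C2_boundary \<Omega> \<longleftrightarrow> (\<forall>x\<in>frontier \<Omega>. \<exists>U \<psi> G. x \<in> U \<and> C2_defining_function \<Omega> U \<psi> G)"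

definition outward_normal :: "(real^'n) set \<Rightarrow> real^'n \<Rightarrow> real^'n" where
  "outward_normal \<Omega> x =
     (THE \<nu>. \<exists>U \<psi> G. x \<in> U \<and> C2_defining_function \<Omega> U \<psi> G \<and> \<nu> = sgn (G x))"

definition has_C1_projection :: "(real^'n) set \<Rightarrow> real \<Rightarrow> bool" where
  "has_C1_projection \<Gamma> \<delta> \<longleftrightarrow>
     (let T = {x. infdist x \<Gamma> < \<delta>} in
       (\<forall>x\<in>T. \<exists>!y. y \<in> \<Gamma> \<and> dist x y = infdist x \<Gamma>) \<and>
       (\<exists>D :: real^'n \<Rightarrow> real^'n^'n.
          continuous_on T D \<and>
          (\<forall>x\<in>T. (closest_point \<Gamma> has_derivative (\<lambda>v. D x *v v)) (at x))))"

text \<open>A connected topological surface, possibly with boundary.\<close>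

definition single_surface :: "'a::topological_space set \<Rightarrow> bool" where
  "single_surface S \<longleftrightarrow>
     connected S \<and>
     (\<forall>x\<in>S. \<exists>U W. x \<in> U \<and> openin (top_of_set S) U \<and>
               openin (top_of_set {y :: real^2. 0 \<le> y $ 1}) W \<and> U homeomorphic W)"

section \<open>Nested Cartesian grids\<close>

text \<open>A configuration is a domain together with a grid hierarchy: level \<open>l \<in> {0..levels}\<close> is the
  lattice of closed cubes of edge \<open>h0 / 2 ^ l\<close> anchored at \<open>origin\<close>. The whole lattice
  serves as background grid; cells are indexed by their lower corner, cells and vertices alike
  by integer vectors.\<close>

record ('n::finite) cut_config =
  Omega :: "(real^'n) set"
  origin :: "real^'n"
  h0 :: real
  levels :: nat

definition Gam :: "('n::finite) cut_config \<Rightarrow> (real^'n) set" where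
  "Gam c = frontier (Omega c)"

definition edge :: "('n::finite) cut_config \<Rightarrow> nat \<Rightarrow> real" where
  "edge c l = h0 c / 2 ^ l"

definition vertex :: "('n::finite) cut_config \<Rightarrow> nat \<Rightarrow> int^'n \<Rightarrow> real^'n" where
  "vertex c l k = origin c + edge c l *\<^sub>R (\<chi> i. of_int (k $ i))"

definition cell :: "('n::finite) cut_config \<Rightarrow> nat \<Rightarrow> int^'n \<Rightarrow> (real^'n) set" where
  "cell c l k = cbox (vertex c l k) (vertex c l (k + (\<chi> i. 1)))"

text \<open>The face between the cells \<open>k\<close> and \<open>k + axis i 1\<close>, with unit normal \<open>axis i 1\<close>.\<close>

definition face :: "('n::finite) cut_config \<Rightarrow> nat \<Rightarrow> int^'n \<Rightarrow> 'n \<Rightarrow> (real^'n) set" where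
  "face c l k i = cell c l k \<inter> cell c l (k + axis i 1)"

definition active :: "('n::finite) cut_config \<Rightarrow> nat \<Rightarrow> (int^'n) set" where
  "active c l = {k. cell c l k \<inter> Omega c \<noteq> {}}"

definition is_cut :: "('n::finite) cut_config \<Rightarrow> nat \<Rightarrow> int^'n \<Rightarrow> bool" where
  "is_cut c l k \<longleftrightarrow> cell c l k \<inter> Gam c \<noteq> {}"

definition active_region :: "('n::finite) cut_config \<Rightarrow> nat \<Rightarrow> (real^'n) set" where
  "active_region c l = (\<Union>k\<in>active c l. cell c l k)"

definition ghost_faces :: "('n::finite) cut_config \<Rightarrow> nat \<Rightarrow> ((int^'n) \<times> 'n) set" where
  "ghost_faces c l = {(k, i). k \<in> active c l \<and> k + axis i 1 \<in> active c l \<and>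
                              (is_cut c l k \<or> is_cut c l (k + axis i 1))}"

text \<open>A closed face is met at most once if its intersection with the boundary is connected
  or empty; for \<open>d = 2\<close>, where the boundary meets each cell boundary in finitely many points,
  this says that there is at most one intersection point.\<close>

definition resolved_cell :: "('n::finite) cut_config \<Rightarrow> nat \<Rightarrow> int^'n \<Rightarrow> bool" where
  "resolved_cell c l k \<longleftrightarrow>
     (CARD('n) = 2 \<longrightarrow>
        (\<exists>\<rho>. arc \<rho> \<and> path_image \<rho> = Gam c \<inter> cell c l k) \<and>
        card (Gam c \<inter> frontier (cell c l k)) = 2) \<and>
     (CARD('n) = 3 \<longrightarrow>
        single_surface (Gam c \<inter> cell c l k) \<and>
        (\<exists>\<rho>. simple_path \<rho> \<and> pathfinish \<rho> = pathstart \<rho> \<and>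
             path_image \<rho> = Gam c \<inter> frontier (cell c l k))) \<and>
     (\<forall>i. connected (Gam c \<inter> face c l k i) \<and> connected (Gam c \<inter> face c l (k - axis i 1) i)) \<and>
     card (components (cell c l k - Gam c)) = 2"

definition geometric_assumption :: "('n::finite) cut_config \<Rightarrow> bool" where
  "geometric_assumption c \<longleftrightarrow>
     open (Omega c) \<and> connected (Omega c) \<and> bounded (Omega c) \<and> Omega c \<noteq> {} \<and>
     0 < h0 c \<and>
     C2_boundary (Omega c) \<and>
     (\<exists>\<delta>>0. has_C1_projection (Gam c) \<delta> \<and>
        (\<forall>l\<in>{1..levels c}.
           (24 * real CARD('n) + 10 * sqrt (real CARD('n))) * edge c (l - 1) \<le> \<delta>)) \<and>
     (\<forall>l\<le>levels c. \<forall>k. is_cut c l k \<longrightarrow> resolved_cell c l k) \<and>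
     (\<forall>l\<le>levels c. \<forall>k. vertex c l k \<notin> Gam c) \<and>
     (\<forall>l\<in>{1..levels c}. active_region c l \<subseteq> active_region c (l - 1))"

section \<open>Finite element spaces\<close>

definition Qpoly :: "nat \<Rightarrow> (real^'n \<Rightarrow> real) set" where
  "Qpoly p = {q. \<exists>a :: ('n \<Rightarrow> nat) \<Rightarrow> real.
                 q = (\<lambda>x. \<Sum>\<alpha> | \<forall>i. \<alpha> i \<le> p. a \<alpha> * (\<Prod>i\<in>UNIV. x $ i ^ \<alpha> i))}"

text \<open>A function on the active region is represented by its extension by zero.\<close>

definition fe_space :: "nat \<Rightarrow> ('n::finite) cut_config \<Rightarrow> nat \<Rightarrow> (real^'n \<Rightarrow> real) set" where
  "fe_space p c l =
     {v. continuous_on (active_region c l) v \<and>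
         (\<forall>k\<in>active c l. \<exists>q\<in>Qpoly p. \<forall>x\<in>cell c l k. v x = q x) \<and>
         (\<forall>x. x \<notin> active_region c l \<longrightarrow> v x = 0)}"

text \<open>The end points and the zeros of \<open>P\<^sub>p'\<close> on the reference interval \<open>[-1, 1]\<close>, where the
  Legendre polynomial \<open>P\<^sub>p\<close> is, up to a factor, the \<open>p\<close>-th derivative of \<open>(t\<^sup>2 - 1) ^ p\<close>.\<close>

definition gauss_lobatto :: "nat \<Rightarrow> real set" where
  "gauss_lobatto p = {-1, 1} \<union> {t. poly ((pderiv ^^ (p + 1)) ([:-1, 0, 1:] ^ p)) t = 0}"

definition nodes :: "nat \<Rightarrow> ('n::finite) cut_config \<Rightarrow> nat \<Rightarrow> (real^'n) set" where
  "nodes p c l =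
     {vertex c l k + edge c l *\<^sub>R (\<chi> i. (1 + t i) / 2) | k t.
        k \<in> active c l \<and> (\<forall>i. t i \<in> gauss_lobatto p)}"

definition nodal_basis ::
    "nat \<Rightarrow> ('n::finite) cut_config \<Rightarrow> nat \<Rightarrow> real^'n \<Rightarrow> real^'n \<Rightarrow> real" where
  "nodal_basis p c l y =
     (THE \<phi>. \<phi> \<in> fe_space p c l \<and> (\<forall>z\<in>nodes p c l. \<phi> z = (if z = y then 1 else 0)))"

definition nodal_span ::
    "nat \<Rightarrow> ('n::finite) cut_config \<Rightarrow> nat \<Rightarrow> (real^'n) set \<Rightarrow> (real^'n \<Rightarrow> real) set" where
  "nodal_span p c l Y = {v. \<exists>a. v = (\<lambda>x. \<Sum>y\<in>Y. a y * nodal_basis p c l y x)}"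

definition prolong ::
    "('n::finite) cut_config \<Rightarrow> nat \<Rightarrow> (real^'n \<Rightarrow> real) \<Rightarrow> real^'n \<Rightarrow> real" where
  "prolong c l v = (\<lambda>x. if x \<in> active_region c l then v x else 0)"

section \<open>Bilinear forms\<close>

text \<open>At points where \<open>v\<close> is not differentiable, a null set for piecewise polynomials, the value
  is irrelevant.\<close>

definition grad :: "(real^'n \<Rightarrow> real) \<Rightarrow> real^'n \<Rightarrow> real^'n" where
  "grad v x = (THE D. GDERIV v x :> D)"

text \<open>The trace of the normal derivative is taken from inside the domain, as a one-sided
  derivative, so that it is also defined where the boundary crosses a cell face.\<close>

definition dn :: "('n::finite) cut_config \<Rightarrow> (real^'n \<Rightarrow> real) \<Rightarrow> real^'n \<Rightarrow> real" where
  "dn c v x = vector_derivative (\<lambda>t. v (x + t *\<^sub>R outward_normal (Omega c) x)) (at 0 within {..0})"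

definition inner_Omega ::
    "('n::finite) cut_config \<Rightarrow> (real^'n \<Rightarrow> real^'n) \<Rightarrow> (real^'n \<Rightarrow> real^'n) \<Rightarrow> real" where
  "inner_Omega c F G = (LINT x:Omega c|lebesgue. F x \<bullet> G x)"

definition inner_Gam ::
    "('n::finite) cut_config \<Rightarrow> (real^'n \<Rightarrow> real) \<Rightarrow> (real^'n \<Rightarrow> real) \<Rightarrow> real" where
  "inner_Gam c f g = (LINT x:Gam c|surface_measure. f x * g x)"

definition nitsche_form ::
    "real \<Rightarrow> ('n::finite) cut_config \<Rightarrow> nat \<Rightarrow> (real^'n \<Rightarrow> real) \<Rightarrow> (real^'n \<Rightarrow> real) \<Rightarrow> real" where
  "nitsche_form \<gamma>D c l u v =
     inner_Omega c (grad u) (grad v) - inner_Gam c (dn c u) v - inner_Gam c u (dn c v)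
     + \<gamma>D * inverse (edge c l) * inner_Gam c u v"

definition cell_poly ::
    "nat \<Rightarrow> ('n::finite) cut_config \<Rightarrow> nat \<Rightarrow> int^'n \<Rightarrow> (real^'n \<Rightarrow> real) \<Rightarrow> real^'n \<Rightarrow> real" where
  "cell_poly p c l k v = (THE q. q \<in> Qpoly p \<and> (\<forall>x\<in>cell c l k. q x = v x))"

definition jump_dn ::
    "nat \<Rightarrow> ('n::finite) cut_config \<Rightarrow> nat \<Rightarrow> int^'n \<Rightarrow> 'n \<Rightarrow> nat \<Rightarrow> (real^'n \<Rightarrow> real) \<Rightarrow> real^'n \<Rightarrow> real"
  where
  "jump_dn p c l k i m v x =
     (deriv ^^ m) (\<lambda>t. cell_poly p c l (k + axis i 1) v (x + t *\<^sub>R axis i 1)) 0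
     - (deriv ^^ m) (\<lambda>t. cell_poly p c l k v (x + t *\<^sub>R axis i 1)) 0"

definition ghost_form ::
    "nat \<Rightarrow> real \<Rightarrow> ('n::finite) cut_config \<Rightarrow> nat \<Rightarrow> (real^'n \<Rightarrow> real) \<Rightarrow> (real^'n \<Rightarrow> real) \<Rightarrow> real"
  where
  "ghost_form p \<gamma> c l u v =
     \<gamma> * (\<Sum>(k, i)\<in>ghost_faces c l. \<Sum>m=1..p.
            edge c l ^ (2 * m - 1) / (fact m)\<^sup>2 *
            (LINT x:face c l k i|surface_measure. jump_dn p c l k i m u x * jump_dn p c l k i m v x))"

definition A_form ::
    "nat \<Rightarrow> real \<Rightarrow> real \<Rightarrow> ('n::finite) cut_config \<Rightarrow> nat \<Rightarrow>
     (real^'n \<Rightarrow> real) \<Rightarrow> (real^'n \<Rightarrow> real) \<Rightarrow> real" where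
  "A_form p \<gamma> \<gamma>D c l u v = nitsche_form \<gamma>D c l u v + ghost_form p \<gamma> c l u v"

definition A_norm ::
    "nat \<Rightarrow> real \<Rightarrow> real \<Rightarrow> ('n::finite) cut_config \<Rightarrow> nat \<Rightarrow> (real^'n \<Rightarrow> real) \<Rightarrow> real" where
  "A_norm p \<gamma> \<gamma>D c l v = sqrt (A_form p \<gamma> \<gamma>D c l v v)"

definition N_norm_sq ::
    "nat \<Rightarrow> real \<Rightarrow> ('n::finite) cut_config \<Rightarrow> nat \<Rightarrow> (real^'n \<Rightarrow> real) \<Rightarrow> real" where
  "N_norm_sq p \<gamma> c l v =
     inner_Omega c (grad v) (grad v) + edge c l * inner_Gam c (dn c v) (dn c v)
     + inverse (edge c l) * inner_Gam c v v + ghost_form p \<gamma> c l v v"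

text \<open>One triple of constants for all levels of all configurations in the family.\<close>

definition stability_assumption ::
    "nat \<Rightarrow> real \<Rightarrow> real \<Rightarrow> ('n::finite) cut_config set \<Rightarrow> bool" where
  "stability_assumption p \<gamma> \<gamma>D \<C> \<longleftrightarrow>
     (\<exists>cA>0. \<exists>CA>0. \<exists>C>0. \<forall>c\<in>\<C>. \<forall>l\<le>levels c. \<forall>u\<in>fe_space p c l. \<forall>v\<in>fe_space p c l.
        cA * N_norm_sq p \<gamma> c l v \<le> A_form p \<gamma> \<gamma>D c l v v \<and>
        A_form p \<gamma> \<gamma>D c l u v \<le> CA * sqrt (N_norm_sq p \<gamma> c l u) * sqrt (N_norm_sq p \<gamma> c l v) \<and>
        (LINT x:(active_region c l - Omega c)|lebesgue. grad v x \<bullet> grad v x)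
          \<le> C * (inner_Omega c (grad v) (grad v) + ghost_form p \<gamma> c l v v))"

section \<open>Patches and subspaces\<close>

definition admissible_vertices :: "('n::finite) cut_config \<Rightarrow> nat \<Rightarrow> (int^'n) set" where
  "admissible_vertices c l =
     {j. vertex c l j \<in> Omega c \<or>
         (vertex c l j \<notin> closure (Omega c) \<and> (\<exists>k. vertex c l j \<in> cell c l k \<and> is_cut c l k))}"

definition background_patch :: "('n::finite) cut_config \<Rightarrow> nat \<Rightarrow> int^'n \<Rightarrow> (real^'n) set" where
  "background_patch c l j = \<Union>{cell c l k | k. vertex c l j \<in> cell c l k}"

definition active_patch_at :: "('n::finite) cut_config \<Rightarrow> nat \<Rightarrow> real^'n \<Rightarrow> (real^'n) set" where
  "active_patch_at c l x = \<Union>{cell c l k | k. k \<in> active c l \<and> x \<in> cell c l k}"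

datatype patch_kind = Classical | Full_Residual

definition local_space ::
    "patch_kind \<Rightarrow> nat \<Rightarrow> ('n::finite) cut_config \<Rightarrow> nat \<Rightarrow> int^'n \<Rightarrow> (real^'n \<Rightarrow> real) set" where
  "local_space \<kappa> p c l j =
     (case \<kappa> of
        Classical \<Rightarrow> nodal_span p c l {x \<in> nodes p c l. x \<in> interior (background_patch c l j)}
      | Full_Residual \<Rightarrow> nodal_span p c l
          {x \<in> nodes p c l. active_patch_at c l x \<subseteq> active_patch_at c l (vertex c l j)})"

definition coarse_space :: "nat \<Rightarrow> ('n::finite) cut_config \<Rightarrow> nat \<Rightarrow> (real^'n \<Rightarrow> real) set" where
  "coarse_space p c l = prolong c l ` fe_space p c (l - 1)"

definition covering_assumption :: "patch_kind \<Rightarrow> nat \<Rightarrow> ('n::finite) cut_config \<Rightarrow> nat \<Rightarrow> bool" where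
  "covering_assumption \<kappa> p c l \<longleftrightarrow>
     (\<forall>x\<in>nodes p c l. \<exists>j\<in>admissible_vertices c l. nodal_basis p c l x \<in> local_space \<kappa> p c l j)"

definition is_prolongation_constant ::
    "nat \<Rightarrow> real \<Rightarrow> real \<Rightarrow> ('n::finite) cut_config set \<Rightarrow> real \<Rightarrow> bool" where
  "is_prolongation_constant p \<gamma> \<gamma>D \<C> Cpr \<longleftrightarrow>
     (\<forall>c\<in>\<C>. \<forall>l\<in>{1..levels c}. \<forall>v\<in>fe_space p c (l - 1).
        A_norm p \<gamma> \<gamma>D c l (prolong c l v) \<le> Cpr * A_norm p \<gamma> \<gamma>D c (l - 1) v)"

definition is_decomposition_constant ::
    "patch_kind \<Rightarrow> nat \<Rightarrow> real \<Rightarrow> real \<Rightarrow> ('n::finite) cut_config set \<Rightarrow> real \<Rightarrow> bool" where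
  "is_decomposition_constant \<kappa> p \<gamma> \<gamma>D \<C> Csd \<longleftrightarrow>
     (\<forall>c\<in>\<C>. \<forall>l\<in>{1..levels c}. \<forall>v\<in>fe_space p c l.
        \<exists>w0\<in>fe_space p c (l - 1). \<exists>w.
          (\<forall>j\<in>admissible_vertices c l. w j \<in> local_space \<kappa> p c l j) \<and>
          v = (\<lambda>x. prolong c l w0 x + (\<Sum>j\<in>admissible_vertices c l. w j x)) \<and>
          (A_norm p \<gamma> \<gamma>D c l (prolong c l w0))\<^sup>2
            + (\<Sum>j\<in>admissible_vertices c l. (A_norm p \<gamma> \<gamma>D c l (w j))\<^sup>2)
            \<le> Csd * (A_norm p \<gamma> \<gamma>D c l v)\<^sup>2 \<and>
          (A_norm p \<gamma> \<gamma>D c (l - 1) w0)\<^sup>2 \<le> Csd * (A_norm p \<gamma> \<gamma>D c l v)\<^sup>2)"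

section \<open>Two-level operators\<close>

type_synonym 'n fe_operator = "(real^'n \<Rightarrow> real) \<Rightarrow> (real^'n \<Rightarrow> real)"

definition A_projection ::
    "nat \<Rightarrow> real \<Rightarrow> real \<Rightarrow> ('n::finite) cut_config \<Rightarrow> nat \<Rightarrow> (real^'n \<Rightarrow> real) set \<Rightarrow> 'n fe_operator"
  where
  "A_projection p \<gamma> \<gamma>D c l S v =
     (THE u. u \<in> S \<and> (\<forall>w\<in>S. A_form p \<gamma> \<gamma>D c l u w = A_form p \<gamma> \<gamma>D c l v w))"

definition local_proj ::
    "patch_kind \<Rightarrow> nat \<Rightarrow> real \<Rightarrow> real \<Rightarrow> ('n::finite) cut_config \<Rightarrow> nat \<Rightarrow> int^'n \<Rightarrow> 'n fe_operator"
  where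
  "local_proj \<kappa> p \<gamma> \<gamma>D c l j = A_projection p \<gamma> \<gamma>D c l (local_space \<kappa> p c l j)"

definition coarse_proj ::
    "nat \<Rightarrow> real \<Rightarrow> real \<Rightarrow> ('n::finite) cut_config \<Rightarrow> nat \<Rightarrow> 'n fe_operator" where
  "coarse_proj p \<gamma> \<gamma>D c l = A_projection p \<gamma> \<gamma>D c l (coarse_space p c l)"

definition restrict_rediscretized ::
    "nat \<Rightarrow> real \<Rightarrow> real \<Rightarrow> ('n::finite) cut_config \<Rightarrow> nat \<Rightarrow> 'n fe_operator" where
  "restrict_rediscretized p \<gamma> \<gamma>D c l u =
     (THE w. w \<in> fe_space p c (l - 1) \<and>
        (\<forall>z\<in>fe_space p c (l - 1).
           A_form p \<gamma> \<gamma>D c (l - 1) w z = A_form p \<gamma> \<gamma>D c l u (prolong c l z)))"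

definition T0_op ::
    "nat \<Rightarrow> real \<Rightarrow> real \<Rightarrow> real \<Rightarrow> ('n::finite) cut_config \<Rightarrow> nat \<Rightarrow> 'n fe_operator" where
  "T0_op p \<gamma> \<gamma>D Cpr c l u =
     (\<lambda>x. inverse (Cpr\<^sup>2) * prolong c l (restrict_rediscretized p \<gamma> \<gamma>D c l u) x)"

definition P_ad ::
    "patch_kind \<Rightarrow> nat \<Rightarrow> real \<Rightarrow> real \<Rightarrow> ('n::finite) cut_config \<Rightarrow> nat \<Rightarrow> 'n fe_operator" where
  "P_ad \<kappa> p \<gamma> \<gamma>D c l v =
     (\<lambda>x. coarse_proj p \<gamma> \<gamma>D c l v x
          + (\<Sum>j\<in>admissible_vertices c l. local_proj \<kappa> p \<gamma> \<gamma>D c l j v x))"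

definition residual_op :: "'n fe_operator \<Rightarrow> 'n fe_operator" where
  "residual_op T v = (\<lambda>x. v x - T v x)"

text \<open>The product of the operators \<open>I - T\<close> over the list; the head of the list acts first.\<close>

definition error_op :: "'n fe_operator list \<Rightarrow> 'n fe_operator" where
  "error_op Ts = fold residual_op Ts"

definition enumerates :: "'a list \<Rightarrow> 'a set \<Rightarrow> bool" where
  "enumerates js S \<longleftrightarrow> distinct js \<and> set js = S"

definition A_opnorm ::
    "nat \<Rightarrow> real \<Rightarrow> real \<Rightarrow> ('n::finite) cut_config \<Rightarrow> nat \<Rightarrow> 'n fe_operator \<Rightarrow> real" where
  "A_opnorm p \<gamma> \<gamma>D c l T =
     (SUP v\<in>{v \<in> fe_space p c l. v \<noteq> (\<lambda>x. 0)}. A_norm p \<gamma> \<gamma>D c l (T v) / A_norm p \<gamma> \<gamma>D c l v)"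

text \<open>Meaningful when \<open>T\<close> is a bijection of the finite element space.\<close>

definition cond_number ::
    "nat \<Rightarrow> real \<Rightarrow> real \<Rightarrow> ('n::finite) cut_config \<Rightarrow> nat \<Rightarrow> 'n fe_operator \<Rightarrow> real" where
  "cond_number p \<gamma> \<gamma>D c l T =
     A_opnorm p \<gamma> \<gamma>D c l T * A_opnorm p \<gamma> \<gamma>D c l (inv_into (fe_space p c l) T)"

definition iteration_converges ::
    "nat \<Rightarrow> real \<Rightarrow> real \<Rightarrow> ('n::finite) cut_config \<Rightarrow> nat \<Rightarrow> 'n fe_operator \<Rightarrow> bool" where
  "iteration_converges p \<gamma> \<gamma>D c l E \<longleftrightarrow>
     (\<forall>v\<in>fe_space p c l. (\<lambda>n. A_norm p \<gamma> \<gamma>D c l ((E ^^ n) v)) \<longlonglongrightarrow> 0)"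

text \<open>\<open>M\<close> is the preconditioned operator: a symmetric positive definite preconditioner makes it
  self-adjoint and positive definite in the \<open>A\<close>-inner product.\<close>

definition spd_with_cond_le ::
    "nat \<Rightarrow> real \<Rightarrow> real \<Rightarrow> ('n::finite) cut_config \<Rightarrow> nat \<Rightarrow> 'n fe_operator \<Rightarrow> real \<Rightarrow> bool" where
  "spd_with_cond_le p \<gamma> \<gamma>D c l M K \<longleftrightarrow>
     bij_betw M (fe_space p c l) (fe_space p c l) \<and>
     (\<forall>v\<in>fe_space p c l. \<forall>w\<in>fe_space p c l.
        A_form p \<gamma> \<gamma>D c l (M v) w = A_form p \<gamma> \<gamma>D c l v (M w)) \<and>
     (\<forall>v\<in>fe_space p c l. v \<noteq> (\<lambda>x. 0) \<longrightarrow> 0 < A_form p \<gamma> \<gamma>D c l (M v) v) \<and>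
     cond_number p \<gamma> \<gamma>D c l M \<le> K"

end

theory Submission
  imports Defs "HOL-Library.Function_Algebras"
begin

text \<open>
  Write \<open>A\<close> for the form \<open>A_form p \<gamma> \<gamma>D c l\<close> and \<open>|v|\<^sup>2 = A v v\<close>. Once \<open>A\<close> is known to be an inner product
  on the finite element space \<open>V\<close> and every exact solve to be an \<open>A\<close>-orthogonal projection, the theorem is a
  statement about subspace corrections that uses three facts: every \<open>v\<close> splits stably into a coarse part
  and patch parts (the constant \<open>Csd\<close>), each patch interacts with at most \<open>N = 5 ^ d\<close> patches, and the
  coarse solver \<open>T\<close> satisfies \<open>A (T v) (T v) \<le> A (T v) v\<close>.

  For the additive method, \<open>A v v = \<Sum> A (v\<^sub>j) (P\<^sub>j v)\<close> and Cauchy-Schwarz give the lower bound, and the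
  Schur bound for the sparse interaction matrix gives the upper one (\<open>additive_bounds\<close>).

  For the multiplicative method, let \<open>e = u - T u\<close> be the error after the coarse correction, and let \<open>F\<close> be
  the sweep over the patches. The sweep loses exactly the energy \<open>Y = |e|\<^sup>2 - |F e|\<^sup>2\<close> of the successive
  corrections (\<open>sweep_energy\<close>), the coarse step leaves a gap \<open>a = A e u - |e|\<^sup>2 \<ge> 0\<close>, and testing \<open>e\<close>
  with its stable splitting bounds \<open>|e|\<^sup>2\<close> by a multiple of \<open>a + Y\<close>. Hence
  \<open>|F e|\<^sup>2 \<le> (1 - 1/K) A e u\<close> (\<open>sweep_contraction\<close>). The right-hand side is the energy of the square root of
  \<open>I - T\<close>, so this single inequality bounds the error operator \<open>F (I - T)\<close>, its adjoint, and the symmetrized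
  operator \<open>F (I - T) F\<^sup>*\<close>, for the exact coarse projection and for the rediscretized solver alike: they differ only
  in how the coarse part of a splitting is controlled (factor \<open>1\<close> or \<open>Cpr\<^sup>2\<close>).

  It remains to justify the three facts and the inner product for the concrete spaces. Bilinearity of \<open>A\<close>
  rests on integrability: gradients are piecewise continuous away from a null set of cell faces, the
  normal derivative on the boundary is a bounded Borel function because it is a limit of difference
  quotients along the inward normal, and the boundary has finite surface measure because it is locally the
  graph of a Lipschitz function (\<open>lipschitz_graph_finite_measure\<close>). Definiteness
  (\<open>energy_definite\<close>) comes from the stability assumption: if \<open>A v v = 0\<close>, then \<open>v\<close> is constant on the
  connected active region and vanishes in the mean square on the boundary. To conclude \<open>v = 0\<close> the surface
  measure must be a genuine measure, which is Caratheodory's criterion for the metric outer measure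
  \<open>hausdorff_outer\<close>, and positive on the boundary, which follows by projecting the boundary along a
  coordinate axis (\<open>frontier_positive_measure\<close>).

  The patch spaces are spanned by nodal basis functions. These exist because the \<open>p + 1\<close> Gauss-Lobatto points
  are unisolvent in each direction and contain both end points, so that piecewise Lagrange polynomials
  glue to continuous functions of one variable whose tensor products are the nodal basis (\<open>nodal_basis_eq\<close>).
  Functions of a patch space vanish on all active cells that do not touch the vertex of the patch; ghost
  penalties couple neighbouring cells, so patches interact only if their vertices differ by at most \<open>2\<close> in
  each coordinate (\<open>locality\<close>), which leaves \<open>5 ^ d\<close> of them.
\<close>

section \<open>Energy forms\<close>

text \<open>Finite element functions are added and scaled pointwise; as elements of a real vector space they
  are covered by the library notions of subspace, span and linear map.\<close>

instantiation "fun" :: (type, real_vector) real_vector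
begin

definition scaleR_fun :: "real \<Rightarrow> ('a \<Rightarrow> 'b) \<Rightarrow> 'a \<Rightarrow> 'b" where
  "scaleR_fun r f = (\<lambda>x. r *\<^sub>R f x)"

instance
  by standard (simp_all add: scaleR_fun_def fun_eq_iff algebra_simps)

end

lemma scaleR_fun_apply [simp]: "(r *\<^sub>R f) x = r *\<^sub>R f x"
  by (simp add: scaleR_fun_def)

lemma sum_fun_apply [simp]: "(\<Sum>i\<in>I. f i) x = (\<Sum>i\<in>I. f i x)"
  by (induction I rule: infinite_finite_induct) auto

text \<open>Semidefinite forms are separated from inner products because \<open>\<lambda>u. A (T u)\<close> is again a semidefinite form
  when \<open>T\<close> is a positive semidefinite operator; Cauchy-Schwarz for that form is what bounds norms of \<open>T\<close>.\<close>

locale psd_form =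
  fixes V :: "'a::real_vector set" and A :: "'a \<Rightarrow> 'a \<Rightarrow> real"
  assumes subspace: "subspace V"
    and add_left: "\<lbrakk>u \<in> V; v \<in> V; w \<in> V\<rbrakk> \<Longrightarrow> A (u + v) w = A u w + A v w"
    and scale_left: "\<lbrakk>u \<in> V; w \<in> V\<rbrakk> \<Longrightarrow> A (c *\<^sub>R u) w = c * A u w"
    and form_sym: "\<lbrakk>u \<in> V; w \<in> V\<rbrakk> \<Longrightarrow> A u w = A w u"
    and nonneg: "u \<in> V \<Longrightarrow> 0 \<le> A u u"
begin

lemmas in_V [simp, intro] = subspace_0[OF subspace] subspace_add[OF subspace]
  subspace_diff[OF subspace] subspace_scale[OF subspace]

lemma sum_in_V [simp, intro]: "(\<And>i. i \<in> I \<Longrightarrow> f i \<in> V) \<Longrightarrow> sum f I \<in> V"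
  using subspace by (rule subspace_sum)

lemma zero_left [simp]: "w \<in> V \<Longrightarrow> A 0 w = 0"
  using scale_left[of 0 w 0] by simp

lemma diff_left: "\<lbrakk>u \<in> V; v \<in> V; w \<in> V\<rbrakk> \<Longrightarrow> A (u - v) w = A u w - A v w"
  using add_left[of "u - v" v w] by simp

lemma add_right: "\<lbrakk>u \<in> V; v \<in> V; w \<in> V\<rbrakk> \<Longrightarrow> A w (u + v) = A w u + A w v"
  by (metis add_left form_sym in_V(2))

lemma diff_right: "\<lbrakk>u \<in> V; v \<in> V; w \<in> V\<rbrakk> \<Longrightarrow> A w (u - v) = A w u - A w v"
  by (metis diff_left form_sym in_V(3))

lemma scale_right: "\<lbrakk>u \<in> V; w \<in> V\<rbrakk> \<Longrightarrow> A w (c *\<^sub>R u) = c * A w u"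
  by (metis scale_left form_sym in_V(4))

lemma zero_right [simp]: "w \<in> V \<Longrightarrow> A w 0 = 0"
  using scale_right[of 0 w 0] by simp

lemma sum_left:
  "\<lbrakk>\<And>i. i \<in> I \<Longrightarrow> f i \<in> V; w \<in> V\<rbrakk> \<Longrightarrow> A (sum f I) w = (\<Sum>i\<in>I. A (f i) w)"
  by (induction I rule: infinite_finite_induct) (auto simp: add_left)

lemma sum_right:
  "\<lbrakk>\<And>i. i \<in> I \<Longrightarrow> f i \<in> V; w \<in> V\<rbrakk> \<Longrightarrow> A w (sum f I) = (\<Sum>i\<in>I. A w (f i))"
  by (induction I rule: infinite_finite_induct) (auto simp: add_right)

lemma Cauchy_Schwarz_sq:
  assumes u: "u \<in> V" and v: "v \<in> V"
  shows "(A u v)\<^sup>2 \<le> A u u * A v v"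
proof -
  have q: "0 \<le> A u u + 2 * t * A u v + t\<^sup>2 * A v v" for t
    using nonneg[of "u + t *\<^sub>R v"] u v form_sym[of v u]
    by (simp add: add_left add_right scale_left scale_right power2_eq_square algebra_simps)
  show ?thesis
  proof (cases "A v v = 0")
    case True
    have "A u v = 0"
    proof (rule ccontr)
      assume n: "A u v \<noteq> 0"
      \<comment> \<open>here the quadratic is affine in \<open>t\<close>; this \<open>t\<close> gives it the value \<open>- 1\<close>\<close>
      show False using q[of "- (A u u + 1) / (2 * A u v)"] n True
        by (simp add: field_simps)
    qed
    then show ?thesis using True by simp
  next
    case False
    then have p: "A v v > 0" using nonneg[OF v] by simp
    have "0 \<le> A v v * (A u u + 2 * (- A u v / A v v) * A u v + (- A u v / A v v)\<^sup>2 * A v v)"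
      using q[of "- A u v / A v v"] p by (intro mult_nonneg_nonneg) auto
    also have "\<dots> = A u u * A v v - (A u v)\<^sup>2"
      using p by (simp add: field_simps power2_eq_square)
    finally show ?thesis by simp
  qed
qed

lemma Cauchy_Schwarz:
  assumes "u \<in> V" "v \<in> V"
  shows "A u v \<le> sqrt (A u u) * sqrt (A v v)"
  using Cauchy_Schwarz_sq[OF assms] by (metis real_le_rsqrt real_sqrt_mult)

lemma Cauchy_Schwarz_abs:
  assumes "u \<in> V" "v \<in> V"
  shows "A u v \<le> \<bar>sqrt (A u u)\<bar> * \<bar>sqrt (A v v)\<bar>"
  using Cauchy_Schwarz[OF assms] assms nonneg by simp

definition self_adjoint :: "('a \<Rightarrow> 'a) \<Rightarrow> bool" where
  "self_adjoint T \<longleftrightarrow> (\<forall>u\<in>V. T u \<in> V) \<and> (\<forall>u\<in>V. \<forall>v\<in>V. A (T u) v = A u (T v))"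

lemma self_adjointD:
  assumes "self_adjoint T"
  shows "u \<in> V \<Longrightarrow> T u \<in> V" "\<lbrakk>u \<in> V; v \<in> V\<rbrakk> \<Longrightarrow> A (T u) v = A u (T v)"
  using assms by (auto simp: self_adjoint_def)

lemma self_adjoint_residual: "self_adjoint T \<Longrightarrow> self_adjoint (\<lambda>v. v - T v)"
  unfolding self_adjoint_def by (auto simp: diff_left diff_right)

text \<open>Self-adjointness carries \<open>T\<close> over to the test function, so the form is additive even though \<open>T\<close> is an
  arbitrary map.\<close>

lemma psd_form_operator:
  assumes T: "self_adjoint T" and pos: "\<And>u. u \<in> V \<Longrightarrow> 0 \<le> A (T u) u"
  shows "psd_form V (\<lambda>u. A (T u))"
proof
  note T' = self_adjointD[OF T]
  show "subspace V" by (rule subspace)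
  show "A (T (u + v)) w = A (T u) w + A (T v) w" if "u \<in> V" "v \<in> V" "w \<in> V" for u v w
    using that T' by (simp add: add_left)
  show "A (T (c *\<^sub>R u)) w = c * A (T u) w" if "u \<in> V" "w \<in> V" for u w c
    using that T' by (simp add: scale_left)
  show "A (T u) w = A (T w) u" if "u \<in> V" "w \<in> V" for u w
    using that T' form_sym by simp
qed (rule pos)

text \<open>Cauchy-Schwarz for the form of \<open>T\<close>, tested with \<open>v\<close> and \<open>T v\<close>. It stands in for the spectral theorem:
  an upper bound on the quadratic form of \<open>T\<close> controls \<open>T\<^sup>2\<close> by \<open>T\<close>.\<close>

lemma energy_operator_le:
  assumes T: "self_adjoint T" and pos: "\<And>u. u \<in> V \<Longrightarrow> 0 \<le> A (T u) u"
    and le: "\<And>u. u \<in> V \<Longrightarrow> A (T u) u \<le> b * A u u" and v: "v \<in> V"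
  shows "A (T v) (T v) \<le> b * A (T v) v"
proof -
  interpret T: psd_form V "\<lambda>u. A (T u)" by (rule psd_form_operator[OF T pos])
  have Tv: "T v \<in> V" using T v by (rule self_adjointD)
  have "(A (T v) (T v))\<^sup>2 \<le> A (T v) v * A (T (T v)) (T v)"
    using T.Cauchy_Schwarz_sq[OF v Tv] .
  also have "\<dots> \<le> A (T v) v * (b * A (T v) (T v))"
    using le[OF Tv] pos[OF v] by (rule mult_left_mono)
  finally have *: "A (T v) (T v) * A (T v) (T v) \<le> (b * A (T v) v) * A (T v) (T v)"
    by (simp add: power2_eq_square algebra_simps)
  show ?thesis
  proof (cases "A (T v) (T v) = 0")
    case True
    have "0 \<le> b * A (T v) v"
    proof (cases "A (T v) v = 0")
      case False
      then have "0 < b * A v v" using le[OF v] pos[OF v] by linarith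
      then show ?thesis using pos[OF v] nonneg[OF v]
        by (metis less_eq_real_def mult_nonneg_nonneg zero_less_mult_pos2 mult_zero_right)
    qed simp
    then show ?thesis using True by simp
  next
    case False
    then show ?thesis using * nonneg[OF Tv] mult_le_cancel_right_pos by fastforce
  qed
qed

end

text \<open>Cauchy-Schwarz over the related pairs: in either factor every square is repeated at most \<open>N\<close> times.\<close>

lemma Schur_bound:
  fixes x y :: "'i \<Rightarrow> real"
  assumes fin: "finite I"
    and row: "\<And>i. i \<in> I \<Longrightarrow> real (card {k \<in> I. R i k}) \<le> N"
    and col: "\<And>k. k \<in> I \<Longrightarrow> real (card {i \<in> I. R i k}) \<le> N"
    and N: "0 \<le> N"
  shows "(\<Sum>i\<in>I. \<Sum>k\<in>{k \<in> I. R i k}. \<bar>x i\<bar> * \<bar>y k\<bar>)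
          \<le> N * (sqrt (\<Sum>i\<in>I. (x i)\<^sup>2) * sqrt (\<Sum>k\<in>I. (y k)\<^sup>2))"
proof -
  define S where "S = Sigma I (\<lambda>i. {k \<in> I. R i k})"
  have "(\<Sum>i\<in>I. \<Sum>k\<in>{k \<in> I. R i k}. \<bar>x i\<bar> * \<bar>y k\<bar>)
      = (\<Sum>(i, k)\<in>S. \<bar>x i\<bar> * \<bar>y k\<bar>)"
    unfolding S_def using fin by (subst sum.Sigma) auto
  also have "\<dots> = (\<Sum>z\<in>S. \<bar>x (fst z)\<bar> * \<bar>y (snd z)\<bar>)"
    by (simp add: case_prod_beta)
  also have "\<dots> \<le> L2_set (\<lambda>z. x (fst z)) S * L2_set (\<lambda>z. y (snd z)) S"
    by (rule L2_set_mult_ineq)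
  also have "\<dots> \<le> sqrt (N * (\<Sum>i\<in>I. (x i)\<^sup>2)) * sqrt (N * (\<Sum>k\<in>I. (y k)\<^sup>2))"
  proof (rule mult_mono)
    have "(\<Sum>z\<in>S. (x (fst z))\<^sup>2) = (\<Sum>(i, k)\<in>S. (x i)\<^sup>2)"
      by (simp add: case_prod_beta)
    also have "\<dots> = (\<Sum>i\<in>I. \<Sum>k\<in>{k \<in> I. R i k}. (x i)\<^sup>2)"
      unfolding S_def using fin by (subst sum.Sigma) auto
    also have "\<dots> = (\<Sum>i\<in>I. real (card {k \<in> I. R i k}) * (x i)\<^sup>2)" by simp
    also have "\<dots> \<le> (\<Sum>i\<in>I. N * (x i)\<^sup>2)"
      by (intro sum_mono mult_right_mono row) auto
    also have "\<dots> = N * (\<Sum>i\<in>I. (x i)\<^sup>2)" by (simp add: sum_distrib_left)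
    finally show "L2_set (\<lambda>z. x (fst z)) S \<le> sqrt (N * (\<Sum>i\<in>I. (x i)\<^sup>2))"
      unfolding L2_set_def by simp
    have "(\<Sum>z\<in>S. (y (snd z))\<^sup>2) = (\<Sum>(i, k)\<in>S. (y k)\<^sup>2)"
      by (simp add: case_prod_beta)
    also have "\<dots> = (\<Sum>i\<in>I. \<Sum>k\<in>{k \<in> I. R i k}. (y k)\<^sup>2)"
      unfolding S_def using fin by (subst sum.Sigma) auto
    also have "\<dots> = (\<Sum>k\<in>I. \<Sum>i\<in>{i \<in> I. R i k}. (y k)\<^sup>2)"
      by (rule sum.swap_restrict[OF fin fin])
    also have "\<dots> = (\<Sum>k\<in>I. real (card {i \<in> I. R i k}) * (y k)\<^sup>2)" by simp
    also have "\<dots> \<le> (\<Sum>k\<in>I. N * (y k)\<^sup>2)"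
      by (intro sum_mono mult_right_mono col) auto
    also have "\<dots> = N * (\<Sum>k\<in>I. (y k)\<^sup>2)" by (simp add: sum_distrib_left)
    finally show "L2_set (\<lambda>z. y (snd z)) S \<le> sqrt (N * (\<Sum>k\<in>I. (y k)\<^sup>2))"
      unfolding L2_set_def by simp
  qed (use N in \<open>auto simp: L2_set_nonneg intro!: mult_nonneg_nonneg sum_nonneg\<close>)
  also have "\<dots> = N * (sqrt (\<Sum>i\<in>I. (x i)\<^sup>2) * sqrt (\<Sum>k\<in>I. (y k)\<^sup>2))"
    using N by (simp add: real_sqrt_mult)
  finally show ?thesis .
qed

locale energy_space = psd_form +
  assumes definite: "\<lbrakk>u \<in> V; A u u = 0\<rbrakk> \<Longrightarrow> u = 0"
begin

lemma energy_pos: "\<lbrakk>u \<in> V; u \<noteq> 0\<rbrakk> \<Longrightarrow> 0 < A u u"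
  using nonneg[of u] definite[of u] by force

lemma eq_by_testing:
  assumes "u \<in> S" "v \<in> S" "subspace S" "S \<subseteq> V" "\<And>w. w \<in> S \<Longrightarrow> A u w = A v w"
  shows "u = v"
proof -
  have uv: "u - v \<in> S" using assms by (simp add: subspace_diff)
  have "A (u - v) (u - v) = 0" using assms uv by (simp add: diff_left subset_iff)
  then show ?thesis using definite[of "u - v"] uv assms(4) by auto
qed

text \<open>Gram-Schmidt on the generators: a new generator is replaced by its component orthogonal to the
  span of the others, and the value of \<open>f\<close> there fixes the coefficient along it.\<close>

lemma Riesz_exists:
  assumes "finite B" "B \<subseteq> V"
    and "\<And>u v. \<lbrakk>u \<in> span B; v \<in> span B\<rbrakk> \<Longrightarrow> f (u + v) = f u + f v"
    and "\<And>c u. u \<in> span B \<Longrightarrow> f (c *\<^sub>R u) = c * f u"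
  shows "\<exists>u\<in>span B. \<forall>w\<in>span B. A u w = f w"
  using assms
proof (induction B arbitrary: f rule: finite_induct)
  case empty
  have "f 0 = 0" using empty(3)[of 0 0] by simp
  then show ?case by simp
next
  case (insert b B)
  have sB: "span B \<subseteq> span (insert b B)" by (rule span_mono) auto
  have BV: "span B \<subseteq> V" using insert by (intro span_minimal subspace) auto
  have bV: "b \<in> V" using insert by auto
  obtain uf where uf: "uf \<in> span B" "\<forall>w\<in>span B. A uf w = f w"
  proof -
    have "\<exists>u\<in>span B. \<forall>w\<in>span B. A u w = f w"
      by (rule insert.IH) (use insert.prems subsetD[OF sB] in simp_all)
    then show ?thesis using that by blast
  qed
  obtain pb where pb: "pb \<in> span B" "\<forall>w\<in>span B. A pb w = A b w"
  proof -
    have "\<exists>u\<in>span B. \<forall>w\<in>span B. A u w = A b w"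
      by (rule insert.IH) (use insert.prems BV bV in \<open>auto simp: add_right scale_right subset_iff\<close>)
    then show ?thesis using that by blast
  qed
  define d where "d = b - pb"
  have dV: "d \<in> V" using bV pb BV by (auto simp: d_def)
  have dS: "d \<in> span (insert b B)"
    unfolding d_def by (rule span_diff) (use pb sB in \<open>auto intro: span_base\<close>)
  have dperp: "A d w = 0" if "w \<in> span B" for w
    using that pb bV BV by (auto simp: d_def diff_left subset_iff)
  \<comment> \<open>if \<open>d = 0\<close> the quotient is \<open>0\<close>, and both sides of the next equation vanish\<close>
  define r where "r = (f d - A uf d) / A d d"
  have r: "r * A d d = f d - A uf d"
  proof (cases "d = 0")
    case True
    have "f 0 = 0" using insert.prems(3)[of 0 0] span_zero[of "insert b B"] by simp
    then show ?thesis using True uf(1) BV by auto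
  next
    case False
    then show ?thesis using energy_pos[OF dV] by (simp add: r_def)
  qed
  have ufV: "uf \<in> V" using uf BV by auto
  have "A (uf + r *\<^sub>R d) w = f w" if w: "w \<in> span (insert b B)" for w
  proof -
    obtain k where k: "w - k *\<^sub>R b \<in> span B" using w span_breakdown_eq by blast
    define z where "z = (w - k *\<^sub>R b) + k *\<^sub>R pb"
    have z: "z \<in> span B" using k pb by (auto simp: z_def intro!: span_add span_scale)
    have wz: "w = z + k *\<^sub>R d" by (simp add: z_def d_def algebra_simps)
    have zV: "z \<in> V" using z BV by auto
    have "A (uf + r *\<^sub>R d) w = A uf z + k * (A uf d + r * A d d)"
      using ufV dV zV dperp[OF z]
      by (simp add: wz add_left add_right scale_left scale_right algebra_simps)
    also have "\<dots> = f z + k * f d" using uf z r by simp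
    also have "\<dots> = f w"
      unfolding wz using insert.prems(2)[of z "k *\<^sub>R d"] insert.prems(3)[of d k] z sB dS
      by (auto simp: span_scale)
    finally show ?thesis .
  qed
  moreover have "uf + r *\<^sub>R d \<in> span (insert b B)"
    using uf sB dS by (auto intro!: span_add span_scale)
  ultimately show ?case by blast
qed

text \<open>An operator and its adjoint have the same norm, because \<open>A (E\<^sup>* v) (E\<^sup>* v) = A (E (E\<^sup>* v)) v\<close>.\<close>

lemma adjoint_contraction:
  assumes E: "\<And>u. u \<in> V \<Longrightarrow> E u \<in> V" and E': "\<And>u. u \<in> V \<Longrightarrow> E' u \<in> V"
    and adj: "\<And>u v. \<lbrakk>u \<in> V; v \<in> V\<rbrakk> \<Longrightarrow> A (E u) v = A u (E' v)"
    and le: "\<And>u. u \<in> V \<Longrightarrow> A (E u) (E u) \<le> \<theta> * A u u" and v: "v \<in> V"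
  shows "A (E' v) (E' v) \<le> \<theta> * A v v"
proof (cases "A (E' v) (E' v) = 0")
  case True
  have "0 \<le> \<theta> * A v v" using le[OF v] nonneg[OF E[OF v]] by linarith
  then show ?thesis using True by simp
next
  case False
  define t where "t = A (E' v) (E' v)"
  have t: "t > 0" using False nonneg[OF E'[OF v]] by (simp add: t_def)
  have "t\<^sup>2 = (A (E (E' v)) v)\<^sup>2" using adj[of "E' v" v] E' v by (simp add: t_def)
  also have "\<dots> \<le> A (E (E' v)) (E (E' v)) * A v v"
    using Cauchy_Schwarz_sq[of "E (E' v)" v] E E' v by auto
  also have "\<dots> \<le> \<theta> * t * A v v"
    using le[of "E' v"] E' v nonneg[OF v] by (simp add: t_def mult_right_mono)
  finally have "t * t \<le> t * (\<theta> * A v v)" by (simp add: power2_eq_square algebra_simps)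
  then show ?thesis using t mult_le_cancel_left_pos[of t t "\<theta> * A v v"] by (simp add: t_def)
qed

lemma spectral_bounds_norm:
  assumes M: "self_adjoint M" and a: "0 < a"
    and lo: "\<And>v. v \<in> V \<Longrightarrow> a * A v v \<le> A (M v) v"
    and hi: "\<And>v. v \<in> V \<Longrightarrow> A (M v) v \<le> b * A v v"
    and v: "v \<in> V"
  shows "sqrt (A (M v) (M v)) \<le> b * sqrt (A v v)" "a * sqrt (A v v) \<le> sqrt (A (M v) (M v))"
proof -
  have pos: "0 \<le> A (M u) u" if "u \<in> V" for u
    using lo[OF that] nonneg[OF that] a by (meson less_imp_le mult_nonneg_nonneg order_trans)
  have Mv: "M v \<in> V" using self_adjointD(1)[OF M v] .
  show "a * sqrt (A v v) \<le> sqrt (A (M v) (M v))"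
  proof (cases "A v v = 0")
    case True
    then show ?thesis using nonneg[OF Mv] by simp
  next
    case False
    then have p: "sqrt (A v v) > 0" using nonneg[OF v] by simp
    have "sqrt (A v v) * (a * sqrt (A v v)) = a * A v v"
      using nonneg[OF v] by simp
    also have "\<dots> \<le> sqrt (A v v) * sqrt (A (M v) (M v))"
      using lo[OF v] Cauchy_Schwarz[OF Mv v] by (simp add: mult.commute)
    finally show ?thesis using p by simp
  qed
  show "sqrt (A (M v) (M v)) \<le> b * sqrt (A v v)"
  proof (cases "v = 0")
    case True
    have "M v = 0"
    proof (rule definite[OF Mv])
      show "A (M v) (M v) = 0"
        using self_adjointD(2)[OF M v Mv] True self_adjointD(1)[OF M Mv] by simp
    qed
    then show ?thesis using True by simp
  next
    case False
    have "a * A v v \<le> b * A v v" using lo[OF v] hi[OF v] by linarith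
    then have b: "b \<ge> 0" using energy_pos[OF v False] a by auto
    have "A (M v) (M v) \<le> b * A (M v) v"
      by (rule energy_operator_le[OF M pos hi v])
    also have "\<dots> \<le> b * (b * A v v)" using hi[OF v] b by (rule mult_left_mono)
    finally have "sqrt (A (M v) (M v)) \<le> sqrt (b\<^sup>2 * A v v)"
      by (simp add: power2_eq_square mult.assoc)
    then show ?thesis using b by (simp add: real_sqrt_mult)
  qed
qed

text \<open>Surjectivity is the Riesz representation of \<open>A w\<close> in the energy space of the form \<open>\<lambda>u. A (M u)\<close>.\<close>

lemma coercive_bij:
  assumes M: "self_adjoint M" and pos: "\<And>v. \<lbrakk>v \<in> V; v \<noteq> 0\<rbrakk> \<Longrightarrow> 0 < A (M v) v"
    and fin: "finite B" "V = span B"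
  shows "bij_betw M V V"
proof -
  have "psd_form V (\<lambda>u. A (M u))"
  proof (rule psd_form_operator[OF M])
    show "0 \<le> A (M u) u" if "u \<in> V" for u
      using pos[OF that] self_adjointD[OF M that] by (cases "u = 0") (force simp: that)+
  qed
  then interpret M: energy_space V "\<lambda>u. A (M u)"
    by (rule energy_space.intro) (use pos in \<open>unfold_locales, force\<close>)
  show ?thesis
  proof (rule bij_betw_imageI)
    show "inj_on M V"
    proof (rule inj_onI)
      fix u v assume u: "u \<in> V" and v: "v \<in> V" and eq: "M u = M v"
      show "u = v"
        by (rule M.eq_by_testing[OF u v subspace]) (simp_all add: eq)
    qed
    show "M ` V = V"
    proof
      show "M ` V \<subseteq> V" using self_adjointD[OF M] by auto
      show "V \<subseteq> M ` V"
      proof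
        fix w assume w: "w \<in> V"
        have "\<exists>u\<in>span B. \<forall>z\<in>span B. A (M u) z = A w z"
          by (rule M.Riesz_exists)
             (use fin w span_superset[of B] in \<open>auto simp: add_right scale_right\<close>)
        then obtain u where u: "u \<in> V" "\<forall>z\<in>V. A (M u) z = A w z" using fin by auto
        have "M u = w"
          by (rule eq_by_testing[of _ V])
             (use u w self_adjointD[OF M] subspace in auto)
        then show "w \<in> M ` V" using u by auto
      qed
    qed
  qed
qed

end

section \<open>Successive and parallel subspace correction\<close>

context energy_space
begin

definition projects_onto :: "'a set \<Rightarrow> ('a \<Rightarrow> 'a) \<Rightarrow> bool" where
  "projects_onto W P \<longleftrightarrow> (\<forall>u\<in>V. P u \<in> W \<and> (\<forall>w\<in>W. A (P u) w = A u w))"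

lemma projects_ontoD:
  assumes "projects_onto W P" "W \<subseteq> V"
  shows "u \<in> V \<Longrightarrow> P u \<in> W" "u \<in> V \<Longrightarrow> P u \<in> V"
    "\<lbrakk>u \<in> V; w \<in> W\<rbrakk> \<Longrightarrow> A (P u) w = A u w" "\<lbrakk>u \<in> V; w \<in> W\<rbrakk> \<Longrightarrow> A w (P u) = A w u"
    "u \<in> V \<Longrightarrow> A (P u) (P u) = A (P u) u"
  using assms form_sym unfolding projects_onto_def subset_iff by metis+

lemma projection_self_adjoint:
  assumes "projects_onto W P" "W \<subseteq> V"
  shows "self_adjoint P"
  unfolding self_adjoint_def using projects_ontoD[OF assms] by metis

definition sweep :: "('a \<Rightarrow> 'a) list \<Rightarrow> 'a \<Rightarrow> 'a" where
  "sweep Ts = fold (\<lambda>T v. v - T v) Ts"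

lemma sweep_Nil [simp]: "sweep [] = (\<lambda>v. v)"
  and sweep_Cons [simp]: "sweep (T # Ts) v = sweep Ts (v - T v)"
  and sweep_append [simp]: "sweep (Ts @ Us) v = sweep Us (sweep Ts v)"
  by (auto simp: sweep_def)

lemma sweep_in_V: "\<lbrakk>\<And>T. T \<in> set Ts \<Longrightarrow> self_adjoint T; v \<in> V\<rbrakk> \<Longrightarrow> sweep Ts v \<in> V"
proof (induction Ts arbitrary: v)
  case (Cons T Ts)
  have "v - T v \<in> V" using Cons.prems self_adjointD(1)[of T v] by simp
  then show ?case using Cons by simp
qed simp

lemma sweep_adjoint:
  assumes "\<And>T. T \<in> set Ts \<Longrightarrow> self_adjoint T" "u \<in> V" "v \<in> V"
  shows "A (sweep Ts u) v = A u (sweep (rev Ts) v)"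
  using assms
proof (induction Ts arbitrary: u)
  case (Cons T Ts)
  have T: "self_adjoint (\<lambda>v. v - T v)" using Cons by (auto intro: self_adjoint_residual)
  have "A (sweep (T # Ts) u) v = A (u - T u) (sweep (rev Ts) v)"
    using Cons.IH Cons.prems self_adjointD(1)[OF T] by simp
  also have "\<dots> = A u (sweep (rev Ts) v - T (sweep (rev Ts) v))"
    using Cons.prems by (intro self_adjointD(2)[OF T] sweep_in_V) auto
  finally show ?case by simp
qed simp

end

text \<open>All that is used of the geometry is sparsity: the Gram matrix of the patches has at most \<open>N\<close> nonzero blocks in
  each row.\<close>

locale patch_space = energy_space V A
  for V :: "'a::real_vector set" and A :: "'a \<Rightarrow> 'a \<Rightarrow> real" +
  fixes J :: "'i set" and W :: "'i \<Rightarrow> 'a set" and P :: "'i \<Rightarrow> 'a \<Rightarrow> 'a"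
    and nb :: "'i \<Rightarrow> 'i \<Rightarrow> bool" and N :: real
  assumes finite_J: "finite J"
    and W_sub: "j \<in> J \<Longrightarrow> W j \<subseteq> V"
    and proj: "j \<in> J \<Longrightarrow> projects_onto (W j) (P j)"
    and local: "\<lbrakk>j \<in> J; k \<in> J; \<not> nb j k; u \<in> W j; v \<in> W k\<rbrakk> \<Longrightarrow> A u v = 0"
    and nb_sym: "nb j k \<longleftrightarrow> nb k j"
    and nb_card: "j \<in> J \<Longrightarrow> real (card {k \<in> J. nb j k}) \<le> N"
    and N_ge: "2 \<le> N"
begin

lemmas P_D = projects_ontoD[OF proj W_sub]

lemma P_nonneg: "\<lbrakk>j \<in> J; v \<in> V\<rbrakk> \<Longrightarrow> 0 \<le> A (P j v) v"
  using P_D(5) nonneg P_D(2) by metis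

lemma P_self_adjoint: "j \<in> J \<Longrightarrow> self_adjoint (P j)"
  using projection_self_adjoint proj W_sub by blast

lemma W_V: "\<lbrakk>j \<in> J; w \<in> W j\<rbrakk> \<Longrightarrow> w \<in> V"
  using W_sub by auto

text \<open>With \<open>q = \<Sum> P\<^sub>j v\<close> and \<open>s = A q v = \<Sum> |P\<^sub>j v|\<^sup>2\<close>, sparsity of the interactions gives \<open>|q|\<^sup>2 \<le> N s\<close>, and
  \<open>s\<^sup>2 \<le> |q|\<^sup>2 |v|\<^sup>2\<close> then yields \<open>s \<le> N |v|\<^sup>2\<close>.\<close>

lemma sum_projections_le:
  assumes v: "v \<in> V"
  shows "(\<Sum>j\<in>J. A (P j v) v) \<le> N * A v v"
proof -
  define q where "q = (\<Sum>j\<in>J. P j v)"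
  have q: "q \<in> V" using v by (auto simp: q_def intro: P_D)
  define s where "s = (\<Sum>j\<in>J. A (P j v) v)"
  have s2: "s = (\<Sum>j\<in>J. (sqrt (A (P j v) (P j v)))\<^sup>2)"
    unfolding s_def by (intro sum.cong) (use v in \<open>auto simp: P_D P_nonneg\<close>)
  have s0: "s \<ge> 0" unfolding s2 by (intro sum_nonneg) auto
  have sq: "s = A q v" unfolding s_def q_def by (rule sum_left[symmetric]) (use v in \<open>auto intro: P_D\<close>)
  have "A q q = (\<Sum>j\<in>J. \<Sum>k\<in>J. A (P j v) (P k v))"
    unfolding q_def using v by (subst sum.swap) (simp add: sum_left sum_right P_D)
  also have "\<dots> = (\<Sum>j\<in>J. \<Sum>k\<in>{k\<in>J. nb j k}. A (P j v) (P k v))"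
    by (intro sum.cong refl sum.mono_neutral_right)
       (use finite_J v in \<open>auto intro: local P_D\<close>)
  also have "\<dots> \<le> (\<Sum>j\<in>J. \<Sum>k\<in>{k\<in>J. nb j k}. \<bar>sqrt (A (P j v) (P j v))\<bar> * \<bar>sqrt (A (P k v) (P k v))\<bar>)"
    by (intro sum_mono) (use v in \<open>auto intro!: Cauchy_Schwarz_abs P_D(2)\<close>)
  also have "\<dots> \<le> N * (sqrt s * sqrt s)"
    unfolding s2 using N_ge nb_card nb_sym by (intro Schur_bound finite_J) auto
  also have "\<dots> = N * s" using s0 by simp
  finally have *: "A q q \<le> N * s" .
  have "s * s \<le> A q q * A v v" using Cauchy_Schwarz_sq[OF q v] sq by (simp add: power2_eq_square)
  also have "\<dots> \<le> N * s * A v v" using * nonneg[OF v] by (rule mult_right_mono)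
  finally have "s * s \<le> s * (N * A v v)" by (simp add: algebra_simps)
  then show ?thesis
    using s0 N_ge nonneg[OF v] unfolding s_def[symmetric]
    by (cases "s = 0") (auto simp: mult_le_cancel_left)
qed

text \<open>Let \<open>y\<^sub>i\<close> be the correction made in the \<open>i\<close>-th step. The steps are orthogonal projections, so the energies
  of the corrections add up to \<open>|e|\<^sup>2 - |r|\<^sup>2\<close>. Since \<open>e\<close> is its \<open>i\<close>-th iterate plus the earlier corrections,
  testing with \<open>w\<^sub>i\<close> sees only \<open>y\<^sub>0, ..., y\<^sub>i\<close>, and of those only the ones from neighbouring patches.\<close>

lemma sweep_energy:
  assumes js: "distinct js" "set js = J" and e: "e \<in> V" and w: "\<And>j. j \<in> J \<Longrightarrow> w j \<in> W j"
  defines "r \<equiv> sweep (map P js) e"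
  shows "(\<Sum>j\<in>J. A (w j) e) \<le> N * (sqrt (\<Sum>j\<in>J. A (w j) (w j)) * sqrt (A e e - A r r))"
    and "A r r \<le> A e e"
proof -
  define n where "n = length js"
  define ev where "ev i = sweep (map P (take i js)) e" for i
  define y where "y i = P (js ! i) (ev i)" for i
  have nJ: "js ! i \<in> J" if "i < n" for i using that js by (auto simp: n_def)
  have ev0: "ev 0 = e" by (simp add: ev_def)
  have evS: "ev (Suc i) = ev i - y i" if "i < n" for i
    using that by (simp add: ev_def y_def n_def take_Suc_conv_app_nth)
  have evn: "ev n = r" by (simp add: ev_def r_def n_def)
  have evV: "ev i \<in> V" if "i \<le> n" for i
    unfolding ev_def by (rule sweep_in_V)
      (use e js in \<open>auto intro!: P_self_adjoint dest: in_set_takeD\<close>)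
  have yW: "y i \<in> W (js ! i)" and yV: "y i \<in> V" if "i < n" for i
    using that P_D[OF nJ[OF that] nJ[OF that]] evV[of i] by (auto simp: y_def)
  have ev_sum: "ev i = e - (\<Sum>k<i. y k)" if "i \<le> n" for i
    using that by (induction i) (auto simp: ev0 evS algebra_simps)
  have step: "A (ev (Suc i)) (ev (Suc i)) = A (ev i) (ev i) - A (y i) (y i)" if i: "i < n" for i
  proof -
    have "A (y i) (ev i) = A (y i) (y i)"
      using P_D(5)[OF nJ[OF i] nJ[OF i]] evV[of i] i by (simp add: y_def)
    then show ?thesis
      using evV[of i] yV[OF i] i form_sym[of "ev i" "y i"]
      by (simp add: evS diff_left diff_right)
  qed
  have tel: "(\<Sum>k<i. A (y k) (y k)) = A e e - A (ev i) (ev i)" if "i \<le> n" for i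
    using that by (induction i) (auto simp: ev0 step)
  have Y: "(\<Sum>k<n. (sqrt (A (y k) (y k)))\<^sup>2) = A e e - A r r"
    using tel[of n] yV by (simp add: evn nonneg)
  show "A r r \<le> A e e"
  proof -
    have "0 \<le> (\<Sum>k<n. (sqrt (A (y k) (y k)))\<^sup>2)" by (intro sum_nonneg) auto
    then show ?thesis using Y by simp
  qed
  have bij: "bij_betw ((!) js) {..<n} J" using js by (auto simp: n_def intro: bij_betw_nth)
  define R where "R i k \<longleftrightarrow> nb (js ! i) (js ! k)" for i k
  have wW: "w (js ! i) \<in> W (js ! i)" and wV: "w (js ! i) \<in> V" if "i < n" for i
    using that w nJ W_V by auto
  have cardR: "real (card {k \<in> {..<n}. R i k}) \<le> N" if "i \<in> {..<n}" for i
  proof -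
    have "card {k \<in> {..<n}. R i k} \<le> card {k \<in> J. nb (js ! i) k}"
      by (rule card_inj_on_le[where f = "(!) js"])
         (use bij finite_J in \<open>auto simp: R_def bij_betw_def inj_on_def\<close>)
    then show ?thesis using nb_card[of "js ! i"] nJ that by force
  qed
  have cardR': "real (card {i \<in> {..<n}. R i k}) \<le> N" if "k \<in> {..<n}" for k
    using cardR[OF that] by (simp add: R_def nb_sym)
  have row: "A (w (js ! i)) e
      \<le> (\<Sum>k\<in>{k \<in> {..<n}. R i k}. \<bar>sqrt (A (w (js ! i)) (w (js ! i)))\<bar> * \<bar>sqrt (A (y k) (y k))\<bar>)"
    if i: "i < n" for i
  proof -
    let ?w = "w (js ! i)"
    have yVi: "y k \<in> V" if "k < i" for k using yV that i by simp
    have "e = ev i + (\<Sum>k<i. y k)" using ev_sum[of i] i by simp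
    then have "A ?w e = A ?w (ev i) + (\<Sum>k<i. A ?w (y k))"
      using i evV[of i] wV[OF i] yVi sum_in_V[of "{..<i}" y] sum_right[of "{..<i}" y]
      by (simp add: add_right)
    also have "A ?w (ev i) = A ?w (y i)"
      using P_D(4)[OF nJ[OF i] nJ[OF i] evV[of i] wW[OF i]] i by (simp add: y_def)
    also have "A ?w (y i) + (\<Sum>k<i. A ?w (y k)) = (\<Sum>k<Suc i. A ?w (y k))" by simp
    also have "\<dots> = (\<Sum>k\<in>{k \<in> {..<Suc i}. R i k}. A ?w (y k))"
      by (rule sum.mono_neutral_right)
         (use i nJ in \<open>auto simp: R_def intro!: local[OF _ _ _ wW[OF i] yW]\<close>)
    also have "\<dots> \<le> (\<Sum>k\<in>{k \<in> {..<Suc i}. R i k}. \<bar>sqrt (A ?w ?w)\<bar> * \<bar>sqrt (A (y k) (y k))\<bar>)"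
      by (intro sum_mono) (use i wV yV in \<open>auto intro!: Cauchy_Schwarz_abs\<close>)
    also have "\<dots> \<le> (\<Sum>k\<in>{k \<in> {..<n}. R i k}. \<bar>sqrt (A ?w ?w)\<bar> * \<bar>sqrt (A (y k) (y k))\<bar>)"
      by (rule sum_mono2) (use i in auto)
    finally show ?thesis .
  qed
  have "(\<Sum>j\<in>J. A (w j) e) = (\<Sum>i<n. A (w (js ! i)) e)"
    by (rule sum.reindex_bij_betw[OF bij, symmetric])
  also have "\<dots> \<le> (\<Sum>i<n. \<Sum>k\<in>{k \<in> {..<n}. R i k}.
      \<bar>sqrt (A (w (js ! i)) (w (js ! i)))\<bar> * \<bar>sqrt (A (y k) (y k))\<bar>)"
    by (intro sum_mono row) auto
  also have "\<dots> \<le> N * (sqrt (\<Sum>i<n. (sqrt (A (w (js ! i)) (w (js ! i))))\<^sup>2)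
      * sqrt (\<Sum>k<n. (sqrt (A (y k) (y k)))\<^sup>2))"
    using N_ge by (intro Schur_bound cardR cardR') auto
  also have "(\<Sum>i<n. (sqrt (A (w (js ! i)) (w (js ! i))))\<^sup>2) = (\<Sum>i<n. A (w (js ! i)) (w (js ! i)))"
    using wV by (intro sum.cong) (auto simp: nonneg)
  also have "\<dots> = (\<Sum>j\<in>J. A (w j) (w j))"
    using sum.reindex_bij_betw[OF bij, of "\<lambda>j. A (w j) (w j)"] by simp
  finally show "(\<Sum>j\<in>J. A (w j) e) \<le> N * (sqrt (\<Sum>j\<in>J. A (w j) (w j)) * sqrt (A e e - A r r))"
    unfolding Y .
qed

text \<open>The coarse part is measured through the coarse solver \<open>T\<close> itself: the orthogonal projection onto the coarse space
  admits \<open>\<rho> = 1\<close>, and a coarse solve with a different form costs the comparison constant of the two forms.\<close>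

definition stable_splitting :: "('a \<Rightarrow> 'a) \<Rightarrow> real \<Rightarrow> real \<Rightarrow> bool" where
  "stable_splitting T \<rho> C \<longleftrightarrow> 0 \<le> \<rho> \<and> 0 \<le> C \<and>
     (\<forall>e\<in>V. \<exists>e0\<in>V. \<exists>w. (\<forall>j\<in>J. w j \<in> W j) \<and> e = e0 + (\<Sum>j\<in>J. w j) \<and>
        A e0 e \<le> sqrt (C * A e e) * sqrt (\<rho> * A (T e) e) \<and>
        (\<Sum>j\<in>J. A (w j) (w j)) \<le> C * A e e)"

text \<open>With \<open>a = A (T u) u - A (T u) (T u)\<close> and \<open>Y = |e|\<^sup>2 - |F e|\<^sup>2\<close> the assertion is equivalent to
  \<open>A e u \<le> K (a + Y)\<close>, where \<open>A e u = |e|\<^sup>2 + a\<close>. Testing \<open>e\<close> with a stable splitting of \<open>e\<close>, rather than of \<open>u\<close>,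
  bounds \<open>|e|\<^sup>2\<close>: the patch parts contribute \<open>N (C Y |e|\<^sup>2)\<^sup>1\<^sup>/\<^sup>2\<close> by the sweep estimate, and the coarse part contributes
  \<open>(C \<rho> |e|\<^sup>2 A (T e) e)\<^sup>1\<^sup>/\<^sup>2\<close>, where \<open>A (T e) e \<le> a\<close>, as \<open>t (1 - t)\<^sup>2 \<le> t (1 - t)\<close> on the spectrum of \<open>T\<close>.\<close>

lemma sweep_contraction:
  assumes js: "distinct js" "set js = J"
    and T: "self_adjoint T" and T_le: "\<And>v. v \<in> V \<Longrightarrow> A (T v) (T v) \<le> A (T v) v"
    and split: "stable_splitting T \<rho> C" and K: "C * (\<rho> + N\<^sup>2) + 1 \<le> K"
    and u: "u \<in> V"
  defines "e \<equiv> u - T u"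
  shows "A (sweep (map P js) e) (sweep (map P js) e) \<le> (1 - 1 / K) * A e u" "A e u \<le> A u u"
proof -
  have Tu: "T u \<in> V" and TTu: "T (T u) \<in> V" using self_adjointD(1)[OF T] u by auto
  have e: "e \<in> V" using u Tu by (simp add: e_def)
  have Te: "T e \<in> V" using self_adjointD(1)[OF T e] .
  define r where "r = sweep (map P js) e"
  define a where "a = A (T u) u - A (T u) (T u)"
  have a0: "a \<ge> 0" using T_le[OF u] by (simp add: a_def)
  have eu: "A e u = A e e + a"
    using u Tu form_sym[OF u Tu] by (simp add: e_def a_def diff_left diff_right)
  have TT: "A (T (T u)) u = A (T u) (T u)"
    using self_adjointD(2)[OF T Tu u] by simp
  have "A (T e) e = A e (T e)" by (rule form_sym[OF Te e])
  also have "\<dots> = A u (T e) - A (T u) (T e)" using u Tu Te by (simp add: e_def diff_left)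
  also have "A u (T e) = A (T u) e" using self_adjointD(2)[OF T u e] by simp
  also have "A (T u) (T e) = A (T (T u)) e" using self_adjointD(2)[OF T Tu e] by simp
  also have "A (T u) e - A (T (T u)) e = a - (A (T u) (T u) - A (T (T u)) (T u))"
    using u Tu TTu TT by (simp add: e_def a_def diff_right)
  also have "\<dots> \<le> a"
  proof -
    \<comment> \<open>\<open>T\<close> has norm at most \<open>1\<close>\<close>
    have "A (T (T u)) (T u) \<le> A (T u) (T u)"
    proof (cases "T u = 0")
      case True
      then show ?thesis using TTu by simp
    next
      case False
      have "(A (T (T u)) (T u))\<^sup>2 \<le> A (T (T u)) (T (T u)) * A (T u) (T u)"
        by (rule Cauchy_Schwarz_sq[OF TTu Tu])
      also have "\<dots> \<le> A (T (T u)) (T u) * A (T u) (T u)"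
        using T_le[OF Tu] nonneg[OF Tu] by (rule mult_right_mono)
      finally have "A (T (T u)) (T u) * A (T (T u)) (T u) \<le> A (T (T u)) (T u) * A (T u) (T u)"
        by (simp add: power2_eq_square)
      moreover have "0 \<le> A (T (T u)) (T u)" using T_le[OF Tu] nonneg[OF TTu] by linarith
      ultimately show ?thesis using nonneg[OF Tu]
        by (cases "A (T (T u)) (T u) = 0") (auto simp: mult_le_cancel_left)
    qed
    then show ?thesis by simp
  qed
  finally have Tee: "A (T e) e \<le> a" .
  have Tee0: "0 \<le> A (T e) e" using T_le[OF e] nonneg[OF Te] by linarith
  obtain e0 w where e0: "e0 \<in> V" and w: "\<forall>j\<in>J. w j \<in> W j" and dec: "e = e0 + (\<Sum>j\<in>J. w j)"
    and e0_le: "A e0 e \<le> sqrt (C * A e e) * sqrt (\<rho> * A (T e) e)"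
    and w_le: "(\<Sum>j\<in>J. A (w j) (w j)) \<le> C * A e e"
    using split e unfolding stable_splitting_def by blast
  have \<rho>: "0 \<le> \<rho>" and C: "0 \<le> C" using split by (auto simp: stable_splitting_def)
  define Y where "Y = A e e - A r r"
  have Y0: "0 \<le> Y" using sweep_energy(2)[OF js e] w by (auto simp: Y_def r_def)
  have wV: "w j \<in> V" if "j \<in> J" for j using w W_V that by blast
  have Ce: "0 \<le> C * A e e" using C nonneg[OF e] by simp
  define s where "s = sqrt (C * A e e)"
  have s0: "0 \<le> s" and s2: "s\<^sup>2 = C * A e e" using Ce by (auto simp: s_def)
  have "A e e = A (e0 + (\<Sum>j\<in>J. w j)) e" using dec by simp
  also have "\<dots> = A e0 e + (\<Sum>j\<in>J. A (w j) e)"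
    using e0 e wV by (simp add: add_left sum_left)
  also have "\<dots> \<le> s * sqrt (\<rho> * a) + N * (s * sqrt Y)"
  proof (rule add_mono)
    show "A e0 e \<le> s * sqrt (\<rho> * a)"
      using e0_le Tee \<rho> s0 unfolding s_def
      by (elim order_trans) (intro mult_left_mono real_sqrt_le_mono, auto)
    have "(\<Sum>j\<in>J. A (w j) e) \<le> N * (sqrt (\<Sum>j\<in>J. A (w j) (w j)) * sqrt Y)"
      using sweep_energy(1)[OF js e] w unfolding Y_def r_def by blast
    also have "\<dots> \<le> N * (s * sqrt Y)"
      using w_le N_ge Y0 unfolding s_def by (intro mult_left_mono mult_right_mono real_sqrt_le_mono) auto
    finally show "(\<Sum>j\<in>J. A (w j) e) \<le> N * (s * sqrt Y)" .
  qed
  also have "\<dots> = s * (sqrt \<rho> * sqrt a + N * sqrt Y)" by (simp add: real_sqrt_mult algebra_simps)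
  finally have *: "A e e \<le> s * (sqrt \<rho> * sqrt a + N * sqrt Y)" .
  have CS2: "(sqrt \<rho> * sqrt a + N * sqrt Y)\<^sup>2 \<le> (\<rho> + N\<^sup>2) * (a + Y)"
  proof -
    have "(\<rho> + N\<^sup>2) * (a + Y) - (sqrt \<rho> * sqrt a + N * sqrt Y)\<^sup>2
        = (sqrt \<rho> * sqrt Y - N * sqrt a)\<^sup>2"
      using \<rho> a0 Y0 by (simp add: power2_eq_square algebra_simps)
    then show ?thesis by (metis diff_ge_0_iff_ge zero_le_power2)
  qed
  have ee: "A e e \<le> C * (\<rho> + N\<^sup>2) * (a + Y)"
  proof (cases "A e e = 0")
    case True
    then show ?thesis using C \<rho> a0 Y0 by simp
  next
    case False
    then have p: "A e e > 0" using nonneg[OF e] by simp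
    have "(A e e)\<^sup>2 \<le> (s * (sqrt \<rho> * sqrt a + N * sqrt Y))\<^sup>2"
      using * p by (intro power_mono) auto
    also have "\<dots> \<le> C * A e e * ((\<rho> + N\<^sup>2) * (a + Y))"
      unfolding power_mult_distrib s2 using CS2 Ce by (intro mult_left_mono)
    finally have "A e e * A e e \<le> A e e * (C * (\<rho> + N\<^sup>2) * (a + Y))"
      by (simp add: power2_eq_square algebra_simps)
    then show ?thesis using p mult_le_cancel_left_pos by blast
  qed
  have "A e u \<le> C * (\<rho> + N\<^sup>2) * (a + Y) + (a + Y)" using eu ee Y0 by linarith
  also have "\<dots> = (C * (\<rho> + N\<^sup>2) + 1) * (a + Y)" by (simp add: algebra_simps)
  also have "\<dots> \<le> K * (a + Y)" using K a0 Y0 by (intro mult_right_mono) auto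
  finally have KK: "A e u \<le> K * (A e u - A r r)" using eu by (simp add: Y_def add_diff_eq add.commute)
  have K0: "K > 0"
  proof -
    have "0 \<le> C * (\<rho> + N\<^sup>2)" using C \<rho> by simp
    then show ?thesis using K by linarith
  qed
  show "A (sweep (map P js) e) (sweep (map P js) e) \<le> (1 - 1 / K) * A e u"
    using KK K0 unfolding r_def[symmetric] by (simp add: field_simps)
  have "0 \<le> A (T u) u" using T_le[OF u] nonneg[OF Tu] by linarith
  then show "A e u \<le> A u u" using u Tu by (simp add: e_def diff_left)
qed

text \<open>\<open>S = F (I - T) F\<^sup>*\<close>, where \<open>F\<close> is the sweep in the given order. With \<open>w = F\<^sup>* v\<close> and \<open>e = w - T w\<close> one has
  \<open>A (S v) v = A e w\<close>, and \<open>(A e w)\<^sup>2 = (A (F e) v)\<^sup>2 \<le> |F e|\<^sup>2 |v|\<^sup>2 \<le> (1 - 1/K) A e w |v|\<^sup>2\<close>. The weight \<open>A e w\<close> in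
  the contraction estimate, instead of \<open>|w|\<^sup>2\<close>, is what makes this work when \<open>I - T\<close> is not a projection.\<close>

lemma symmetrized_sweep:
  assumes js: "distinct js" "set js = J"
    and T: "self_adjoint T" and T_le: "\<And>v. v \<in> V \<Longrightarrow> A (T v) (T v) \<le> A (T v) v"
    and split: "stable_splitting T \<rho> C" and K: "C * (\<rho> + N\<^sup>2) + 1 \<le> K"
    and S_def: "S = sweep (rev (map P js) @ T # map P js)"
  shows "self_adjoint S"
    and "v \<in> V \<Longrightarrow> 0 \<le> A (S v) v"
    and "v \<in> V \<Longrightarrow> A (S v) v \<le> (1 - 1 / K) * A v v"
proof -
  have sa: "self_adjoint Q" if "Q \<in> set (rev (map P js) @ T # map P js)" for Q
    using that T js P_self_adjoint by auto
  show S: "self_adjoint S"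
    unfolding self_adjoint_def S_def
  proof (intro conjI ballI)
    fix u v assume u: "u \<in> V" and v: "v \<in> V"
    show "A (sweep (rev (map P js) @ T # map P js) u) v = A u (sweep (rev (map P js) @ T # map P js) v)"
      using sweep_adjoint[of "rev (map P js) @ T # map P js" u v] sa u v by simp
  qed (rule sweep_in_V[OF sa])
  assume v: "v \<in> V"
  define w where "w = sweep (rev (map P js)) v"
  define e where "e = w - T w"
  define F where "F = sweep (map P js)"
  have w: "w \<in> V" unfolding w_def using v sa by (intro sweep_in_V) auto
  have e: "e \<in> V" using w self_adjointD[OF T] by (simp add: e_def)
  have Fe: "F e \<in> V" unfolding F_def using e sa by (intro sweep_in_V) auto
  have Sv: "S v = F e" by (simp add: S_def F_def e_def w_def)
  have "A (F e) v = A e (sweep (rev (map P js)) v)"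
    unfolding F_def using e v sa by (intro sweep_adjoint) auto
  then have Sew: "A (S v) v = A e w" by (simp add: Sv w_def)
  note c = sweep_contraction(1)[OF js T T_le split K w, folded e_def F_def]
  have "A (T w) w \<le> A w w"
  proof -
    have "(A (T w) w)\<^sup>2 \<le> A (T w) (T w) * A w w"
      by (rule Cauchy_Schwarz_sq) (use w self_adjointD[OF T] in auto)
    also have "\<dots> \<le> A (T w) w * A w w" using T_le[OF w] nonneg[OF w] by (rule mult_right_mono)
    finally have "A (T w) w * A (T w) w \<le> A (T w) w * A w w" by (simp add: power2_eq_square)
    moreover have "0 \<le> A (T w) w"
      using T_le[OF w] nonneg[OF self_adjointD(1)[OF T w]] by linarith
    ultimately show ?thesis using nonneg[OF w]
      by (cases "A (T w) w = 0") (auto simp: mult_le_cancel_left)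
  qed
  then have ew0: "0 \<le> A e w" using w self_adjointD[OF T] by (simp add: e_def diff_left)
  then show "0 \<le> A (S v) v" by (simp add: Sew)
  have "(A e w)\<^sup>2 \<le> A (F e) (F e) * A v v"
    using Cauchy_Schwarz_sq[OF Fe v] Sew Sv by simp
  also have "\<dots> \<le> (1 - 1 / K) * A e w * A v v"
    using c nonneg[OF v] by (rule mult_right_mono)
  finally have *: "A e w * A e w \<le> A e w * ((1 - 1 / K) * A v v)"
    by (simp add: power2_eq_square algebra_simps)
  have C: "0 \<le> C" "0 \<le> \<rho>" using split by (auto simp: stable_splitting_def)
  then have "1 \<le> K" using K by (smt (verit) mult_nonneg_nonneg zero_le_power2)
  then have K1: "0 \<le> 1 - 1 / K" by simp
  show "A (S v) v \<le> (1 - 1 / K) * A v v"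
  proof (cases "A e w = 0")
    case True
    then show ?thesis using K1 nonneg[OF v] by (simp add: Sew)
  next
    case False
    then show ?thesis using ew0 * unfolding Sew by (simp add: mult_le_cancel_left)
  qed
qed

text \<open>The lower bound is Cauchy-Schwarz in \<open>A v v = \<Sum> A (v\<^sub>j) (P\<^sub>j v)\<close>; in the upper bound the coarse projection
  adds \<open>1\<close> to the interaction number of the patches.\<close>

lemma additive_bounds:
  assumes W0: "W0 \<subseteq> V" and P0: "projects_onto W0 P0"
    and split: "\<exists>v0\<in>W0. \<exists>w. (\<forall>j\<in>J. w j \<in> W j) \<and> v = v0 + (\<Sum>j\<in>J. w j) \<and>
        A v0 v0 + (\<Sum>j\<in>J. A (w j) (w j)) \<le> C * A v v"
    and v: "v \<in> V"
  defines "Q \<equiv> P0 v + (\<Sum>j\<in>J. P j v)"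
  shows "A v v \<le> C * A Q v" "A Q v \<le> (N + 1) * A v v"
proof -
  note P0D = projects_ontoD[OF P0 W0]
  have Pv: "P j v \<in> V" if "j \<in> J" for j using P_D that v by blast
  have Qv: "A Q v = A (P0 v) v + (\<Sum>j\<in>J. A (P j v) v)"
    unfolding Q_def using v Pv P0D by (simp add: add_left sum_left)
  have "A (P0 v) v \<le> A v v"
  proof -
    have "0 \<le> A (v - P0 v) (v - P0 v)" by (rule nonneg) (use v P0D in auto)
    also have "\<dots> = A v v - A (P0 v) v"
      using v P0D form_sym[of v "P0 v"] by (simp add: diff_left diff_right)
    finally show ?thesis by simp
  qed
  then show "A Q v \<le> (N + 1) * A v v"
    using sum_projections_le[OF v] Qv by (simp add: algebra_simps)
  obtain v0 w where v0: "v0 \<in> W0" and w: "\<forall>j\<in>J. w j \<in> W j" and dec: "v = v0 + (\<Sum>j\<in>J. w j)"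
    and le: "A v0 v0 + (\<Sum>j\<in>J. A (w j) (w j)) \<le> C * A v v" using split by blast
  have wV: "w j \<in> V" if "j \<in> J" for j using w W_V that by auto
  have v0V: "v0 \<in> V" using v0 W0 by auto
  \<comment> \<open>the coarse space and the patches are handled as one family indexed by \<open>option\<close>\<close>
  define I where "I = insert None (Some ` J)"
  define x where "x i = (case i of None \<Rightarrow> v0 | Some j \<Rightarrow> w j)" for i
  define y where "y i = (case i of None \<Rightarrow> P0 v | Some j \<Rightarrow> P j v)" for i
  have sumI: "(\<Sum>i\<in>I. f i) = f None + (\<Sum>j\<in>J. f (Some j))" for f :: "'i option \<Rightarrow> real"
    unfolding I_def using finite_J by (subst sum.insert) (auto simp: sum.reindex)
  have xV: "x i \<in> V" and yV: "y i \<in> V" if "i \<in> I" for i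
    using that v0V wV Pv P0D v by (auto simp: x_def y_def I_def)
  have xy: "A (x i) v = A (x i) (y i)" if "i \<in> I" for i
    using that v0 w v P0D P_D by (auto simp: x_def y_def I_def)
  have "A v v = A (v0 + (\<Sum>j\<in>J. w j)) v" using dec by simp
  also have "\<dots> = (\<Sum>i\<in>I. A (x i) v)" unfolding sumI x_def using v0V wV v by (simp add: add_left sum_left)
  also have "\<dots> = (\<Sum>i\<in>I. A (x i) (y i))" using xy by simp
  also have "\<dots> \<le> (\<Sum>i\<in>I. \<bar>sqrt (A (x i) (x i))\<bar> * \<bar>sqrt (A (y i) (y i))\<bar>)"
    by (intro sum_mono) (use xV yV in \<open>auto intro!: Cauchy_Schwarz_abs\<close>)
  also have "\<dots> \<le> L2_set (\<lambda>i. sqrt (A (x i) (x i))) I * L2_set (\<lambda>i. sqrt (A (y i) (y i))) I"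
    by (rule L2_set_mult_ineq)
  also have "\<dots> = sqrt (\<Sum>i\<in>I. A (x i) (x i)) * sqrt (\<Sum>i\<in>I. A (y i) (y i))"
    unfolding L2_set_def using xV yV by (simp add: nonneg)
  also have "(\<Sum>i\<in>I. A (x i) (x i)) = A v0 v0 + (\<Sum>j\<in>J. A (w j) (w j))"
    by (simp add: sumI x_def)
  also have "(\<Sum>i\<in>I. A (y i) (y i)) = A Q v"
    unfolding Qv sumI y_def using P0D P_D v by simp
  finally have *: "A v v \<le> sqrt (A v0 v0 + (\<Sum>j\<in>J. A (w j) (w j))) * sqrt (A Q v)" .
  have Q0: "0 \<le> A Q v"
  proof -
    have "0 \<le> (\<Sum>i\<in>I. A (y i) (y i))" using yV by (intro sum_nonneg nonneg)
    then show ?thesis using \<open>(\<Sum>i\<in>I. A (y i) (y i)) = A Q v\<close> by simp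
  qed
  have x0: "0 \<le> A v0 v0 + (\<Sum>j\<in>J. A (w j) (w j))"
    using v0V wV by (intro add_nonneg_nonneg sum_nonneg nonneg)
  have "(A v v)\<^sup>2 \<le> (sqrt (A v0 v0 + (\<Sum>j\<in>J. A (w j) (w j))) * sqrt (A Q v))\<^sup>2"
    using * nonneg[OF v] by (intro power_mono) auto
  also have "\<dots> = (A v0 v0 + (\<Sum>j\<in>J. A (w j) (w j))) * A Q v"
    using Q0 x0 by (simp add: power_mult_distrib)
  also have "\<dots> \<le> C * A v v * A Q v" using le Q0 by (rule mult_right_mono)
  finally have **: "A v v * A v v \<le> A v v * (C * A Q v)"
    by (simp add: power2_eq_square algebra_simps)
  show "A v v \<le> C * A Q v"
  proof (cases "v = 0")
    case True
    have "A Q v = 0" unfolding True Q_def using P0D Pv v True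
      by (intro zero_right in_V sum_in_V) auto
    then show ?thesis using True v by simp
  next
    case False
    then show ?thesis using ** energy_pos[OF v] by simp
  qed
qed

end

section \<open>The surface measure as a measure\<close>

definition hausdorff_content :: "real \<Rightarrow> real \<Rightarrow> 'a::metric_space set \<Rightarrow> ennreal" where
  "hausdorff_content s \<delta> A =
     (INF U\<in>{U :: nat \<Rightarrow> 'a set. A \<subseteq> (\<Union>i. U i) \<and> (\<forall>i. bounded (U i) \<and> diameter (U i) \<le> \<delta>)}.
        (\<Sum>i. ennreal (unit_ball_vol s * (diameter (U i) / 2) powr s)))"

lemma hausdorff_outer_eq_SUP: "hausdorff_outer s A = (SUP \<delta>\<in>{0<..}. hausdorff_content s \<delta> A)"
  by (simp add: hausdorff_outer_def hausdorff_content_def)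

lemma hausdorff_content_le_outer: "0 < \<delta> \<Longrightarrow> hausdorff_content s \<delta> A \<le> hausdorff_outer s A"
  unfolding hausdorff_outer_eq_SUP by (rule SUP_upper) auto

lemma hausdorff_content_le:
  assumes "A \<subseteq> (\<Union>i. U i)" "\<And>i. bounded (U i)" "\<And>i. diameter (U i) \<le> \<delta>"
  shows "hausdorff_content s \<delta> A \<le> (\<Sum>i. ennreal (unit_ball_vol s * (diameter (U i) / 2) powr s))"
  unfolding hausdorff_content_def by (rule INF_lower) (use assms in auto)

lemma hausdorff_content_greatest:
  assumes "\<And>U :: nat \<Rightarrow> 'a::metric_space set. \<lbrakk>A \<subseteq> (\<Union>i. U i); \<And>i. bounded (U i); \<And>i. diameter (U i) \<le> \<delta>\<rbrakk>
      \<Longrightarrow> x \<le> (\<Sum>i. ennreal (unit_ball_vol s * (diameter (U i) / 2) powr s))"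
  shows "x \<le> hausdorff_content s \<delta> A"
  unfolding hausdorff_content_def by (rule INF_greatest) (use assms in auto)

lemma hausdorff_content_less:
  assumes "hausdorff_content s \<delta> A < x"
  obtains U :: "nat \<Rightarrow> 'a::metric_space set" where "A \<subseteq> (\<Union>i. U i)" "\<And>i. bounded (U i)"
    "\<And>i. diameter (U i) \<le> \<delta>"
    "(\<Sum>i. ennreal (unit_ball_vol s * (diameter (U i) / 2) powr s)) < x"
  using assms unfolding hausdorff_content_def INF_less_iff by blast

lemma hausdorff_content_mono: "A \<subseteq> B \<Longrightarrow> hausdorff_content s \<delta> A \<le> hausdorff_content s \<delta> B"
  by (intro hausdorff_content_greatest hausdorff_content_le) auto

lemma hausdorff_content_antimono: "\<delta> \<le> \<epsilon> \<Longrightarrow> hausdorff_content s \<epsilon> A \<le> hausdorff_content s \<delta> A"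
  by (rule hausdorff_content_greatest, rule hausdorff_content_le) (auto intro: order_trans)

lemma hausdorff_content_empty: "0 \<le> \<delta> \<Longrightarrow> hausdorff_content s \<delta> {} = 0"
  using hausdorff_content_le[of "{}" "\<lambda>_. {}" \<delta> s] by (simp add: diameter_def)

lemma hausdorff_content_countably_subadditive:
  fixes A :: "nat \<Rightarrow> 'a::metric_space set"
  shows "hausdorff_content s \<delta> (\<Union>n. A n) \<le> (\<Sum>n. hausdorff_content s \<delta> (A n))"
proof (rule ennreal_le_epsilon)
  fix e :: real assume e: "0 < e" and fin: "(\<Sum>n. hausdorff_content s \<delta> (A n)) < top"
  let ?f = "\<lambda>X :: 'a set. ennreal (unit_ball_vol s * (diameter X / 2) powr s)"
  have "\<exists>U. A n \<subseteq> (\<Union>i. U i) \<and> (\<forall>i. bounded (U i) \<and> diameter (U i) \<le> \<delta>) \<and>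
      (\<Sum>i. ?f (U i)) \<le> hausdorff_content s \<delta> (A n) + e * (1/2) ^ Suc n" for n
  proof -
    have "hausdorff_content s \<delta> (A n) < hausdorff_content s \<delta> (A n) + e * (1/2) ^ Suc n"
      using fin e by (auto simp add: less_top dest!: ennreal_suminf_lessD)
    then show ?thesis by (rule hausdorff_content_less) (use less_imp_le in blast)
  qed
  then obtain U where U: "\<And>n. A n \<subseteq> (\<Union>i. U n i)" "\<And>n i. bounded (U n i)"
      "\<And>n i. diameter (U n i) \<le> \<delta>"
      "\<And>n. (\<Sum>i. ?f (U n i)) \<le> hausdorff_content s \<delta> (A n) + e * (1/2) ^ Suc n"
    by metis
  define C where "C = case_prod U o prod_decode"
  have "(\<Union>n. A n) \<subseteq> (\<Union>i. C i)"
    using U(1) by (auto simp add: C_def subset_eq) (metis prod.case prod_encode_inverse)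
  then have "hausdorff_content s \<delta> (\<Union>n. A n) \<le> (\<Sum>i. ?f (C i))"
    by (rule hausdorff_content_le) (auto simp: C_def case_prod_beta U)
  also have "\<dots> = (\<Sum>n. \<Sum>i. ?f (U n i))"
    using suminf_ennreal_2dimen[of "\<lambda>n. \<Sum>i. ?f (U n i)" "\<lambda>(n, i). ?f (U n i)"]
    by (simp add: C_def case_prod_beta comp_def)
  also have "\<dots> \<le> (\<Sum>n. hausdorff_content s \<delta> (A n) + e * (1/2) ^ Suc n)"
    by (intro suminf_le U) auto
  also have "... = (\<Sum>n. hausdorff_content s \<delta> (A n)) + (\<Sum>n. ennreal e * ennreal ((1/2) ^ Suc n))"
    using e by (subst suminf_add[symmetric])
               (auto simp del: ennreal_suminf_cmult simp add: ennreal_mult[symmetric])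
  also have "\<dots> = (\<Sum>n. hausdorff_content s \<delta> (A n)) + e"
    unfolding ennreal_suminf_cmult
    by (subst suminf_ennreal_eq[OF zero_le_power power_half_series]) auto
  finally show "hausdorff_content s \<delta> (\<Union>n. A n) \<le> (\<Sum>n. hausdorff_content s \<delta> (A n)) + e" .
qed

lemma hausdorff_outer_empty: "hausdorff_outer s {} = 0"
  unfolding hausdorff_outer_eq_SUP by (auto simp: hausdorff_content_empty intro!: SUP_eqI)

lemma hausdorff_outer_mono: "A \<subseteq> B \<Longrightarrow> hausdorff_outer s A \<le> hausdorff_outer s B"
  unfolding hausdorff_outer_eq_SUP by (rule SUP_mono) (auto intro: hausdorff_content_mono)

lemma hausdorff_outer_countably_subadditive:
  "hausdorff_outer s (\<Union>n. A n) \<le> (\<Sum>n. hausdorff_outer s (A n))"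
  unfolding hausdorff_outer_eq_SUP[of s "\<Union>n. A n"]
proof (rule SUP_least)
  fix \<delta> :: real assume "\<delta> \<in> {0<..}"
  then have "(\<Sum>n. hausdorff_content s \<delta> (A n)) \<le> (\<Sum>n. hausdorff_outer s (A n))"
    by (intro suminf_le hausdorff_content_le_outer) auto
  then show "hausdorff_content s \<delta> (\<Union>n. A n) \<le> (\<Sum>n. hausdorff_outer s (A n))"
    using hausdorff_content_countably_subadditive[of s \<delta> A] by (rule order_trans[rotated])
qed

lemma hausdorff_outer_measure_space: "outer_measure_space (Pow UNIV) (hausdorff_outer s)"
  unfolding outer_measure_space_def positive_def increasing_def countably_subadditive_def
  by (auto intro: hausdorff_outer_empty hausdorff_outer_mono hausdorff_outer_countably_subadditive)

lemma hausdorff_outer_Un_le: "hausdorff_outer s (A \<union> B) \<le> hausdorff_outer s A + hausdorff_outer s B"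
proof -
  have "hausdorff_outer s (A \<union> B) \<le> (\<Sum>n. hausdorff_outer s (binaryset A B n))"
    using hausdorff_outer_countably_subadditive[of s "binaryset A B"] by (simp add: UN_binaryset_eq)
  also have "\<dots> = hausdorff_outer s A + hausdorff_outer s B"
    by (rule suminf_binaryset_eq) (rule hausdorff_outer_empty)
  finally show ?thesis .
qed

text \<open>A cover by sets of diameter less than the distance of \<open>A\<close> and \<open>B\<close> splits into a cover of \<open>A\<close> and a cover
  of \<open>B\<close>.\<close>

lemma hausdorff_outer_separated:
  fixes A B :: "'a::metric_space set"
  assumes e: "0 < e" and sep: "\<And>a b. \<lbrakk>a \<in> A; b \<in> B\<rbrakk> \<Longrightarrow> e \<le> dist a b"
  shows "hausdorff_outer s A + hausdorff_outer s B \<le> hausdorff_outer s (A \<union> B)"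
proof -
  let ?f = "\<lambda>X :: 'a set. ennreal (unit_ball_vol s * (diameter X / 2) powr s)"
  have f0: "?f {} = 0" by (simp add: diameter_def)
  have small: "hausdorff_content s \<delta> A + hausdorff_content s \<delta> B \<le> hausdorff_outer s (A \<union> B)"
    if \<delta>: "0 < \<delta>" "\<delta> < e" for \<delta>
  proof -
    have "hausdorff_content s \<delta> A + hausdorff_content s \<delta> B \<le> hausdorff_content s \<delta> (A \<union> B)"
    proof (rule hausdorff_content_greatest)
      fix U :: "nat \<Rightarrow> 'a set"
      assume cov: "A \<union> B \<subseteq> (\<Union>i. U i)" and bd: "\<And>i. bounded (U i)" and dm: "\<And>i. diameter (U i) \<le> \<delta>"
      define UA where "UA i = (if U i \<inter> A = {} then {} else U i)" for i
      define UB where "UB i = (if U i \<inter> B = {} then {} else U i)" for i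
      have one: "U i \<inter> A = {} \<or> U i \<inter> B = {}" for i
      proof (rule ccontr)
        assume "\<not> ?thesis"
        then obtain a b where ab: "a \<in> U i" "a \<in> A" "b \<in> U i" "b \<in> B" by auto
        have "dist a b \<le> diameter (U i)" using diameter_bounded_bound[OF bd ab(1) ab(3)] .
        then show False using sep[OF ab(2) ab(4)] dm[of i] \<delta> by linarith
      qed
      have "hausdorff_content s \<delta> A \<le> (\<Sum>i. ?f (UA i))"
      proof (rule hausdorff_content_le)
        show "A \<subseteq> (\<Union>i. UA i)" using cov unfolding UA_def by fastforce
      qed (use bd dm \<delta> in \<open>auto simp: UA_def\<close>)
      moreover have "hausdorff_content s \<delta> B \<le> (\<Sum>i. ?f (UB i))"
      proof (rule hausdorff_content_le)
        show "B \<subseteq> (\<Union>i. UB i)" using cov unfolding UB_def by fastforce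
      qed (use bd dm \<delta> in \<open>auto simp: UB_def\<close>)
      ultimately have "hausdorff_content s \<delta> A + hausdorff_content s \<delta> B
          \<le> (\<Sum>i. ?f (UA i)) + (\<Sum>i. ?f (UB i))" by (rule add_mono)
      also have "\<dots> = (\<Sum>i. ?f (UA i) + ?f (UB i))" by (rule suminf_add) auto
      also have "\<dots> \<le> (\<Sum>i. ?f (U i))"
      proof (rule suminf_le)
        fix i
        show "?f (UA i) + ?f (UB i) \<le> ?f (U i)"
          using one[of i] f0 by (auto simp: UA_def UB_def)
      qed auto
      finally show "hausdorff_content s \<delta> A + hausdorff_content s \<delta> B \<le> (\<Sum>i. ?f (U i))" .
    qed
    also have "\<dots> \<le> hausdorff_outer s (A \<union> B)" using \<delta>(1) by (rule hausdorff_content_le_outer)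
    finally show ?thesis .
  qed
  have "hausdorff_outer s A + hausdorff_outer s B
      = (SUP \<delta>\<in>{0<..}. hausdorff_content s \<delta> A + hausdorff_content s \<delta> B)"
    unfolding hausdorff_outer_eq_SUP
  proof (rule SUP_add_directed_ennreal[symmetric])
    fix x y :: real assume xy: "x \<in> {0<..}" "y \<in> {0<..}"
    have "hausdorff_content s x A + hausdorff_content s y B
        \<le> hausdorff_content s (min x y) A + hausdorff_content s (min x y) B"
      by (intro add_mono hausdorff_content_antimono) auto
    then show "\<exists>k\<in>{0<..}. hausdorff_content s x A + hausdorff_content s y B
        \<le> hausdorff_content s k A + hausdorff_content s k B"
      using xy by (intro bexI[of _ "min x y"]) auto
  qed
  also have "\<dots> \<le> hausdorff_outer s (A \<union> B)"
  proof (rule SUP_least)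
    fix x :: real assume x: "x \<in> {0<..}"
    have "hausdorff_content s x A + hausdorff_content s x B
        \<le> hausdorff_content s (min x (e/2)) A + hausdorff_content s (min x (e/2)) B"
      by (intro add_mono hausdorff_content_antimono) auto
    also have "\<dots> \<le> hausdorff_outer s (A \<union> B)" using x e by (intro small) auto
    finally show "hausdorff_content s x A + hausdorff_content s x B \<le> hausdorff_outer s (A \<union> B)" .
  qed
  finally show ?thesis .
qed

text \<open>Every second layer is separated from the others of the same parity, so finitely many of them have additive
  outer measure.\<close>

lemma hausdorff_outer_layers:
  fixes X :: "'a::metric_space set" and d :: "'a \<Rightarrow> real"
  assumes lip: "\<And>x y. \<bar>d x - d y\<bar> \<le> dist x y"
    and t: "\<And>k. t (Suc k) < t k"
    and R: "\<And>k. R k \<subseteq> {x\<in>X. t (Suc k) \<le> d x \<and> d x < t k}"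
  shows "(\<Sum>k<n. hausdorff_outer s (R (2 * k))) \<le> hausdorff_outer s X"
proof -
  have anti: "t k \<le> t j" if "j \<le> k" for j k
    using that by (rule lift_Suc_antimono_le[of t, OF less_imp_le[OF t]])
  have "(\<Sum>k<n. hausdorff_outer s (R (2 * k))) \<le> hausdorff_outer s (\<Union>k<n. R (2 * k))"
  proof (induction n)
    case (Suc n)
    have "(\<Sum>k<Suc n. hausdorff_outer s (R (2 * k)))
        \<le> hausdorff_outer s (\<Union>k<n. R (2 * k)) + hausdorff_outer s (R (2 * n))"
      using Suc by (simp add: add_right_mono)
    also have "\<dots> \<le> hausdorff_outer s ((\<Union>k<n. R (2 * k)) \<union> R (2 * n))"
    proof (cases n)
      case 0
      then show ?thesis by (simp add: hausdorff_outer_empty)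
    next
      case (Suc m)
      show ?thesis
      proof (rule hausdorff_outer_separated)
        show "0 < t (2 * n - 1) - t (2 * n)" using t[of "2 * n - 1"] Suc by simp
        fix a b assume "a \<in> (\<Union>k<n. R (2 * k))" and b: "b \<in> R (2 * n)"
        then obtain k where k: "k < n" "a \<in> R (2 * k)" by auto
        have "t (2 * n - 1) \<le> t (Suc (2 * k))" using k by (intro anti) auto
        also have "\<dots> \<le> d a" using R k by blast
        finally show "t (2 * n - 1) - t (2 * n) \<le> dist a b"
          using lip[of a b] R[of "2 * n"] b by (auto simp: abs_le_iff)
      qed
    qed
    also have "(\<Union>k<n. R (2 * k)) \<union> R (2 * n) = (\<Union>k<Suc n. R (2 * k))"
      by (auto simp: less_Suc_eq)
    finally show ?case .
  qed (simp add: hausdorff_outer_empty)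
  also have "\<dots> \<le> hausdorff_outer s X" using R by (intro hausdorff_outer_mono) blast
  finally show ?thesis .
qed

text \<open>Closed sets satisfy Caratheodory's criterion for a metric outer measure: \<open>X - F\<close> is exhausted by the sets \<open>E n\<close>
  of points at distance at least \<open>t n\<close> from \<open>F\<close>, on which additivity is known. What is missing is covered by
  the layers \<open>R (k + n)\<close>, the tails of a convergent series.\<close>

lemma closed_Caratheodory:
  fixes F :: "'a::metric_space set"
  assumes F: "closed F"
  shows "hausdorff_outer s (X \<inter> F) + hausdorff_outer s (X - F) \<le> hausdorff_outer s X"
proof (cases "F = {} \<or> hausdorff_outer s X = \<infinity>")
  case True
  then show ?thesis by (auto simp: hausdorff_outer_empty)
next
  case False
  then have ne: "F \<noteq> {}" and fin: "hausdorff_outer s X < \<infinity>" by (auto simp: less_top)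
  define d where "d x = infdist x F" for x
  define t :: "nat \<Rightarrow> real" where "t k = inverse (real (Suc k))" for k
  define R where "R k = {x\<in>X. t (Suc k) \<le> d x \<and> d x < t k}" for k
  define H where "H k = hausdorff_outer s (R k)" for k
  define E where "E n = {x\<in>X. t n \<le> d x}" for n
  have lip: "\<bar>d x - d y\<bar> \<le> dist x y" for x y
    using infdist_triangle_abs[of x F y] by (simp add: d_def)
  have t: "t (Suc k) < t k" and t0: "0 < t k" for k by (auto simp: t_def)
  have "(\<Sum>k<n. H k) \<le> 2 * hausdorff_outer s X" for n
  proof -
    \<comment> \<open>even and odd layers are summed separately\<close>
    have "(\<Sum>k<n. H k) \<le> (\<Sum>k<2 * n. H k)" by (rule sum_mono2) auto
    also have "(\<Sum>k<2 * n. H k) = (\<Sum>k<n. H (2 * k)) + (\<Sum>k<n. H (2 * k + 1))"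
      by (induction n) (auto simp: algebra_simps)
    also have "\<dots> \<le> hausdorff_outer s X + hausdorff_outer s X"
    proof (rule add_mono)
      show "(\<Sum>k<n. H (2 * k)) \<le> hausdorff_outer s X"
        unfolding H_def by (rule hausdorff_outer_layers[of d t]) (auto simp: R_def lip t)
      show "(\<Sum>k<n. H (2 * k + 1)) \<le> hausdorff_outer s X"
        unfolding H_def
        by (rule hausdorff_outer_layers[of d "\<lambda>k. t (k + 1)" "\<lambda>k. R (k + 1)"])
           (auto simp: R_def lip t)
    qed
    finally show ?thesis by (simp add: mult_2)
  qed
  then have "(\<Sum>k. H k) \<le> 2 * hausdorff_outer s X" by (rule suminf_le_const[OF summableI])
  also have "\<dots> < top" using fin by (simp add: ennreal_mult_less_top less_top)
  finally have Hfin: "(\<Sum>k. H k) < top" .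
  define h where "h k = enn2real (H k)" for k
  have Hh: "H k = ennreal (h k)" for k
    using ennreal_suminf_lessD[OF Hfin] by (simp add: h_def less_top)
  have h0: "0 \<le> h k" for k by (simp add: h_def)
  have sumh: "summable h"
    using Hfin h0 unfolding Hh by (simp add: summable_suminf_not_top less_top)
  have *: "hausdorff_outer s (X \<inter> F) + hausdorff_outer s (X - F)
      \<le> hausdorff_outer s X + ennreal (\<Sum>k. h (k + n))" for n
  proof -
    have "X - F \<subseteq> E n \<union> (\<Union>k. R (k + n))"
    proof
      fix x assume x: "x \<in> X - F"
      then have dx: "0 < d x" using F ne in_closed_iff_infdist_zero[of F x]
        by (simp add: d_def infdist_nonneg order_less_le)
      show "x \<in> E n \<union> (\<Union>k. R (k + n))"
      proof (cases "t n \<le> d x")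
        case False
        have ex: "\<exists>m. t (Suc (m + n)) \<le> d x"
        proof -
          obtain m where m: "inverse (real (Suc m)) < d x" using reals_Archimedean[OF dx] by auto
          have "t (Suc (m + n)) \<le> inverse (real (Suc m))" by (simp add: t_def)
          then show ?thesis using m by (meson less_eq_real_def order_trans)
        qed
        define m where "m = (LEAST m. t (Suc (m + n)) \<le> d x)"
        have m: "t (Suc (m + n)) \<le> d x" unfolding m_def using ex by (rule LeastI_ex)
        have "d x < t (m + n)"
        proof (cases m)
          case 0
          then show ?thesis using False by simp
        next
          case (Suc m')
          then have "\<not> t (Suc (m' + n)) \<le> d x" using not_less_Least[of m' "\<lambda>m. t (Suc (m + n)) \<le> d x"]
            by (simp add: m_def)
          then show ?thesis using Suc by simp
        qed
        then show ?thesis using m x by (auto simp: R_def)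
      qed (use x in \<open>auto simp: E_def\<close>)
    qed
    then have "hausdorff_outer s (X - F) \<le> hausdorff_outer s (E n \<union> (\<Union>k. R (k + n)))"
      by (rule hausdorff_outer_mono)
    also have "\<dots> \<le> hausdorff_outer s (E n) + (\<Sum>k. H (k + n))"
      using hausdorff_outer_Un_le hausdorff_outer_countably_subadditive[of s "\<lambda>k. R (k + n)"]
      unfolding H_def by (meson add_left_mono order_trans)
    also have "(\<Sum>k. H (k + n)) = ennreal (\<Sum>k. h (k + n))"
      unfolding Hh using h0 sumh by (intro suminf_ennreal2) (auto simp: summable_iff_shift)
    finally have "hausdorff_outer s (X \<inter> F) + hausdorff_outer s (X - F)
        \<le> (hausdorff_outer s (X \<inter> F) + hausdorff_outer s (E n)) + ennreal (\<Sum>k. h (k + n))"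
      by (simp add: add_left_mono add.assoc)
    also have "hausdorff_outer s (X \<inter> F) + hausdorff_outer s (E n)
        \<le> hausdorff_outer s ((X \<inter> F) \<union> E n)"
    proof (rule hausdorff_outer_separated[OF t0[of n]])
      fix a b assume "a \<in> X \<inter> F" "b \<in> E n"
      then show "t n \<le> dist a b" using infdist_le[of a F b] by (auto simp: E_def d_def dist_commute)
    qed
    also have "\<dots> \<le> hausdorff_outer s X" by (rule hausdorff_outer_mono) (auto simp: E_def)
    finally show ?thesis by (simp add: add_right_mono)
  qed
  have lim: "(\<lambda>n. hausdorff_outer s X + ennreal (\<Sum>k. h (k + n))) \<longlonglongrightarrow> hausdorff_outer s X + ennreal 0"
    by (intro tendsto_add tendsto_const tendsto_ennrealI suminf_exist_split2[OF sumh])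
  show ?thesis using LIMSEQ_le_const[OF lim] * by auto
qed

lemma measure_space_hausdorff_outer:
  "measure_space UNIV (sets (borel :: 'a::metric_space measure)) (hausdorff_outer s)"
proof -
  interpret P: sigma_algebra UNIV "Pow UNIV :: 'a set set" by (rule sigma_algebra_Pow)
  define L where "L = lambda_system UNIV (Pow UNIV) (hausdorff_outer s :: 'a set \<Rightarrow> ennreal)"
  have L: "measure_space UNIV L (hausdorff_outer s :: 'a set \<Rightarrow> ennreal)"
    unfolding L_def by (rule P.caratheodory_lemma[OF hausdorff_outer_measure_space])
  have "F \<in> L" if F: "closed F" for F :: "'a set"
    unfolding L_def lambda_system_def
  proof (safe)
    fix X :: "'a set"
    have e: "X \<inter> F = F \<inter> X" "X - F = (UNIV - F) \<inter> X" by auto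
    have "hausdorff_outer s X \<le> hausdorff_outer s (X \<inter> F) + hausdorff_outer s (X - F)"
      using hausdorff_outer_Un_le[of s "X \<inter> F" "X - F"] by (simp add: Int_Diff_Un)
    then show "hausdorff_outer s (F \<inter> X) + hausdorff_outer s ((UNIV - F) \<inter> X) = hausdorff_outer s X"
      using closed_Caratheodory[OF F, of s X] unfolding e by simp
  qed auto
  then have "sigma_sets UNIV (Collect closed) \<subseteq> L"
    using L by (intro sigma_algebra.sigma_sets_subset) (auto simp: measure_space_def)
  then have "sets (borel :: 'a measure) \<subseteq> L" by (simp add: borel_eq_closed)
  then show ?thesis
    by (intro measure_down[OF L]) (use sets.sigma_algebra_axioms[of "borel :: 'a measure"] in simp)
qed

lemma sets_surface_measure [simp]: "sets (surface_measure :: (real^'n) measure) = sets borel"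
  and space_surface_measure [simp]: "space (surface_measure :: (real^'n) measure) = UNIV"
  unfolding surface_measure_def
  using sets.sigma_sets_eq[of "borel :: (real^'n) measure"] by simp_all

lemma emeasure_surface_measure:
  assumes "S \<in> sets borel"
  shows "emeasure (surface_measure :: (real^'n) measure) S = hausdorff_outer (real CARD('n) - 1) S"
proof -
  have m: "measure_space UNIV (sets (borel :: (real^'n) measure)) (hausdorff_outer (real CARD('n) - 1))"
    by (rule measure_space_hausdorff_outer)
  show ?thesis
    unfolding surface_measure_def
    by (subst emeasure_measure_of_sigma)
       (use m assms in \<open>auto simp: measure_space_def\<close>)
qed

section \<open>Measure of graphs and of frontiers\<close>

lemma hausdorff_content_finite_cover:
  fixes U :: "'i \<Rightarrow> 'a::metric_space set"
  assumes I: "finite I" and cov: "A \<subseteq> (\<Union>i\<in>I. U i)" and bd: "\<And>i. i \<in> I \<Longrightarrow> bounded (U i)"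
    and dm: "\<And>i. i \<in> I \<Longrightarrow> diameter (U i) \<le> D" and D: "D \<le> \<delta>" "0 \<le> D" and s: "0 \<le> s"
  shows "hausdorff_content s \<delta> A \<le> of_nat (card I) * ennreal (unit_ball_vol s * (D / 2) powr s)"
proof -
  obtain h where h: "bij_betw h {0..<card I} I" using ex_bij_betw_nat_finite[OF I] by blast
  let ?f = "\<lambda>X :: 'a set. ennreal (unit_ball_vol s * (diameter X / 2) powr s)"
  define W where "W k = (if k < card I then U (h k) else {})" for k
  have hI: "h k \<in> I" if "k < card I" for k using h that by (auto simp: bij_betw_def)
  have "hausdorff_content s \<delta> A \<le> (\<Sum>k. ?f (W k))"
  proof (rule hausdorff_content_le)
    show "A \<subseteq> (\<Union>k. W k)"
    proof
      fix x assume "x \<in> A"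
      then obtain i where i: "i \<in> I" "x \<in> U i" using cov by auto
      then have "i \<in> h ` {0..<card I}" using h by (simp add: bij_betw_def)
      then obtain k where "k < card I" "h k = i" by auto
      then show "x \<in> (\<Union>k. W k)" using i by (auto simp: W_def intro!: exI[of _ k])
    qed
    show "bounded (W k)" for k using bd hI by (auto simp: W_def)
    show "diameter (W k) \<le> \<delta>" for k using dm[OF hI, of k] D by (auto simp: W_def)
  qed
  also have "\<dots> = (\<Sum>k<card I. ?f (W k))" by (rule suminf_finite) (auto simp: W_def)
  also have "\<dots> \<le> (\<Sum>k<card I. ennreal (unit_ball_vol s * (D / 2) powr s))"
  proof (rule sum_mono)
    fix k assume "k \<in> {..<card I}"
    then have "W k = U (h k)" "h k \<in> I" by (auto simp: W_def hI)
    then show "?f (W k) \<le> ennreal (unit_ball_vol s * (D / 2) powr s)"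
      using dm[of "h k"] bd[of "h k"] s
      by (intro ennreal_leI mult_left_mono powr_mono2) (auto simp: diameter_ge_0)
  qed
  finally show ?thesis by simp
qed

lemma grid_interval:
  fixes R x :: real
  assumes "\<bar>x\<bar> \<le> R" "0 < R" "0 < N"
  obtains m :: nat where "m < N" "- R + 2 * R * real m / real N \<le> x"
    "x \<le> - R + 2 * R * (real m + 1) / real N"
proof (cases "x = R")
  case True
  show ?thesis
  proof (rule that[of "N - 1"])
    have "2 * R * real (N - 1) / real N \<le> 2 * R" using assms by (simp add: field_simps)
    then show "- R + 2 * R * real (N - 1) / real N \<le> x" using True by simp
    show "x \<le> - R + 2 * R * (real (N - 1) + 1) / real N" using assms True by (simp add: of_nat_diff)
  qed (use assms in simp)
next
  case False
  define z where "z = (x + R) * N / (2 * R)"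
  have z0: "0 \<le> z" using assms by (auto simp: z_def abs_le_iff)
  have zN: "z < N" using assms False by (simp add: z_def field_simps abs_le_iff)
  define m where "m = nat \<lfloor>z\<rfloor>"
  have m: "real m \<le> z" "z \<le> real m + 1" 
  proof -
    have "real m = of_int \<lfloor>z\<rfloor>" using z0 by (simp add: m_def)
    then show "real m \<le> z" "z \<le> real m + 1" by linarith+
  qed
  show ?thesis
  proof (rule that[of m])
    show "m < N" using m(1) zN by linarith
    have x: "x = - R + 2 * R * z / N" using assms by (simp add: z_def)
    show "- R + 2 * R * real m / N \<le> x" unfolding x using m assms by (simp add: divide_right_mono mult_left_mono)
    show "x \<le> - R + 2 * R * (real m + 1) / N" unfolding x using m assms by (simp add: divide_right_mono mult_left_mono)
  qed
qed

text \<open>The hypothesis says that \<open>S\<close> is a Lipschitz graph over its projection along the \<open>i\<close>-th axis. Cutting the bounding cube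
  of the projection into \<open>N ^ m\<close> cubes, where \<open>m\<close> is the dimension less one, covers \<open>S\<close> by sets of diameter at most \<open>D / N\<close>, and
  \<open>N ^ m (D / N) ^ m\<close> does not depend on \<open>N\<close>.\<close>

lemma lipschitz_graph_finite_measure:
  fixes S :: "(real^'n) set"
  assumes bd: "bounded S" and L: "0 \<le> L"
    and lip: "\<And>x y. \<lbrakk>x \<in> S; y \<in> S\<rbrakk> \<Longrightarrow> \<bar>x $ i - y $ i\<bar> \<le> L * (\<Sum>j\<in>UNIV - {i}. \<bar>x $ j - y $ j\<bar>)"
  shows "hausdorff_outer (real CARD('n) - 1) S < \<infinity>"
proof -
  define s where "s = real CARD('n) - 1"
  define m where "m = CARD('n) - 1"
  have sm: "s = real m" using zero_less_card_finite[where 'a = 'n] by (simp add: s_def m_def of_nat_diff)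
  have s0: "0 \<le> s" by (simp add: sm)
  have cm: "card (UNIV - {i}) = m" by (simp add: m_def card_Diff_singleton)
  obtain R where R: "\<And>x. x \<in> S \<Longrightarrow> norm x \<le> R" "0 < R"
    using bd unfolding bounded_pos by blast
  define D where "D = (1 + L) * (real m * (2 * R))"
  have D0: "0 \<le> D" using L R by (simp add: D_def)
  define c where "c = unit_ball_vol s * (D / 2) powr s"
  have c0: "0 \<le> c" using s0 by (simp add: c_def)
  have main: "hausdorff_content s \<delta> S \<le> ennreal c" if \<delta>: "0 < \<delta>" for \<delta>
  proof -
    obtain N :: nat where N: "D / \<delta> < real N" using reals_Archimedean2 by blast
    then have N0: "0 < N" using D0 \<delta> by (metis divide_nonneg_pos less_le_trans not_gr_zero not_le of_nat_0)
    have DN: "D / N \<le> \<delta>" using N N0 \<delta> by (simp add: field_simps)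
    define I where "I = PiE (UNIV - {i}) (\<lambda>_. {..<N})"
    define U where "U f = {x\<in>S. \<forall>j\<in>UNIV - {i}. - R + 2 * R * real (f j) / N \<le> x $ j
                          \<and> x $ j \<le> - R + 2 * R * (real (f j) + 1) / N}" for f
    have I: "finite I" "card I = N ^ m"
      unfolding I_def by (auto simp: card_PiE cm intro!: finite_PiE)
    have cov: "S \<subseteq> (\<Union>f\<in>I. U f)"
    proof
      fix x assume x: "x \<in> S"
      have "\<exists>k<N. - R + 2 * R * real k / N \<le> x $ j \<and> x $ j \<le> - R + 2 * R * (real k + 1) / N" for j
      proof -
        have "\<bar>x $ j\<bar> \<le> R" using R(1)[OF x] component_le_norm_cart[of x j] by linarith
        then show ?thesis using grid_interval[OF _ R(2) N0] by metis
      qed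
      then obtain f where f: "\<And>j. f j < N" "\<And>j. - R + 2 * R * real (f j) / N \<le> x $ j"
          "\<And>j. x $ j \<le> - R + 2 * R * (real (f j) + 1) / N" by metis
      have "restrict f (UNIV - {i}) \<in> I" using f by (auto simp: I_def)
      moreover have "x \<in> U (restrict f (UNIV - {i}))" using f x by (auto simp: U_def)
      ultimately show "x \<in> (\<Union>f\<in>I. U f)" by blast
    qed
    have Ubd: "bounded (U f)" for f by (rule bounded_subset[OF bd]) (auto simp: U_def)
    have Udm: "diameter (U f) \<le> D / N" for f
    proof (rule diameter_le)
      show "U f \<noteq> {} \<or> 0 \<le> D / N" using D0 by simp
      fix x y assume x: "x \<in> U f" and y: "y \<in> U f"
      have j: "\<bar>x $ j - y $ j\<bar> \<le> 2 * R / N" if "j \<noteq> i" for j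
      proof -
        have "- R + 2 * R * real (f j) / N \<le> x $ j" "x $ j \<le> - R + 2 * R * (real (f j) + 1) / N"
          "- R + 2 * R * real (f j) / N \<le> y $ j" "y $ j \<le> - R + 2 * R * (real (f j) + 1) / N"
          using x y that by (auto simp: U_def)
        then have "\<bar>x $ j - y $ j\<bar>
            \<le> 2 * R * (real (f j) + 1) / N - 2 * R * real (f j) / N" by linarith
        also have "\<dots> = 2 * R / N" by (simp add: diff_divide_distrib[symmetric] algebra_simps)
        finally show ?thesis .
      qed
      have sj: "(\<Sum>j\<in>UNIV - {i}. \<bar>x $ j - y $ j\<bar>) \<le> real m * (2 * R / N)"
        using sum_mono[of "UNIV - {i}" "\<lambda>j. \<bar>x $ j - y $ j\<bar>" "\<lambda>_. 2 * R / N"] j cm by simp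
      have "norm (x - y) \<le> (\<Sum>j\<in>UNIV. \<bar>(x - y) $ j\<bar>)" by (rule norm_le_l1_cart)
      also have "\<dots> = \<bar>x $ i - y $ i\<bar> + (\<Sum>j\<in>UNIV - {i}. \<bar>x $ j - y $ j\<bar>)"
        by (subst sum.remove[of _ i]) auto
      also have "\<dots> \<le> (1 + L) * (\<Sum>j\<in>UNIV - {i}. \<bar>x $ j - y $ j\<bar>)"
        using lip[of x y] x y by (auto simp: U_def algebra_simps)
      also have "\<dots> \<le> (1 + L) * (real m * (2 * R / N))"
        using sj L by (intro mult_left_mono) auto
      finally show "norm (x - y) \<le> D / N" by (simp add: D_def)
    qed
    have "hausdorff_content s \<delta> S \<le> of_nat (card I) * ennreal (unit_ball_vol s * ((D / N) / 2) powr s)"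
      by (rule hausdorff_content_finite_cover[OF I(1) cov Ubd Udm DN _ s0]) (use D0 in auto)
    also have "\<dots> = ennreal (real N ^ m) * ennreal (unit_ball_vol s * ((D / N) / 2) powr s)"
      using I by (simp add: ennreal_of_nat_eq_real_of_nat)
    also have "\<dots> = ennreal (real N ^ m * (unit_ball_vol s * ((D / N) / 2) powr s))"
      using s0 by (simp add: ennreal_mult)
    also have "real N ^ m * (unit_ball_vol s * ((D / N) / 2) powr s) = c"
    proof -
      have "((D / N) / 2) powr s = (D / 2) powr s / (real N) powr s"
        using D0 N0 powr_divide[of "D / 2" "real N" s] by (simp add: mult.commute)
      then show ?thesis using N0 by (simp add: c_def sm powr_realpow)
    qed
    finally show ?thesis .
  qed
  have "hausdorff_outer s S \<le> ennreal c"
    unfolding hausdorff_outer_eq_SUP using main by (intro SUP_least) auto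
  also have "\<dots> < \<infinity>" by simp
  finally show ?thesis by (simp add: s_def)
qed

lemma emeasure_lborel_cbox_cart:
  fixes a b :: "real^'n"
  assumes "\<And>i. a $ i \<le> b $ i"
  shows "emeasure lborel (cbox a b) = ennreal (\<Prod>i\<in>UNIV. b $ i - a $ i)"
proof -
  have ne: "cbox a b \<noteq> {}" using assms by (simp add: interval_ne_empty_cart)
  have "emeasure lborel (cbox a b) = ennreal (measure lborel (cbox a b))"
    by (rule emeasure_eq_ennreal_measure) (use emeasure_lborel_cbox_finite[of a b] in auto)
  then show ?thesis using content_cbox_cart[OF ne] by simp
qed

text \<open>Every line parallel to the \<open>i\<close>-th axis through a cube \<open>Q\<close> inside \<open>S\<close> leaves the bounded set \<open>S\<close> and so meets the
  frontier. A cover of the frontier by sets \<open>U k\<close> therefore induces a cover of \<open>Q\<close> by boxes \<open>B k\<close> that have the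
  height of \<open>Q\<close> and a base of side length twice the diameter of \<open>U k\<close>. Their volumes would add up to less
  than the volume of \<open>Q\<close> if the frontier were a null set.\<close>

lemma frontier_positive_measure:
  fixes S :: "(real^'n) set"
  assumes S: "open S" "bounded S" "S \<noteq> {}" and dim: "2 \<le> CARD('n)"
  shows "0 < hausdorff_outer (real CARD('n) - 1) (frontier S)"
proof (rule ccontr)
  assume "\<not> ?thesis"
  then have zero: "hausdorff_outer (real CARD('n) - 1) (frontier S) = 0" by simp
  define s where "s = real CARD('n) - 1"
  define m where "m = CARD('n) - 1"
  have sm: "s = real m" using dim by (simp add: s_def m_def of_nat_diff)
  have m1: "1 \<le> m" using dim by (simp add: m_def)
  have s0: "0 \<le> s" by (simp add: sm)
  obtain i :: 'n where True by simp
  have cm: "card (UNIV - {i}) = m" by (simp add: m_def card_Diff_singleton)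
  obtain x0 where "x0 \<in> S" using S by auto
  then obtain e where e: "e > 0" "ball x0 e \<subseteq> S" using S(1) open_contains_ball by blast
  \<comment> \<open>small enough that the cube of half side \<open>r\<close> lies in the ball of radius \<open>e\<close>\<close>
  define r where "r = e / (2 * real CARD('n))"
  have r: "r > 0" using e by (simp add: r_def)
  define Q where "Q = cbox (\<chi> j. x0 $ j - r) (\<chi> j. x0 $ j + r)"
  have QS: "Q \<subseteq> S"
  proof
    fix x assume x: "x \<in> Q"
    have "\<bar>(x - x0) $ j\<bar> \<le> r" for j using x by (auto simp: Q_def mem_box_cart abs_le_iff field_simps)
    then have "norm (x - x0) \<le> (\<Sum>j\<in>(UNIV :: 'n set). r)"
      using norm_le_l1_cart[of "x - x0"] by (meson order_trans sum_mono)
    also have "\<dots> = e / 2" by (simp add: r_def)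
    finally have "x \<in> ball x0 e" using e by (simp add: dist_norm norm_minus_commute)
    then show "x \<in> S" using e by auto
  qed
  define c where "c = unit_ball_vol s"
  have c: "0 < c" using s0 by (simp add: c_def)
  define K where "K = 2 * r * 4 ^ m / c"
  have K: "0 < K" using r c by (simp add: K_def)
  have Qm: "emeasure lborel Q = ennreal ((2 * r) ^ CARD('n))"
    unfolding Q_def by (subst emeasure_lborel_cbox_cart) (use r in auto)
  have main: "emeasure lborel Q \<le> ennreal K * ennreal \<eta>" if \<eta>: "0 < \<eta>" for \<eta>
  proof -
    have "hausdorff_content s 1 (frontier S) \<le> 0"
      using zero hausdorff_content_le_outer[of 1 s "frontier S"] by (simp add: s_def)
    also have "\<dots> < ennreal \<eta>" using \<eta> by simp
    finally have lt: "hausdorff_content s 1 (frontier S) < ennreal \<eta>" .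
    obtain U where U: "frontier S \<subseteq> (\<Union>k. U k)" "\<And>k. bounded (U k)"
        "\<And>k. diameter (U k) \<le> 1"
        "(\<Sum>k. ennreal (unit_ball_vol s * (diameter (U k) / 2) powr s)) < ennreal \<eta>"
      using hausdorff_content_less[OF lt] by blast
    define z where "z k = (SOME y. y \<in> U k)" for k
    define lo where "lo k = (\<chi> j. if j = i then x0 $ i - r else z k $ j - diameter (U k))" for k
    define hi where "hi k = (\<chi> j. if j = i then x0 $ i + r else z k $ j + diameter (U k))" for k
    define B where "B k = cbox (lo k) (hi k)" for k
    have dm0: "0 \<le> diameter (U k)" for k by (rule diameter_ge_0[OF U(2)])
    have QB: "Q \<subseteq> (\<Union>k. B k)"
    proof
      fix x assume x: "x \<in> Q"
      define ln where "ln = range (\<lambda>t. x + t *\<^sub>R axis i (1::real))"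
      have "connected ln"
        unfolding ln_def by (intro connected_continuous_image continuous_intros) auto
      moreover have "ln \<inter> S \<noteq> {}"
      proof -
        have "x \<in> ln" unfolding ln_def by (rule range_eqI[of _ _ 0]) simp
        then show ?thesis using x QS by auto
      qed
      moreover have "ln - S \<noteq> {}"
      proof
        assume "ln - S = {}"
        then have "bounded ln" using S(2) bounded_subset by auto
        then obtain M where M: "\<And>y. y \<in> ln \<Longrightarrow> norm y \<le> M" by (auto simp: bounded_iff)
        define t where "t = M + 1 + \<bar>x $ i\<bar>"
        have "norm (x + t *\<^sub>R axis i (1::real)) \<le> M" by (rule M) (auto simp: ln_def)
        moreover have "\<bar>(x + t *\<^sub>R axis i (1::real)) $ i\<bar> \<le> norm (x + t *\<^sub>R axis i (1::real))"
          by (rule component_le_norm_cart)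
        ultimately show False by (simp add: t_def axis_def)
      qed
      ultimately obtain y where y: "y \<in> ln" "y \<in> frontier S"
        using connected_Int_frontier[of ln S] by auto
      have yj: "y $ j = x $ j" if "j \<noteq> i" for j using y(1) that by (auto simp: ln_def axis_def)
      obtain k where k: "y \<in> U k" using y U(1) by auto
      have zk: "z k \<in> U k" unfolding z_def using k by (rule someI)
      have yz: "\<bar>y $ j - z k $ j\<bar> \<le> diameter (U k)" for j
        using diameter_bounded_bound[OF U(2) k zk] component_le_norm_cart[of "y - z k" j]
        by (simp add: dist_norm)
      have "lo k $ j \<le> x $ j \<and> x $ j \<le> hi k $ j" for j
      proof (cases "j = i")
        case True
        then show ?thesis using x by (auto simp: lo_def hi_def Q_def mem_box_cart)
      next
        case False
        then show ?thesis using yz[of j] yj[of j] by (auto simp: lo_def hi_def abs_le_iff)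
      qed
      then have "x \<in> B k" by (simp add: B_def mem_box_cart)
      then show "x \<in> (\<Union>k. B k)" by blast
    qed
    have Bm: "emeasure lborel (B k) = ennreal K * ennreal (unit_ball_vol s * (diameter (U k) / 2) powr s)" for k
    proof -
      have "emeasure lborel (B k) = ennreal (\<Prod>j\<in>UNIV. hi k $ j - lo k $ j)"
        unfolding B_def using dm0[of k] r
        by (intro emeasure_lborel_cbox_cart) (auto simp: lo_def hi_def)
      also have "(\<Prod>j\<in>UNIV. hi k $ j - lo k $ j) = 2 * r * (\<Prod>j\<in>UNIV - {i}. hi k $ j - lo k $ j)"
        by (subst prod.remove[of _ i]) (auto simp: lo_def hi_def)
      also have "(\<Prod>j\<in>UNIV - {i}. hi k $ j - lo k $ j) = (\<Prod>j\<in>UNIV - {i}. 2 * diameter (U k))"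
        by (rule prod.cong) (auto simp: lo_def hi_def)
      also have "\<dots> = (2 * diameter (U k)) ^ m" by (simp only: prod_constant cm)
      also have "\<dots> = 4 ^ m * (diameter (U k) / 2) ^ m"
        by (subst power_mult_distrib[symmetric]) simp
      also have "(diameter (U k) / 2) ^ m = (diameter (U k) / 2) powr s"
        using dm0[of k] m1 by (cases "diameter (U k) = 0") (auto simp: sm powr_realpow)
      also have "2 * r * (4 ^ m * (diameter (U k) / 2) powr s)
          = K * (unit_ball_vol s * (diameter (U k) / 2) powr s)"
        using c by (simp add: K_def c_def[symmetric])
      also have "ennreal \<dots> = ennreal K * ennreal (unit_ball_vol s * (diameter (U k) / 2) powr s)"
        using K s0 by (intro ennreal_mult) auto
      finally show ?thesis .
    qed
    have "emeasure lborel Q \<le> emeasure lborel (\<Union>k. B k)"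
      by (rule emeasure_mono[OF QB]) (auto simp: B_def)
    also have "\<dots> \<le> (\<Sum>k. emeasure lborel (B k))"
      by (rule emeasure_subadditive_countably) (auto simp: B_def)
    also have "\<dots> = ennreal K * (\<Sum>k. ennreal (unit_ball_vol s * (diameter (U k) / 2) powr s))"
      unfolding Bm by simp
    also have "\<dots> \<le> ennreal K * ennreal \<eta>" using U(4) by (intro mult_left_mono) auto
    finally show ?thesis .
  qed
  have "ennreal ((2 * r) ^ CARD('n)) \<le> ennreal K * ennreal ((2 * r) ^ CARD('n) / (2 * K))"
    using main[of "(2 * r) ^ CARD('n) / (2 * K)"] Qm r K by simp
  also have "\<dots> = ennreal ((2 * r) ^ CARD('n) / 2)"
    using K r by (subst ennreal_mult[symmetric]) auto
  finally have "(2 * r) ^ CARD('n) \<le> (2 * r) ^ CARD('n) / 2" using r by (simp add: ennreal_le_iff)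
  moreover have "0 < (2 * r) ^ CARD('n)" using r by simp
  ultimately show False by linarith
qed

section \<open>Gauss-Lobatto points and tensor product polynomials\<close>

lemma Rolle_roots:
  fixes f :: "real poly"
  assumes "finite Z" "card Z = Suc n" "\<forall>z\<in>Z. poly f z = 0"
  shows "\<exists>Y. finite Y \<and> card Y = n \<and> (\<forall>y\<in>Y. poly (pderiv f) y = 0 \<and> Min Z < y \<and> y < Max Z)"
  using assms
proof (induction n arbitrary: Z)
  case (Suc n)
  define m where "m = Max Z"
  define Z' where "Z' = Z - {m}"
  have ne: "Z \<noteq> {}" using Suc by auto
  have m: "m \<in> Z" using Suc ne by (simp add: m_def)
  have Z': "finite Z'" "card Z' = Suc n" "\<forall>z\<in>Z'. poly f z = 0"
    using Suc m by (auto simp: Z'_def)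
  have ne': "Z' \<noteq> {}" using Z' by auto
  have Min: "Min Z \<le> Min Z'" using Suc ne' by (intro Min_antimono) (auto simp: Z'_def)
  have Max: "Max Z' < m"
  proof -
    have sub: "y \<in> Z \<and> y \<noteq> m" if "y \<in> Z'" for y using that by (simp add: Z'_def)
    show ?thesis
      using sub[OF Max_in[OF Z'(1) ne']] Max_ge[OF Suc.prems(1), of "Max Z'"] by (simp add: m_def)
  qed
  obtain Y where Y: "finite Y" "card Y = n"
      "\<forall>y\<in>Y. poly (pderiv f) y = 0 \<and> Min Z' < y \<and> y < Max Z'"
    using Suc.IH[OF Z'] by blast
  obtain x where x: "Max Z' < x" "x < m" "poly f m - poly f (Max Z') = (m - Max Z') * poly (pderiv f) x"
    using poly_MVT[OF Max] by blast
  have x0: "poly (pderiv f) x = 0"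
    using x Max Suc.prems(3) m Z'(3) Max_in[OF Z'(1) ne'] by simp
  have "Min Z' \<le> Max Z'" using Z'(1) ne' by simp
  moreover have "x \<notin> Y" using Y x by force
  ultimately have "finite (insert x Y) \<and> card (insert x Y) = Suc n \<and>
      (\<forall>y\<in>insert x Y. poly (pderiv f) y = 0 \<and> Min Z < y \<and> y < Max Z)"
    using Y x x0 Min Max by (auto simp: m_def[symmetric])
  then show ?case by blast
qed (auto intro: exI[of _ "{}"])

lemma pderiv_dvd_power:
  fixes f g :: "real poly"
  assumes "g ^ Suc n dvd f"
  shows "g ^ n dvd pderiv f"
proof -
  obtain r where "f = g ^ Suc n * r" using assms by (elim dvdE)
  then have "pderiv f = g ^ n * (g * pderiv r + smult (of_nat (Suc n)) (pderiv g * r))"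
    by (simp add: pderiv_mult pderiv_power_Suc algebra_simps del: power_Suc) (simp add: algebra_simps)
  then show ?thesis by (rule dvdI)
qed

lemma higher_pderiv_root_power:
  fixes f :: "real poly"
  assumes "[:-a, 1:] ^ n dvd f" "k \<le> n"
  shows "[:-a, 1:] ^ (n - k) dvd (pderiv ^^ k) f"
  using assms(2)
proof (induction k)
  case (Suc k)
  then have "[:-a, 1:] ^ Suc (n - Suc k) dvd (pderiv ^^ k) f" by (simp add: Suc_diff_Suc)
  then show ?case using pderiv_dvd_power by simp
qed (use assms in simp)

text \<open>The \<open>k\<close>-th derivative of \<open>(t\<^sup>2 - 1) ^ p\<close> vanishes at \<open>\<plusminus>1\<close> for \<open>k < p\<close>, so by Rolle's theorem every differentiation
  up to the \<open>p\<close>-th gains an interior root. The \<open>p\<close> interior roots of the \<open>p\<close>-th derivative leave \<open>p - 1\<close> for the next one,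
  which has degree \<open>p - 1\<close> and hence no others.\<close>

lemma gauss_lobatto_facts:
  assumes p: "1 \<le> p"
  shows "finite (gauss_lobatto p)" "card (gauss_lobatto p) = Suc p"
    "gauss_lobatto p \<subseteq> {-1..1}" "-1 \<in> gauss_lobatto p" "1 \<in> gauss_lobatto p"
proof -
  define q :: "real poly" where "q = [:-1, 0, 1:] ^ p"
  define D where "D k = (pderiv ^^ k) q" for k
  have fac: "q = [:-1, 1:] ^ p * [:-(-1), 1:] ^ p"
    unfolding q_def by (simp add: power_mult_distrib[symmetric])
  have ends: "poly (D k) 1 = 0 \<and> poly (D k) (-1) = 0" if "k < p" for k
  proof -
    have "[:-a, 1:] dvd D k" if "[:-a, 1:] ^ p dvd q" for a
    proof -
      have "[:-a, 1:] ^ (p - k) dvd D k"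
        unfolding D_def using \<open>k < p\<close> that by (intro higher_pderiv_root_power) auto
      moreover have "[:-a, 1:] dvd [:-a, 1:] ^ (p - k)" using \<open>k < p\<close> by (intro dvd_power) auto
      ultimately show ?thesis by (rule dvd_trans[rotated])
    qed
    from this[of 1] this[of "-1"] show ?thesis
      unfolding fac by (simp add: poly_eq_0_iff_dvd)
  qed
  have interior: "\<exists>Y. finite Y \<and> card Y = k \<and> (\<forall>y\<in>Y. poly (D k) y = 0 \<and> -1 < y \<and> y < 1)"
    if "k \<le> p" for k
    using that
  proof (induction k)
    case (Suc k)
    then obtain Y where Y: "finite Y" "card Y = k" "\<forall>y\<in>Y. poly (D k) y = 0 \<and> -1 < y \<and> y < 1"
      by auto
    define Z where "Z = insert (-1) (insert 1 Y)"
    have "1 \<notin> Y" "-1 \<notin> insert 1 Y" using Y by force+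
    then have Z: "finite Z" "card Z = Suc (Suc k)" "\<forall>z\<in>Z. poly (D k) z = 0"
      using Y ends[of k] Suc by (auto simp: Z_def)
    have Min: "Min Z = -1" by (rule Min_eqI) (use Y in \<open>force simp: Z_def\<close>)+
    have Max: "Max Z = 1" by (rule Max_eqI) (use Y in \<open>force simp: Z_def\<close>)+
    show ?case using Rolle_roots[OF Z] unfolding Min Max by (simp add: D_def)
  qed (auto intro: exI[of _ "{}"])
  obtain Y where Y: "finite Y" "card Y = p" "\<forall>y\<in>Y. poly (D p) y = 0 \<and> -1 < y \<and> y < 1"
    using interior[of p] by auto
  have neY: "Y \<noteq> {}" using Y p by auto
  have Yp: "card Y = Suc (p - 1)" using Y p by simp
  obtain Y' where Y': "finite Y'" "card Y' = p - 1"
      "\<forall>y\<in>Y'. poly (pderiv (D p)) y = 0 \<and> Min Y < y \<and> y < Max Y"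
    using Rolle_roots[OF Y(1) Yp] Y(3) by blast
  have Y'1: "poly (D (Suc p)) y = 0" "-1 < y" "y < 1" if "y \<in> Y'" for y
    using that Y' Y(3) Min_in[OF Y(1) neY] Max_in[OF Y(1) neY] by (force simp: D_def)+
  have q0: "q \<noteq> 0" by (simp add: q_def)
  have degq: "degree q = 2 * p" by (simp add: q_def degree_power_eq mult.commute)
  have degD: "degree (D k) = 2 * p - k" for k
    by (induction k) (auto simp: D_def degree_pderiv degq)
  have D0: "D (Suc p) \<noteq> 0"
  proof
    assume "D (Suc p) = 0"
    then have "degree (D p) = 0" by (simp add: D_def pderiv_eq_0_iff)
    then show False using degD[of p] p by simp
  qed
  define Rt where "Rt = {t. poly (D (Suc p)) t = 0}"
  have Rt: "finite Rt" "card Rt \<le> p - 1"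
    using D0 poly_roots_finite[OF D0] card_poly_roots_bound[OF D0] degD[of "Suc p"]
    by (auto simp: Rt_def)
  have "Y' \<subseteq> Rt" using Y'1 by (auto simp: Rt_def)
  then have RtY: "Rt = Y'" using Rt Y' by (metis card_subset_eq card_mono le_antisym)
  have GL: "gauss_lobatto p = insert (-1) (insert 1 Y')"
    unfolding gauss_lobatto_def RtY[symmetric] Rt_def D_def q_def by auto
  have n: "1 \<notin> Y'" "-1 \<notin> insert 1 Y'" using Y'1 by force+
  show "finite (gauss_lobatto p)" "-1 \<in> gauss_lobatto p" "1 \<in> gauss_lobatto p"
    using Y' by (auto simp: GL)
  show "card (gauss_lobatto p) = Suc p" using n Y' p by (simp add: GL)
  show "gauss_lobatto p \<subseteq> {-1..1}" using Y'1 by (force simp: GL)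
qed

definition lagrange_poly :: "real set \<Rightarrow> real \<Rightarrow> real poly" where
  "lagrange_poly S \<eta> = (\<Prod>s\<in>S - {\<eta>}. smult (inverse (\<eta> - s)) [:- s, 1:])"

lemma degree_lagrange_poly:
  assumes "finite S" "\<eta> \<in> S"
  shows "degree (lagrange_poly S \<eta>) \<le> card S - 1"
proof -
  have "degree (lagrange_poly S \<eta>) \<le> (\<Sum>s\<in>S - {\<eta>}. degree (smult (inverse (\<eta> - s)) [:- s, 1:]))"
    unfolding lagrange_poly_def
    using degree_prod_sum_le[of "S - {\<eta>}" "\<lambda>s. smult (inverse (\<eta> - s)) [:- s, 1:]"] assms
    by (simp only: comp_def finite_Diff)
  also have "\<dots> \<le> (\<Sum>s\<in>S - {\<eta>}. 1)" by (rule sum_mono) simp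
  also have "\<dots> = card S - 1" using assms by simp
  finally show ?thesis .
qed

lemma poly_lagrange_poly:
  assumes "finite S" "\<eta> \<in> S" "t \<in> S"
  shows "poly (lagrange_poly S \<eta>) t = (if t = \<eta> then 1 else 0)"
proof (cases "t = \<eta>")
  case True
  have "(\<Prod>s\<in>S - {\<eta>}. poly (smult (inverse (\<eta> - s)) [:- s, 1:]) \<eta>) = (\<Prod>s\<in>S - {\<eta>}. 1)"
  proof (rule prod.cong)
    fix s assume s: "s \<in> S - {\<eta>}"
    have "poly (smult (inverse (\<eta> - s)) [:- s, 1:]) \<eta> = inverse (\<eta> - s) * (\<eta> - s)"
      by (simp add: algebra_simps)
    also have "\<dots> = 1" using s by simp
    finally show "poly (smult (inverse (\<eta> - s)) [:- s, 1:]) \<eta> = 1" .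
  qed simp
  then show ?thesis using True by (simp only: lagrange_poly_def poly_prod prod.neutral_const if_True simp_thms)
next
  case False
  then have "t \<in> S - {\<eta>}" using assms by simp
  then have "(\<Prod>s\<in>S - {\<eta>}. poly (smult (inverse (\<eta> - s)) [:- s, 1:]) t) = 0"
    using assms by (intro prod_zero) (auto intro!: bexI[of _ t])
  then show ?thesis using False by (simp only: lagrange_poly_def poly_prod if_False simp_thms)
qed

lemma finite_multiindices [simp]: "finite {\<alpha> :: 'n::finite \<Rightarrow> nat. \<forall>i. \<alpha> i \<le> p}"
proof -
  have "{\<alpha> :: 'n \<Rightarrow> nat. \<forall>i. \<alpha> i \<le> p} = PiE UNIV (\<lambda>_. {..p})" by auto
  then show ?thesis by (metis finite_PiE finite finite_atMost)
qed

lemma subspace_Qpoly: "subspace (Qpoly p :: (real^'n \<Rightarrow> real) set)"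
proof (rule subspaceI)
  show "0 \<in> (Qpoly p :: (real^'n \<Rightarrow> real) set)"
    unfolding Qpoly_def by (auto simp: fun_eq_iff intro!: exI[of _ "\<lambda>_. 0"])
next
  fix f g :: "real^'n \<Rightarrow> real" assume "f \<in> Qpoly p" "g \<in> Qpoly p"
  then obtain a b :: "('n \<Rightarrow> nat) \<Rightarrow> real" where
    "f = (\<lambda>x. \<Sum>\<alpha> | \<forall>i. \<alpha> i \<le> p. a \<alpha> * (\<Prod>i\<in>UNIV. x $ i ^ \<alpha> i))"
    "g = (\<lambda>x. \<Sum>\<alpha> | \<forall>i. \<alpha> i \<le> p. b \<alpha> * (\<Prod>i\<in>UNIV. x $ i ^ \<alpha> i))"
    by (auto simp: Qpoly_def)
  then have "f + g = (\<lambda>x. \<Sum>\<alpha> | \<forall>i. \<alpha> i \<le> p. (a \<alpha> + b \<alpha>) * (\<Prod>i\<in>UNIV. x $ i ^ \<alpha> i))"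
    by (simp add: fun_eq_iff sum.distrib distrib_right)
  then show "f + g \<in> Qpoly p" unfolding Qpoly_def
    by (intro CollectI exI[of _ "\<lambda>\<alpha>. a \<alpha> + b \<alpha>"]) simp
next
  fix c :: real and f :: "real^'n \<Rightarrow> real" assume "f \<in> Qpoly p"
  then obtain a :: "('n \<Rightarrow> nat) \<Rightarrow> real" where
    "f = (\<lambda>x. \<Sum>\<alpha> | \<forall>i. \<alpha> i \<le> p. a \<alpha> * (\<Prod>i\<in>UNIV. x $ i ^ \<alpha> i))"
    by (auto simp: Qpoly_def)
  then have "c *\<^sub>R f = (\<lambda>x. \<Sum>\<alpha> | \<forall>i. \<alpha> i \<le> p. (c * a \<alpha>) * (\<Prod>i\<in>UNIV. x $ i ^ \<alpha> i))"
    by (simp add: fun_eq_iff sum_distrib_left mult.assoc)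
  then show "c *\<^sub>R f \<in> Qpoly p" unfolding Qpoly_def
    by (intro CollectI exI[of _ "\<lambda>\<alpha>. c * a \<alpha>"]) simp
qed

lemma monomial_in_Qpoly:
  assumes "\<And>i. \<alpha> i \<le> p"
  shows "(\<lambda>x :: real^'n. \<Prod>i\<in>UNIV. x $ i ^ \<alpha> i) \<in> Qpoly p"
  unfolding Qpoly_def
proof (intro CollectI exI[of _ "\<lambda>\<beta>. if \<beta> = \<alpha> then 1 else 0"] ext)
  fix x :: "real^'n"
  have "(\<Sum>\<beta> | \<forall>i. \<beta> i \<le> p. (if \<beta> = \<alpha> then 1 else 0) * (\<Prod>i\<in>UNIV. x $ i ^ \<beta> i))
      = (\<Sum>\<beta> | \<forall>i. \<beta> i \<le> p. if \<beta> = \<alpha> then \<Prod>i\<in>UNIV. x $ i ^ \<beta> i else 0)"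
    by (rule sum.cong) auto
  also have "\<dots> = (\<Prod>i\<in>UNIV. x $ i ^ \<alpha> i)" using assms by (subst sum.delta) auto
  finally show "(\<Prod>i\<in>UNIV. x $ i ^ \<alpha> i)
      = (\<Sum>\<beta> | \<forall>i. \<beta> i \<le> p. (if \<beta> = \<alpha> then 1 else 0) * (\<Prod>i\<in>UNIV. x $ i ^ \<beta> i))" by simp
qed

lemma Qpoly_induct [consumes 1, case_names monomial add scale zero]:
  fixes f :: "real^'n \<Rightarrow> real"
  assumes f: "f \<in> Qpoly p"
    and mono: "\<And>\<alpha>. (\<And>i. \<alpha> i \<le> p) \<Longrightarrow> R (\<lambda>x. \<Prod>i\<in>UNIV. x $ i ^ \<alpha> i)"
    and add: "\<And>f g. \<lbrakk>R f; R g\<rbrakk> \<Longrightarrow> R (f + g)"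
    and scale: "\<And>c f. R f \<Longrightarrow> R (c *\<^sub>R f)"
    and zero: "R 0"
  shows "R f"
proof -
  obtain a :: "('n \<Rightarrow> nat) \<Rightarrow> real" where
    a: "f = (\<lambda>x. \<Sum>\<alpha> | \<forall>i. \<alpha> i \<le> p. a \<alpha> * (\<Prod>i\<in>UNIV. x $ i ^ \<alpha> i))"
    using f by (auto simp: Qpoly_def)
  have eq: "f = (\<Sum>\<alpha> | \<forall>i. \<alpha> i \<le> p. a \<alpha> *\<^sub>R (\<lambda>x. \<Prod>i\<in>UNIV. x $ i ^ \<alpha> i))"
    by (simp add: a fun_eq_iff)
  show ?thesis
  proof (subst eq)
    have sub: "R (\<Sum>\<alpha>\<in>M. a \<alpha> *\<^sub>R (\<lambda>x. \<Prod>i\<in>UNIV. x $ i ^ \<alpha> i))"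
      if "finite M" "M \<subseteq> {\<alpha>. \<forall>i. \<alpha> i \<le> p}" for M :: "('n \<Rightarrow> nat) set"
      using that by (induction M rule: finite_induct) (auto intro!: zero add scale mono)
    show "R (\<Sum>\<alpha> | \<forall>i. \<alpha> i \<le> p. a \<alpha> *\<^sub>R (\<lambda>x. \<Prod>i\<in>UNIV. x $ i ^ \<alpha> i))"
      by (rule sub) auto
  qed
qed

lemma tensor_in_Qpoly:
  fixes P :: "'n::finite \<Rightarrow> real poly"
  assumes "\<And>i. degree (P i) \<le> p"
  shows "(\<lambda>x :: real^'n. \<Prod>i\<in>UNIV. poly (P i) (x $ i)) \<in> Qpoly p"
  unfolding Qpoly_def
proof (intro CollectI exI[of _ "\<lambda>\<alpha>. \<Prod>i\<in>UNIV. coeff (P i) (\<alpha> i)"] ext)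
  fix x :: "real^'n"
  have "(\<Prod>i\<in>UNIV. poly (P i) (x $ i)) = (\<Prod>i\<in>UNIV. \<Sum>k\<in>{..p}. coeff (P i) k * (x $ i) ^ k)"
  proof (rule prod.cong)
    fix i
    show "poly (P i) (x $ i) = (\<Sum>k\<in>{..p}. coeff (P i) k * (x $ i) ^ k)"
      unfolding poly_altdef by (rule sum.mono_neutral_left) (use assms in \<open>auto simp: coeff_eq_0\<close>)
  qed simp
  also have "\<dots> = (\<Sum>\<alpha>\<in>PiE UNIV (\<lambda>_. {..p}). \<Prod>i\<in>UNIV. coeff (P i) (\<alpha> i) * (x $ i) ^ \<alpha> i)"
    by (rule prod_sum_PiE) auto
  also have "PiE UNIV (\<lambda>_. {..p}) = {\<alpha> :: 'n \<Rightarrow> nat. \<forall>i. \<alpha> i \<le> p}" by auto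
  finally show "(\<Prod>i\<in>UNIV. poly (P i) (x $ i))
      = (\<Sum>\<alpha> | \<forall>i. \<alpha> i \<le> p. (\<Prod>i\<in>UNIV. coeff (P i) (\<alpha> i)) * (\<Prod>i\<in>UNIV. x $ i ^ \<alpha> i))"
    by (simp add: prod.distrib)
qed

lemma Qpoly_slice:
  fixes f :: "real^'n \<Rightarrow> real"
  assumes "f \<in> Qpoly p"
  shows "\<exists>P. degree P \<le> p \<and> (\<forall>t. f (\<chi> j. if j = i then t else x $ j) = poly P t)"
  using assms
proof (induction f rule: Qpoly_induct)
  case (monomial \<alpha>)
  have "(\<Prod>j\<in>UNIV. (\<chi> j. if j = i then t else x $ j) $ j ^ \<alpha> j)
      = poly (monom (\<Prod>j\<in>UNIV - {i}. x $ j ^ \<alpha> j) (\<alpha> i)) t" for t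
    by (subst prod.remove[of _ i]) (auto simp: poly_monom)
  moreover have "degree (monom (\<Prod>j\<in>UNIV - {i}. x $ j ^ \<alpha> j) (\<alpha> i)) \<le> p"
    using monomial degree_monom_le le_trans by blast
  ultimately show ?case by blast
next
  case (add f g)
  then obtain P Q where "degree P \<le> p" "degree Q \<le> p"
    "\<forall>t. f (\<chi> j. if j = i then t else x $ j) = poly P t"
    "\<forall>t. g (\<chi> j. if j = i then t else x $ j) = poly Q t" by blast
  then show ?case by (intro exI[of _ "P + Q"]) (auto intro: degree_add_le)
next
  case (scale c f)
  then obtain P where "degree P \<le> p" "\<forall>t. f (\<chi> j. if j = i then t else x $ j) = poly P t" by blast
  then show ?case by (intro exI[of _ "smult c P"]) (auto intro: order_trans[OF degree_smult_le])
next
  case zero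
  then show ?case by (intro exI[of _ 0]) auto
qed

text \<open>A polynomial of degree at most \<open>p\<close> with more than \<open>p\<close> roots vanishes; this is applied to one coordinate after the
  other, \<open>I\<close> being the set of coordinates that are already free.\<close>

lemma Qpoly_unisolvent:
  fixes f :: "real^'n \<Rightarrow> real"
  assumes f: "f \<in> Qpoly p" and S: "\<And>i. finite (S i)" "\<And>i. p < card (S i)"
    and zero: "\<And>x. (\<And>i. x $ i \<in> S i) \<Longrightarrow> f x = 0"
  shows "f x = 0"
proof -
  have "\<forall>x. (\<forall>i. i \<notin> I \<longrightarrow> x $ i \<in> S i) \<longrightarrow> f x = 0" if "finite I" for I :: "'n set"
    using that
  proof (induction I rule: finite_induct)
    case (insert i I)
    show ?case
    proof (intro allI impI)
      fix x assume x: "\<forall>j. j \<notin> insert i I \<longrightarrow> x $ j \<in> S j"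
      obtain P where P: "degree P \<le> p" "\<And>t. f (\<chi> j. if j = i then t else x $ j) = poly P t"
        using Qpoly_slice[OF f] by blast
      have "poly P t = 0" if "t \<in> S i" for t
        using insert.IH x that by (auto simp: P(2)[symmetric])
      then have sub: "S i \<subseteq> {t. poly P t = 0}" by auto
      have "P = 0"
      proof (rule ccontr)
        assume P0: "P \<noteq> 0"
        have "card (S i) \<le> card {t. poly P t = 0}"
          using sub poly_roots_finite[OF P0] by (rule card_mono[rotated])
        also have "\<dots> \<le> p" using card_poly_roots_bound[OF P0] P(1) by linarith
        finally show False using S(2)[of i] by simp
      qed
      then have "f (\<chi> j. if j = i then x $ i else x $ j) = 0" by (simp add: P(2))
      moreover have "(\<chi> j. if j = i then x $ i else x $ j) = x" by (simp add: vec_eq_iff)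
      ultimately show "f x = 0" by simp
    qed
  qed (use zero in auto)
  from this[of UNIV] show ?thesis by simp
qed

lemma Qpoly_real_polynomial_function: "f \<in> Qpoly p \<Longrightarrow> real_polynomial_function f"
proof (induction f rule: Qpoly_induct)
  case (monomial \<alpha>)
  show ?case
    by (intro real_polynomial_function_prod real_polynomial_function_power
          real_polynomial_function.intros(1) bounded_linear_vec_nth) auto
next
  case (add f g)
  then show ?case unfolding plus_fun_def by (rule real_polynomial_function.intros(3))
next
  case (scale c f)
  then show ?case unfolding scaleR_fun_def by (auto intro: real_polynomial_function.intros)
next
  case zero
  show ?case unfolding zero_fun_def by (rule real_polynomial_function.intros(2))
qed

lemma Qpoly_continuous: "f \<in> Qpoly p \<Longrightarrow> continuous_on S f"
  by (intro continuous_at_imp_continuous_on ballI continuous_real_polymonial_function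
        Qpoly_real_polynomial_function)

lemma Qpoly_partial:
  fixes f :: "real^'n \<Rightarrow> real"
  assumes "f \<in> Qpoly p"
  shows "\<exists>f'\<in>Qpoly p. \<forall>x t. ((\<lambda>t. f (x + t *\<^sub>R axis i 1)) has_real_derivative f' (x + t *\<^sub>R axis i 1)) (at t)"
  using assms
proof (induction f rule: Qpoly_induct)
  case (monomial \<alpha>)
  define \<beta> where "\<beta> = \<alpha>(i := \<alpha> i - 1)"
  define f' :: "real^'n \<Rightarrow> real" where "f' = real (\<alpha> i) *\<^sub>R (\<lambda>x. \<Prod>j\<in>UNIV. x $ j ^ \<beta> j)"
  have "f' \<in> Qpoly p"
    unfolding f'_def
  proof (intro subspace_scale[OF subspace_Qpoly] monomial_in_Qpoly)
    show "\<beta> j \<le> p" for j using monomial[of j] by (auto simp: \<beta>_def)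
  qed
  moreover have "((\<lambda>t. \<Prod>j\<in>UNIV. (x + t *\<^sub>R axis i 1) $ j ^ \<alpha> j) has_real_derivative
      f' (x + t *\<^sub>R axis i 1)) (at t)" for x :: "real^'n" and t
  proof -
    define c where "c = (\<Prod>j\<in>UNIV - {i}. x $ j ^ \<alpha> j)"
    have e: "(\<Prod>j\<in>UNIV. (x + t *\<^sub>R axis i 1) $ j ^ \<gamma> j) = (x $ i + t) ^ \<gamma> i * (\<Prod>j\<in>UNIV - {i}. x $ j ^ \<gamma> j)"
      for t and \<gamma> :: "'n \<Rightarrow> nat"
      by (subst prod.remove[of _ i]) (auto simp: axis_def intro!: prod.cong)
    have c': "(\<Prod>j\<in>UNIV - {i}. x $ j ^ \<beta> j) = c" unfolding c_def \<beta>_def by (rule prod.cong) auto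
    have "((\<lambda>t. (x $ i + t) ^ \<alpha> i * c) has_real_derivative real (\<alpha> i) * (x $ i + t) ^ (\<alpha> i - 1) * c) (at t)"
      by (auto intro!: derivative_eq_intros)
    then show ?thesis unfolding e f'_def c_def[symmetric] scaleR_fun_apply c' by (simp add: \<beta>_def mult.assoc)
  qed
  ultimately show ?case by blast
next
  case (add f g)
  then obtain f' g' where "f' \<in> Qpoly p" "g' \<in> Qpoly p"
    "\<forall>x t. ((\<lambda>t. f (x + t *\<^sub>R axis i 1)) has_real_derivative f' (x + t *\<^sub>R axis i 1)) (at t)"
    "\<forall>x t. ((\<lambda>t. g (x + t *\<^sub>R axis i 1)) has_real_derivative g' (x + t *\<^sub>R axis i 1)) (at t)" by blast
  then show ?case
    by (intro bexI[of _ "f' + g'"]) (auto intro!: DERIV_add subspace_add[OF subspace_Qpoly])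
next
  case (scale c f)
  then obtain f' where "f' \<in> Qpoly p"
    "\<forall>x t. ((\<lambda>t. f (x + t *\<^sub>R axis i 1)) has_real_derivative f' (x + t *\<^sub>R axis i 1)) (at t)" by blast
  then show ?case
    by (intro bexI[of _ "c *\<^sub>R f'"]) (auto intro!: DERIV_cmult subspace_scale[OF subspace_Qpoly])
next
  case zero
  then show ?case by (intro bexI[of _ 0]) (auto intro: subspace_0[OF subspace_Qpoly])
qed

text \<open>Polynomials are differentiable, so the gradient is the vector of the partial derivatives, which are polynomials
  and hence continuous.\<close>

lemma Qpoly_GDERIV:
  fixes f :: "real^'n \<Rightarrow> real"
  assumes f: "f \<in> Qpoly p"
  shows "\<exists>g. continuous_on UNIV g \<and> (\<forall>x. GDERIV f x :> g x)"
proof -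
  obtain d where d: "\<And>i. d i \<in> Qpoly p"
    "\<And>i x t. ((\<lambda>t. f (x + t *\<^sub>R axis i 1)) has_real_derivative d i (x + t *\<^sub>R axis i 1)) (at t)"
    using Qpoly_partial[OF f] by metis
  define g where "g x = (\<chi> i. d i x)" for x
  have "continuous_on UNIV g"
    unfolding g_def by (intro continuous_on_vec_lambda Qpoly_continuous[OF d(1)])
  moreover have "GDERIV f x :> g x" for x
  proof -
    have "f differentiable (at x)"
      by (rule differentiable_at_real_polynomial_function[OF Qpoly_real_polynomial_function[OF f]])
    then obtain f' where f': "(f has_derivative f') (at x)" by (auto simp: differentiable_def)
    then have lin: "linear f'" by (rule has_derivative_linear)
    have "f' (axis i 1) = d i x" for i
    proof -
      have "((\<lambda>t. x + t *\<^sub>R axis i 1) has_derivative (\<lambda>t. t *\<^sub>R axis i 1)) (at 0)"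
        by (auto intro!: derivative_eq_intros)
      then have "((\<lambda>t. f (x + t *\<^sub>R axis i 1)) has_derivative (\<lambda>t. f' (t *\<^sub>R axis i 1))) (at 0)"
        by (rule has_derivative_compose) (use f' in simp)
      moreover have "(\<lambda>t. f' (t *\<^sub>R axis i 1)) = (*) (f' (axis i 1))"
        by (auto simp: linear_scale[OF lin])
      ultimately have "((\<lambda>t. f (x + t *\<^sub>R axis i 1)) has_real_derivative f' (axis i 1)) (at 0)"
        by (simp add: has_field_derivative_def)
      then show ?thesis using d(2)[where x = x and t = 0 and i = i] DERIV_unique by fastforce
    qed
    then have "f' v = v \<bullet> g x" for v
    proof -
      have "f' v = f' (\<Sum>i\<in>UNIV. v $ i *\<^sub>R axis i 1)"
        using basis_expansion[of v] by (simp add: scalar_mult_eq_scaleR)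
      also have "\<dots> = (\<Sum>i\<in>UNIV. v $ i * f' (axis i 1))"
        by (simp add: linear_sum[OF lin] linear_scale[OF lin])
      also have "\<dots> = v \<bullet> g x"
        using \<open>\<And>i. f' (axis i 1) = d i x\<close> by (simp add: g_def inner_vec_def)
      finally show ?thesis .
    qed
    then have "f' = (\<lambda>v. v \<bullet> g x)" by auto
    then show ?thesis using f' by (simp add: gderiv_def)
  qed
  ultimately show ?thesis by blast
qed

section \<open>Grid geometry\<close>

lemma finite_int_vectors:
  fixes F :: "'n::finite \<Rightarrow> int set"
  assumes "\<And>i. finite (F i)"
  shows "finite {k :: int^'n. \<forall>i. k $ i \<in> F i}"
proof -
  have "{k :: int^'n. \<forall>i. k $ i \<in> F i} \<subseteq> vec_lambda ` (PiE UNIV F)"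
  proof
    fix k :: "int^'n" assume "k \<in> {k. \<forall>i. k $ i \<in> F i}"
    then have "vec_nth k \<in> PiE UNIV F" by auto
    then show "k \<in> vec_lambda ` (PiE UNIV F)" by (intro image_eqI[of _ _ "vec_nth k"]) (simp_all add: vec_nth_inverse)
  qed
  then show ?thesis by (rule finite_subset) (intro finite_imageI finite_PiE assms finite)
qed

text \<open>The part of the geometric assumption that concerns the grid and the topology of the domain.\<close>

locale grid =
  fixes c :: "('n::finite) cut_config"
  assumes h0: "0 < h0 c" and open_Omega: "open (Omega c)" and bounded_Omega: "bounded (Omega c)"
    and connected_Omega: "connected (Omega c)" and Omega_ne: "Omega c \<noteq> {}"
begin

lemma edge_pos [simp]: "0 < edge c l"
  using h0 by (simp add: edge_def)

lemma edge_ne [simp]: "edge c l \<noteq> 0"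
  using edge_pos[of l] by linarith

definition iv :: "nat \<Rightarrow> 'n \<Rightarrow> int \<Rightarrow> real set" where
  "iv l i m = {origin c $ i + edge c l * m .. origin c $ i + edge c l * (m + 1)}"

lemma vertex_nth: "vertex c l k $ i = origin c $ i + edge c l * of_int (k $ i)"
  by (simp add: vertex_def)

lemma mem_cell: "x \<in> cell c l k \<longleftrightarrow> (\<forall>i. x $ i \<in> iv l i (k $ i))"
  by (simp add: cell_def mem_box_cart vertex_nth iv_def)

lemma interior_cell: "x \<in> interior (cell c l k) \<longleftrightarrow>
    (\<forall>i. origin c $ i + edge c l * (k $ i) < x $ i \<and> x $ i < origin c $ i + edge c l * (k $ i + 1))"
  by (simp add: cell_def interior_cbox mem_box_cart vertex_nth)

definition cell_index :: "nat \<Rightarrow> 'n \<Rightarrow> real \<Rightarrow> int" where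
  "cell_index l i t = \<lfloor>(t - origin c $ i) / edge c l\<rfloor>"

lemma iv_cell_index: "t \<in> iv l i (cell_index l i t)"
proof -
  let ?z = "(t - origin c $ i) / edge c l"
  have t: "t = origin c $ i + edge c l * ?z" using edge_pos[of l] by simp
  have "of_int \<lfloor>?z\<rfloor> \<le> ?z" "?z \<le> of_int \<lfloor>?z\<rfloor> + 1" by linarith+
  then have "edge c l * of_int \<lfloor>?z\<rfloor> \<le> edge c l * ?z" "edge c l * ?z \<le> edge c l * (of_int \<lfloor>?z\<rfloor> + 1)"
    by (auto intro!: mult_left_mono less_imp_le[OF edge_pos] simp del: times_divide_eq_right)
  then show ?thesis unfolding iv_def cell_index_def using t by auto
qed

lemma cell_index_less:
  assumes "t \<in> iv l i m" "t \<noteq> origin c $ i + edge c l * (m + 1)"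
  shows "cell_index l i t = m"
proof -
  have "origin c $ i + edge c l * m \<le> t" "t < origin c $ i + edge c l * (m + 1)"
    using assms by (auto simp: iv_def)
  then have "m \<le> (t - origin c $ i) / edge c l" "(t - origin c $ i) / edge c l < m + 1"
    by (auto simp: field_simps)
  then show ?thesis by (simp add: cell_index_def floor_eq_iff)
qed

lemma cell_index_end: "cell_index l i (origin c $ i + edge c l * (m + 1)) = m + 1" for m :: int
  using edge_pos[of l] by (simp add: cell_index_def)

lemma iv_overlap:
  assumes "t \<in> iv l i m" "t \<in> iv l i m'" "m < m'"
  shows "m' = m + 1" "t = origin c $ i + edge c l * (m + 1)"
proof -
  have a: "origin c $ i + edge c l * m' \<le> t" "t \<le> origin c $ i + edge c l * (m + 1)"
    using assms by (auto simp: iv_def)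
  then have "edge c l * of_int m' \<le> edge c l * of_int (m + 1)" by linarith
  then have "m' \<le> m + 1" using edge_pos[of l] by simp
  then show m: "m' = m + 1" using assms(3) by linarith
  show "t = origin c $ i + edge c l * (m + 1)" using a m by simp
qed

lemma mem_cell_index: "x \<in> cell c l (\<chi> i. cell_index l i (x $ i))"
  by (simp add: mem_cell iv_cell_index)

lemma finite_cells_meeting:
  assumes "bounded B"
  shows "finite {k. cell c l k \<inter> B \<noteq> {}}"
proof -
  obtain M where M: "\<And>x. x \<in> B \<Longrightarrow> norm x \<le> M" using assms by (auto simp: bounded_iff)
  define F where "F i = {\<lfloor>(- M - origin c $ i) / edge c l\<rfloor> - 1 .. \<lceil>(M - origin c $ i) / edge c l\<rceil>}" for i
  have "{k. cell c l k \<inter> B \<noteq> {}} \<subseteq> {k. \<forall>i. k $ i \<in> F i}"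
  proof (intro subsetI CollectI allI)
    fix k i assume "k \<in> {k. cell c l k \<inter> B \<noteq> {}}"
    then obtain x where x: "x \<in> cell c l k" "x \<in> B" by auto
    have "\<bar>x $ i\<bar> \<le> M" using component_le_norm_cart[of x i] M[OF x(2)] by linarith
    moreover have "origin c $ i + edge c l * (k $ i) \<le> x $ i" "x $ i \<le> origin c $ i + edge c l * (k $ i + 1)"
      using x(1) by (auto simp: mem_cell iv_def)
    ultimately have "edge c l * (k $ i) \<le> M - origin c $ i" "- M - origin c $ i \<le> edge c l * (k $ i + 1)"
      by (auto simp: abs_le_iff)
    then have "k $ i \<le> (M - origin c $ i) / edge c l" "(- M - origin c $ i) / edge c l \<le> k $ i + 1"
      using edge_pos[of l] by (simp_all add: pos_le_divide_eq pos_divide_le_eq mult.commute)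
    then show "k $ i \<in> F i" unfolding F_def by (simp; linarith)
  qed
  moreover have "finite {k :: int^'n. \<forall>i. k $ i \<in> F i}" by (rule finite_int_vectors) (simp add: F_def)
  ultimately show ?thesis by (rule finite_subset)
qed

lemma finite_active [simp]: "finite (active c l)"
  unfolding active_def by (rule finite_cells_meeting[OF bounded_Omega])

lemma bounded_cell [simp]: "bounded (cell c l k)"
  and compact_cell [simp]: "compact (cell c l k)"
  and closed_cell [simp]: "closed (cell c l k)"
  and convex_cell [simp]: "convex (cell c l k)"
  by (simp_all add: cell_def convex_box closed_cbox)

lemma compact_active_region: "compact (active_region c l)"
  unfolding active_region_def by (intro compact_UN) auto

lemma closed_active_region: "closed (active_region c l)"
  using compact_active_region by (rule compact_imp_closed)

lemma vertex_in_cell: "vertex c l k \<in> cell c l k"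
  by (simp add: mem_cell iv_def vertex_nth)

lemma bounded_Gam: "bounded (Gam c)"
  unfolding Gam_def using bounded_Omega frontier_subset_closed bounded_subset[OF bounded_closure]
  by (auto simp: frontier_def)

lemma finite_admissible [simp]: "finite (admissible_vertices c l)"
proof -
  define B where "B = (\<Union>k\<in>{k. cell c l k \<inter> Gam c \<noteq> {}}. cell c l k)"
  have "bounded B"
    unfolding B_def using finite_cells_meeting[OF bounded_Gam] by (intro bounded_UN) auto
  then have "finite {j. cell c l j \<inter> (Omega c \<union> B) \<noteq> {}}"
    by (intro finite_cells_meeting) (simp add: bounded_Omega)
  moreover have "admissible_vertices c l \<subseteq> {j. cell c l j \<inter> (Omega c \<union> B) \<noteq> {}}"
  proof
    fix j assume "j \<in> admissible_vertices c l"
    then have "vertex c l j \<in> Omega c \<union> B"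
      by (auto simp: admissible_vertices_def B_def is_cut_def)
    then show "j \<in> {j. cell c l j \<inter> (Omega c \<union> B) \<noteq> {}}" using vertex_in_cell[of l j] by blast
  qed
  ultimately show ?thesis by (rule finite_subset[rotated])
qed

lemma Omega_sub_active: "Omega c \<subseteq> active_region c l"
proof
  fix x assume x: "x \<in> Omega c"
  then have "(\<chi> i. cell_index l i (x $ i)) \<in> active c l"
    using mem_cell_index[of x l] by (auto simp: active_def)
  then show "x \<in> active_region c l" using mem_cell_index[of x l] by (auto simp: active_region_def)
qed

lemma interior_cell_unique:
  assumes "x \<in> interior (cell c l k)" "x \<in> cell c l k'"
  shows "k' = k"
proof -
  have "k' $ i = k $ i" for i
  proof -
    have a: "x $ i \<in> iv l i (k $ i)" "x $ i \<in> iv l i (k' $ i)"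
      using assms(2) subsetD[OF interior_subset assms(1)] by (auto simp: mem_cell)
    have b: "origin c $ i + edge c l * (k $ i) < x $ i" "x $ i < origin c $ i + edge c l * (k $ i + 1)"
      using assms(1) by (auto simp: interior_cell)
    show ?thesis
    proof (rule ccontr)
      assume "k' $ i \<noteq> k $ i"
      then consider "k' $ i < k $ i" | "k $ i < k' $ i" by linarith
      then show False
      proof cases
        case 1
        then show ?thesis using iv_overlap[OF a(2) a(1) 1] b by simp
      next
        case 2
        then show ?thesis using iv_overlap[OF a(1) a(2) 2] b by simp
      qed
    qed
  qed
  then show ?thesis by (simp add: vec_eq_iff)
qed

lemma cell_closure_interior: "closure (interior (cell c l k)) = cell c l k"
proof -
  have "vertex c l k + (1/2 * edge c l) *\<^sub>R (\<chi> i. 1) \<in> interior (cell c l k)"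
    using edge_pos[of l] by (simp add: interior_cell vertex_nth algebra_simps)
  then show ?thesis using convex_closure_interior[OF convex_cell, of l k] by auto
qed

lemma interior_cell_ne: "interior (cell c l k) \<noteq> {}"
  using cell_closure_interior[of l k] vertex_in_cell[of l k] by force

lemma cell_sub_Union_cells:
  assumes "interior (cell c l k) \<inter> S \<noteq> {}" "S \<subseteq> (\<Union>m\<in>M. cell c l m)"
  shows "k \<in> M"
  using assms interior_cell_unique by blast

end

section \<open>The nodal basis\<close>

locale fe_grid = grid c for c :: "('n::finite) cut_config" +
  fixes p :: nat
  assumes p: "1 \<le> p"
begin

lemmas gl = gauss_lobatto_facts[OF p]

text \<open>The nodes of one cell are the product of the sets \<open>node1\<close> over the coordinates.\<close>

definition node1 :: "nat \<Rightarrow> 'n \<Rightarrow> int \<Rightarrow> real set" where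
  "node1 l i m = (\<lambda>t. origin c $ i + edge c l * (m + (1 + t) / 2)) ` gauss_lobatto p"

lemma finite_node1 [simp]: "finite (node1 l i m)"
  using gl by (simp add: node1_def)

lemma card_node1: "card (node1 l i m) = Suc p"
proof -
  have "inj_on (\<lambda>t. origin c $ i + edge c l * (m + (1 + t) / 2)) (gauss_lobatto p)"
    using edge_pos[of l] by (intro inj_onI) simp
  then show ?thesis using gl by (simp add: node1_def card_image)
qed

lemma node1_sub: "node1 l i m \<subseteq> iv l i m"
proof
  fix x assume "x \<in> node1 l i m"
  then obtain t where t: "t \<in> gauss_lobatto p" "x = origin c $ i + edge c l * (m + (1 + t) / 2)"
    by (auto simp: node1_def)
  then have "-1 \<le> t" "t \<le> 1" using gl by auto
  then have "edge c l * m \<le> edge c l * (m + (1 + t) / 2)" "edge c l * (m + (1 + t) / 2) \<le> edge c l * (m + 1)"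
    by (auto intro!: mult_left_mono less_imp_le[OF edge_pos] simp del: times_divide_eq_right)
  then show "x \<in> iv l i m" by (simp add: iv_def t)
qed

lemma node1_ends: "origin c $ i + edge c l * m \<in> node1 l i m"
  "origin c $ i + edge c l * (m + 1) \<in> node1 l i m"
  unfolding node1_def using gl by (auto intro: image_eqI[of _ _ "-1"] image_eqI[of _ _ 1])

text \<open>Two intervals of the one-dimensional grid share at most an end point, and both contain it as a node. This is
  where the end points of the Gauss-Lobatto rule matter.\<close>

lemma node1_iv:
  assumes "\<eta> \<in> node1 l i m" "\<eta> \<in> iv l i m'"
  shows "\<eta> \<in> node1 l i m'"
proof -
  have "\<eta> \<in> iv l i m" using assms node1_sub by auto
  consider "m = m'" | "m < m'" | "m' < m" by linarith
  then show ?thesis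
  proof cases
    case 2
    then show ?thesis using iv_overlap[OF \<open>\<eta> \<in> iv l i m\<close> assms(2)] node1_ends(1)[of i l m'] by simp
  next
    case 3
    then show ?thesis using iv_overlap[OF assms(2) \<open>\<eta> \<in> iv l i m\<close>] node1_ends(2)[of i l m'] by simp
  qed (use assms in simp)
qed

lemma mem_nodes: "x \<in> nodes p c l \<longleftrightarrow> (\<exists>k\<in>active c l. \<forall>i. x $ i \<in> node1 l i (k $ i))"
proof
  assume "x \<in> nodes p c l"
  then obtain k t where "k \<in> active c l" "\<forall>i. t i \<in> gauss_lobatto p"
    "x = vertex c l k + edge c l *\<^sub>R (\<chi> i. (1 + t i) / 2)" by (auto simp: nodes_def)
  then show "\<exists>k\<in>active c l. \<forall>i. x $ i \<in> node1 l i (k $ i)"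
    by (intro bexI[of _ k]) (auto simp: node1_def vertex_nth algebra_simps intro!: image_eqI[of _ _ "t _"])
next
  assume "\<exists>k\<in>active c l. \<forall>i. x $ i \<in> node1 l i (k $ i)"
  then obtain k where k: "k \<in> active c l" "\<And>i. x $ i \<in> node1 l i (k $ i)" by auto
  have "\<exists>t. t \<in> gauss_lobatto p \<and> x $ i = origin c $ i + edge c l * (k $ i + (1 + t) / 2)" for i
    using k(2)[of i] by (auto simp: node1_def)
  then obtain t where t: "\<And>i. t i \<in> gauss_lobatto p"
    "\<And>i. x $ i = origin c $ i + edge c l * (k $ i + (1 + t i) / 2)" by metis
  have "x = vertex c l k + edge c l *\<^sub>R (\<chi> i. (1 + t i) / 2)"
    by (simp add: vec_eq_iff vertex_nth t(2) algebra_simps)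
  then show "x \<in> nodes p c l" using k(1) t(1) unfolding nodes_def by blast
qed

lemma nodes_in_cell:
  assumes "z \<in> nodes p c l" "z \<in> cell c l k"
  shows "z $ i \<in> node1 l i (k $ i)"
  using assms node1_iv by (force simp: mem_nodes mem_cell)

lemma node_in_active_cell:
  assumes "z \<in> nodes p c l"
  obtains k where "k \<in> active c l" "z \<in> cell c l k"
proof -
  obtain k where "k \<in> active c l" "\<forall>i. z $ i \<in> node1 l i (k $ i)" using assms by (auto simp: mem_nodes)
  then show ?thesis by (intro that[of k]) (auto simp: mem_cell intro: subsetD[OF node1_sub])
qed

lemma finite_nodes [simp]: "finite (nodes p c l)"
proof -
  define F where "F = (\<Union>k\<in>active c l. vec_lambda ` PiE UNIV (\<lambda>i. node1 l i (k $ i)))"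
  have "nodes p c l \<subseteq> F"
  proof
    fix x assume "x \<in> nodes p c l"
    then obtain k where k: "k \<in> active c l" "\<forall>i. x $ i \<in> node1 l i (k $ i)" by (auto simp: mem_nodes)
    have "x \<in> vec_lambda ` PiE UNIV (\<lambda>i. node1 l i (k $ i))"
      by (rule image_eqI[of _ _ "vec_nth x"]) (use k in \<open>auto simp: vec_nth_inverse\<close>)
    then show "x \<in> F" using k by (auto simp: F_def)
  qed
  moreover have "finite F" unfolding F_def by (intro finite_UN_I finite_imageI finite_PiE) auto
  ultimately show ?thesis by (rule finite_subset)
qed

definition piece :: "nat \<Rightarrow> 'n \<Rightarrow> int \<Rightarrow> real \<Rightarrow> real poly" where
  "piece l i m \<eta> = (if \<eta> \<in> node1 l i m then lagrange_poly (node1 l i m) \<eta> else 0)"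

text \<open>The one-dimensional nodal function of \<open>\<eta>\<close>: on each interval the Lagrange polynomial of \<open>\<eta>\<close> if \<open>\<eta>\<close> is one of its nodes, and zero
  otherwise. At a grid point the interval to the right is used.\<close>

definition tent1 :: "nat \<Rightarrow> 'n \<Rightarrow> real \<Rightarrow> real \<Rightarrow> real" where
  "tent1 l i \<eta> t = poly (piece l i (cell_index l i t) \<eta>) t"

lemma degree_piece: "degree (piece l i m \<eta>) \<le> p"
  using degree_lagrange_poly[of "node1 l i m" \<eta>] by (auto simp: piece_def card_node1)

lemma poly_piece: "\<xi> \<in> node1 l i m \<Longrightarrow> poly (piece l i m \<eta>) \<xi> = (if \<xi> = \<eta> then 1 else 0)"
  by (auto simp: piece_def poly_lagrange_poly)

text \<open>The choice of the interval at a grid point is immaterial because both polynomials interpolate there. This one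
  fact makes all tensor products continuous across cell faces.\<close>

lemma tent1_eq:
  assumes "t \<in> iv l i m"
  shows "tent1 l i \<eta> t = poly (piece l i m \<eta>) t"
proof (cases "t = origin c $ i + edge c l * (m + 1)")
  case True
  have ci: "cell_index l i t = m + 1" unfolding True by (rule cell_index_end)
  have "t \<in> node1 l i m" "t \<in> node1 l i (m + 1)"
    using node1_ends(2)[of i l m] node1_ends(1)[of i l "m + 1"] True by simp_all
  then show ?thesis by (simp add: tent1_def ci poly_piece)
next
  case False
  then show ?thesis by (simp add: tent1_def cell_index_less[OF assms])
qed

definition tent :: "nat \<Rightarrow> real^'n \<Rightarrow> real^'n \<Rightarrow> real" where
  "tent l y x = (if x \<in> active_region c l then \<Prod>i\<in>UNIV. tent1 l i (y $ i) (x $ i) else 0)"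

lemma tent_on_cell:
  assumes "k \<in> active c l" "x \<in> cell c l k"
  shows "tent l y x = (\<Prod>i\<in>UNIV. poly (piece l i (k $ i) (y $ i)) (x $ i))"
proof -
  have "x \<in> active_region c l" using assms by (auto simp: active_region_def)
  moreover have "tent1 l i (y $ i) (x $ i) = poly (piece l i (k $ i) (y $ i)) (x $ i)" for i
    by (rule tent1_eq) (use assms(2) in \<open>simp add: mem_cell\<close>)
  ultimately show ?thesis by (simp add: tent_def)
qed

lemma continuous_on_active_region:
  assumes "\<And>k. k \<in> active c l \<Longrightarrow> continuous_on (cell c l k) f"
  shows "continuous_on (active_region c l) f"
  unfolding active_region_def by (rule continuous_on_closed_Union) (use assms in auto)

lemma tent_in_fe: "tent l y \<in> fe_space p c l"
proof -
  define q where "q k = (\<lambda>x :: real^'n. \<Prod>i\<in>UNIV. poly (piece l i (k $ i) (y $ i)) (x $ i))" for k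
  have q: "q k \<in> Qpoly p" for k unfolding q_def by (rule tensor_in_Qpoly) (rule degree_piece)
  have eq: "tent l y x = q k x" if "k \<in> active c l" "x \<in> cell c l k" for k x
    using tent_on_cell[OF that] by (simp add: q_def)
  have "continuous_on (cell c l k) (tent l y)" if "k \<in> active c l" for k
    using Qpoly_continuous[OF q] eq[OF that] by (subst continuous_on_cong[OF refl, of _ _ "q k"]) auto
  then have "continuous_on (active_region c l) (tent l y)" by (rule continuous_on_active_region)
  moreover have "\<forall>k\<in>active c l. \<exists>q\<in>Qpoly p. \<forall>x\<in>cell c l k. tent l y x = q x"
    using q eq by blast
  moreover have "\<forall>x. x \<notin> active_region c l \<longrightarrow> tent l y x = 0" by (simp add: tent_def)
  ultimately show ?thesis by (simp add: fe_space_def)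
qed

lemma tent_support:
  assumes "k \<in> active c l" "x \<in> cell c l k" "tent l y x \<noteq> 0"
  shows "y \<in> cell c l k"
proof -
  have "piece l i (k $ i) (y $ i) \<noteq> 0" for i
    using assms(3) unfolding tent_on_cell[OF assms(1,2)] by (auto simp: prod_zero_iff) (metis poly_0)
  then have "y $ i \<in> node1 l i (k $ i)" for i by (meson piece_def)
  then show ?thesis by (auto simp: mem_cell intro: subsetD[OF node1_sub])
qed

lemma tent_node:
  assumes "z \<in> nodes p c l"
  shows "tent l y z = (if z = y then 1 else 0)"
proof -
  obtain k where k: "k \<in> active c l" "z \<in> cell c l k" using node_in_active_cell[OF assms] .
  have "tent l y z = (\<Prod>i\<in>UNIV. if z $ i = y $ i then 1 else 0)"
    unfolding tent_on_cell[OF k]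
    by (intro prod.cong refl poly_piece nodes_in_cell[OF assms k(2)])
  also have "\<dots> = (if z = y then 1 else 0)"
  proof (cases "z = y")
    case False
    then obtain i where "z $ i \<noteq> y $ i" by (auto simp: vec_eq_iff)
    then have "(\<Prod>i\<in>UNIV. if z $ i = y $ i then 1 else 0 :: real) = 0" by (intro prod_zero) auto
    then show ?thesis using False by simp
  qed simp
  finally show ?thesis .
qed

lemma Qpoly_zero_on_cell:
  assumes q: "q \<in> Qpoly p" and zero: "\<And>x. \<lbrakk>x \<in> cell c l k; \<And>i. x $ i \<in> node1 l i (k $ i)\<rbrakk> \<Longrightarrow> q x = 0"
  shows "q = 0"
proof
  fix x :: "real^'n"
  have "q x = 0"
    by (rule Qpoly_unisolvent[OF q, of "\<lambda>i. node1 l i (k $ i)"])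
       (auto simp: card_node1 mem_cell intro!: zero subsetD[OF node1_sub])
  then show "q x = 0 x" by simp
qed

lemma subspace_fe: "subspace (fe_space p c l)"
proof (rule subspaceI)
  show "0 \<in> fe_space p c l"
    unfolding fe_space_def
    using subspace_0[OF subspace_Qpoly[of p]] by (auto simp: zero_fun_def intro!: bexI)
next
  fix u v assume uv: "u \<in> fe_space p c l" "v \<in> fe_space p c l"
  then show "u + v \<in> fe_space p c l"
    unfolding fe_space_def plus_fun_def
    by (auto intro!: continuous_on_add)
       (smt (verit) plus_fun_def subspace_add[OF subspace_Qpoly])
next
  fix r :: real and u assume u: "u \<in> fe_space p c l"
  then show "r *\<^sub>R u \<in> fe_space p c l"
    unfolding fe_space_def scaleR_fun_def
    by (auto intro!: continuous_intros)
       (metis (mono_tags, lifting) real_scaleR_def scaleR_fun_apply subspace_scale[OF subspace_Qpoly])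
qed

lemma fe_zero_by_nodes:
  assumes v: "v \<in> fe_space p c l" and zero: "\<And>z. z \<in> nodes p c l \<Longrightarrow> v z = 0"
  shows "v = 0"
proof
  fix x
  show "v x = 0 x"
  proof (cases "x \<in> active_region c l")
    case True
    then obtain k where k: "k \<in> active c l" "x \<in> cell c l k" by (auto simp: active_region_def)
    then obtain q where q: "q \<in> Qpoly p" "\<forall>x\<in>cell c l k. v x = q x" using v by (auto simp: fe_space_def)
    have "q = 0"
    proof (rule Qpoly_zero_on_cell[OF q(1), of l k])
      fix x assume x: "x \<in> cell c l k" "\<And>i. x $ i \<in> node1 l i (k $ i)"
      then have "x \<in> nodes p c l" using k(1) by (auto simp: mem_nodes)
      then show "q x = 0" using zero q x by auto
    qed
    then show ?thesis using q k by simp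
  qed (use v in \<open>auto simp: fe_space_def\<close>)
qed

text \<open>Existence is the tensor product of one-dimensional nodal functions, uniqueness is unisolvence on each cell.\<close>

lemma nodal_basis_eq: "y \<in> nodes p c l \<Longrightarrow> nodal_basis p c l y = tent l y"
  unfolding nodal_basis_def
proof (rule the_equality)
  show "tent l y \<in> fe_space p c l \<and> (\<forall>z\<in>nodes p c l. tent l y z = (if z = y then 1 else 0))"
    using tent_in_fe tent_node by auto
  fix \<phi> assume \<phi>: "\<phi> \<in> fe_space p c l \<and> (\<forall>z\<in>nodes p c l. \<phi> z = (if z = y then 1 else 0))"
  have "\<phi> - tent l y = 0"
    by (rule fe_zero_by_nodes) (use \<phi> tent_in_fe tent_node subspace_diff[OF subspace_fe] in auto)
  then show "\<phi> = tent l y" by simp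
qed

lemma nodal_span_eq:
  assumes "Y \<subseteq> nodes p c l"
  shows "nodal_span p c l Y = span (tent l ` Y)"
proof -
  have fin: "finite Y" by (rule finite_subset[OF assms finite_nodes])
  have eq: "(\<lambda>x. \<Sum>y\<in>Y. a y * nodal_basis p c l y x) = (\<Sum>y\<in>Y. a y *\<^sub>R tent l y)" for a
    using assms nodal_basis_eq by (auto simp: fun_eq_iff subset_iff intro!: sum.cong)
  have "nodal_span p c l Y = {v. \<exists>a. v = (\<Sum>y\<in>Y. a y *\<^sub>R tent l y)}"
    unfolding nodal_span_def eq ..
  also have "\<dots> = span (tent l ` Y)"
  proof
    show "{v. \<exists>a. v = (\<Sum>y\<in>Y. a y *\<^sub>R tent l y)} \<subseteq> span (tent l ` Y)"
      by clarify (intro span_sum span_scale span_base imageI)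
    show "span (tent l ` Y) \<subseteq> {v. \<exists>a. v = (\<Sum>y\<in>Y. a y *\<^sub>R tent l y)}"
    proof (rule span_minimal)
      show "tent l ` Y \<subseteq> {v. \<exists>a. v = (\<Sum>y\<in>Y. a y *\<^sub>R tent l y)}"
      proof (clarify)
        fix y assume y: "y \<in> Y"
        have "(\<Sum>z\<in>Y. (if z = y then 1 else 0) *\<^sub>R tent l z) = (\<Sum>z\<in>Y. if z = y then tent l y else 0)"
          by (rule sum.cong) auto
        also have "\<dots> = tent l y" using y fin by simp
        finally show "\<exists>a. tent l y = (\<Sum>z\<in>Y. a z *\<^sub>R tent l z)" by metis
      qed
      show "subspace {v. \<exists>a. v = (\<Sum>y\<in>Y. a y *\<^sub>R tent l y)}"
      proof (rule subspaceI)
        show "0 \<in> {v. \<exists>a. v = (\<Sum>y\<in>Y. a y *\<^sub>R tent l y)}"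
          by (auto intro!: exI[of _ "\<lambda>_. 0"])
      next
        fix u v assume "u \<in> {v. \<exists>a. v = (\<Sum>y\<in>Y. a y *\<^sub>R tent l y)}"
          "v \<in> {v. \<exists>a. v = (\<Sum>y\<in>Y. a y *\<^sub>R tent l y)}"
        then obtain a b where "u = (\<Sum>y\<in>Y. a y *\<^sub>R tent l y)" "v = (\<Sum>y\<in>Y. b y *\<^sub>R tent l y)"
          by blast
        then show "u + v \<in> {v. \<exists>a. v = (\<Sum>y\<in>Y. a y *\<^sub>R tent l y)}"
          by (intro CollectI exI[of _ "\<lambda>y. a y + b y"]) (simp add: sum.distrib scaleR_add_left)
      next
        fix r u assume "u \<in> {v. \<exists>a. v = (\<Sum>y\<in>Y. a y *\<^sub>R tent l y)}"
        then obtain a where "u = (\<Sum>y\<in>Y. a y *\<^sub>R tent l y)" by blast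
        then show "r *\<^sub>R u \<in> {v. \<exists>a. v = (\<Sum>y\<in>Y. a y *\<^sub>R tent l y)}"
          by (intro CollectI exI[of _ "\<lambda>y. r * a y"]) (simp add: scaleR_sum_right)
      qed
    qed
  qed
  finally show ?thesis .
qed

lemma fe_space_span: "fe_space p c l = span (tent l ` nodes p c l)"
proof
  show "span (tent l ` nodes p c l) \<subseteq> fe_space p c l"
    by (rule span_minimal[OF _ subspace_fe]) (use tent_in_fe in auto)
  show "fe_space p c l \<subseteq> span (tent l ` nodes p c l)"
  proof
    fix v assume v: "v \<in> fe_space p c l"
    define w where "w = (\<Sum>y\<in>nodes p c l. v y *\<^sub>R tent l y)"
    have w: "w \<in> fe_space p c l"
      unfolding w_def by (intro subspace_sum[OF subspace_fe] subspace_scale[OF subspace_fe] tent_in_fe)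
    have "v - w = 0"
    proof (rule fe_zero_by_nodes)
      show "v - w \<in> fe_space p c l" using v w by (rule subspace_diff[OF subspace_fe])
      fix z assume z: "z \<in> nodes p c l"
      have "w z = (\<Sum>y\<in>nodes p c l. if z = y then v z else 0)"
        unfolding w_def sum_fun_apply by (intro sum.cong) (simp_all add: tent_node[OF z])
      then show "(v - w) z = 0" using z by simp
    qed
    then have "v = w" by simp
    then show "v \<in> span (tent l ` nodes p c l)"
      unfolding w_def by (metis (no_types, lifting) imageI span_base span_scale span_sum)
  qed
qed

lemma cell_poly_unique:
  assumes "q \<in> Qpoly p" "q' \<in> Qpoly p" "\<And>x. x \<in> cell c l k \<Longrightarrow> q x = q' x"
  shows "q = q'"
proof -
  have "q - q' = 0"
    by (rule Qpoly_zero_on_cell[of _ l k]) (use assms subspace_diff[OF subspace_Qpoly] in auto)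
  then show ?thesis by simp
qed

lemma cell_poly:
  assumes "v \<in> fe_space p c l" "k \<in> active c l"
  shows "cell_poly p c l k v \<in> Qpoly p" "x \<in> cell c l k \<Longrightarrow> cell_poly p c l k v x = v x"
proof -
  obtain q where q: "q \<in> Qpoly p" "\<forall>x\<in>cell c l k. v x = q x" using assms by (auto simp: fe_space_def)
  have "cell_poly p c l k v = q"
    unfolding cell_poly_def by (rule the_equality) (use q cell_poly_unique[of _ q l k] in auto)
  then show "cell_poly p c l k v \<in> Qpoly p" "x \<in> cell c l k \<Longrightarrow> cell_poly p c l k v x = v x"
    using q by auto
qed

lemma cell_poly_add:
  assumes "u \<in> fe_space p c l" "v \<in> fe_space p c l" "k \<in> active c l"
  shows "cell_poly p c l k (u + v) = cell_poly p c l k u + cell_poly p c l k v"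
  by (rule cell_poly_unique[of _ _ l k])
     (use assms cell_poly subspace_add[OF subspace_fe] in \<open>auto intro!: subspace_add[OF subspace_Qpoly]\<close>)

lemma cell_poly_scale:
  assumes "u \<in> fe_space p c l" "k \<in> active c l"
  shows "cell_poly p c l k (r *\<^sub>R u) = r *\<^sub>R cell_poly p c l k u"
  by (rule cell_poly_unique[of _ _ l k])
     (use assms cell_poly subspace_scale[OF subspace_fe] in \<open>auto intro!: subspace_scale[OF subspace_Qpoly]\<close>)

lemma cell_poly_zero:
  assumes "u \<in> fe_space p c l" "k \<in> active c l" "\<And>x. x \<in> cell c l k \<Longrightarrow> u x = 0"
  shows "cell_poly p c l k u = 0"
  by (rule cell_poly_unique[of _ _ l k])
     (use assms cell_poly subspace_0[OF subspace_Qpoly] in auto)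

end

section \<open>The outward normal\<close>

lemma GDERIV_unique:
  assumes "GDERIV f x :> a" "GDERIV f x :> b"
  shows "a = b"
proof -
  have "(\<lambda>h. h \<bullet> a) = (\<lambda>h. h \<bullet> b)"
    using has_derivative_unique assms unfolding gderiv_def by blast
  then have "(a - b) \<bullet> a = (a - b) \<bullet> b" by metis
  then have "(a - b) \<bullet> (a - b) = 0" by (simp add: inner_diff_right)
  then show ?thesis by simp
qed

lemma GDERIV_line:
  assumes "GDERIV \<psi> x :> g"
  shows "((\<lambda>t. \<psi> (x + t *\<^sub>R v)) has_real_derivative v \<bullet> g) (at 0)"
proof -
  have d: "((\<lambda>t. x + t *\<^sub>R v) has_derivative (\<lambda>t. t *\<^sub>R v)) (at 0)"
    by (auto intro!: derivative_eq_intros)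
  have "((\<lambda>t. \<psi> (x + t *\<^sub>R v)) has_derivative (\<lambda>t. (t *\<^sub>R v) \<bullet> g)) (at 0)"
    by (rule has_derivative_compose[OF d]) (use assms in \<open>simp add: gderiv_def\<close>)
  then show ?thesis by (simp add: has_field_derivative_def mult_commute_abs)
qed

text \<open>Along a direction in which \<open>\<psi>\<close> decreases, a zero of \<open>\<psi>\<close> is left at once towards the sublevel set.\<close>

lemma level_descent:
  assumes \<psi>: "GDERIV \<psi> x :> g" "\<psi> x = 0" and v: "v \<bullet> g < 0" and U: "open U" "x \<in> U"
  shows "\<exists>d>0. \<forall>t. 0 < t \<longrightarrow> t < d \<longrightarrow> x + t *\<^sub>R v \<in> U \<and> \<psi> (x + t *\<^sub>R v) < 0"
proof -
  obtain d1 where d1: "d1 > 0" "\<forall>h>0. h < d1 \<longrightarrow> \<psi> (x + 0 *\<^sub>R v) > \<psi> (x + (0 + h) *\<^sub>R v)"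
    using DERIV_neg_dec_right[OF GDERIV_line[OF \<psi>(1), of v] v] by blast
  have "isCont (\<lambda>t. x + t *\<^sub>R v) 0" by (intro continuous_intros)
  then have "\<forall>\<^sub>F t in at 0. x + t *\<^sub>R v \<in> U"
    using U by (auto simp: isCont_def dest!: topological_tendstoD[of _ _ _ U])
  then obtain d2 where d2: "d2 > 0" "\<forall>t. t \<noteq> 0 \<longrightarrow> \<bar>t\<bar> < d2 \<longrightarrow> x + t *\<^sub>R v \<in> U"
    by (auto simp: eventually_at dist_norm)
  show ?thesis
    using d1 d2 \<psi>(2) by (intro exI[of _ "min d1 d2"]) auto
qed

lemma sgn_inner_lt:
  fixes a b :: "'a::real_inner"
  assumes "a \<noteq> 0" "b \<noteq> 0" "sgn a \<noteq> sgn b"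
  shows "(sgn b - sgn a) \<bullet> a < 0"
proof -
  have n: "norm (sgn a) = 1" "norm (sgn b) = 1" using assms by (simp_all add: norm_sgn)
  have "0 < (norm (sgn b - sgn a))\<^sup>2" using assms by simp
  also have "\<dots> = 2 - 2 * (sgn b \<bullet> sgn a)"
    using n by (simp add: power2_norm_eq_inner inner_diff inner_commute norm_eq_1)
  finally have l: "sgn b \<bullet> sgn a < 1" by simp
  have "a = norm a *\<^sub>R sgn a" using assms by (simp add: sgn_div_norm)
  then have "(sgn b - sgn a) \<bullet> a = norm a * (sgn b \<bullet> sgn a - sgn a \<bullet> sgn a)"
    by (metis inner_diff_left inner_scaleR_right)
  also have "\<dots> = norm a * (sgn b \<bullet> sgn a - 1)" using n by (simp add: norm_eq_1)
  also have "\<dots> < 0" using l assms by (simp add: mult_less_0_iff)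
  finally show ?thesis .
qed

lemma C2_defining_functionD:
  assumes "C2_defining_function \<Omega> U \<psi> G"
  shows "open U" "x \<in> U \<Longrightarrow> GDERIV \<psi> x :> G x" "x \<in> U \<Longrightarrow> G x \<noteq> 0" "x \<in> U \<Longrightarrow> isCont G x"
    "\<Omega> \<inter> U = {x \<in> U. \<psi> x < 0}" "frontier \<Omega> \<inter> U = {x \<in> U. \<psi> x = 0}"
  using assms has_derivative_continuous unfolding C2_defining_function_def by blast+

text \<open>If the unit gradients differed, then along their difference one defining function would decrease and the
  other increase, so that the same points would lie inside and outside the domain.\<close>

lemma C2_defining_function_normal_unique:
  assumes 1: "C2_defining_function \<Omega> U \<psi> G" "x \<in> U" and 2: "C2_defining_function \<Omega> U' \<psi>' G'" "x \<in> U'"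
    and x: "x \<in> frontier \<Omega>"
  shows "sgn (G x) = sgn (G' x)"
proof (rule ccontr)
  assume ne: "sgn (G x) \<noteq> sgn (G' x)"
  have a: "open U" "GDERIV \<psi> x :> G x" "G x \<noteq> 0" "\<Omega> \<inter> U = {x \<in> U. \<psi> x < 0}" "\<psi> x = 0"
    using 1 x by (auto simp: C2_defining_function_def)
  have b: "open U'" "GDERIV \<psi>' x :> G' x" "G' x \<noteq> 0" "\<Omega> \<inter> U' = {x \<in> U'. \<psi>' x < 0}" "\<psi>' x = 0"
    using 2 x by (auto simp: C2_defining_function_def)
  define v where "v = sgn (G' x) - sgn (G x)"
  have v1: "v \<bullet> G x < 0" unfolding v_def by (rule sgn_inner_lt[OF a(3) b(3) ne])
  have "(sgn (G x) - sgn (G' x)) \<bullet> G' x < 0" by (rule sgn_inner_lt[OF b(3) a(3) ne[symmetric]])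
  then have v2: "v \<bullet> (- G' x) < 0" by (simp add: v_def inner_diff_left)
  have b': "GDERIV (\<lambda>x. - \<psi>' x) x :> - G' x" using b(2) by (rule GDERIV_minus)
  have b5: "- \<psi>' x = 0" using b(5) by simp
  obtain d1 where d1: "d1 > 0" "\<forall>t. 0 < t \<longrightarrow> t < d1 \<longrightarrow> x + t *\<^sub>R v \<in> U \<and> \<psi> (x + t *\<^sub>R v) < 0"
    using level_descent[OF a(2) a(5) v1 a(1) 1(2)] by blast
  obtain d2 where d2: "d2 > 0" "\<forall>t. 0 < t \<longrightarrow> t < d2 \<longrightarrow> x + t *\<^sub>R v \<in> U' \<and> - \<psi>' (x + t *\<^sub>R v) < 0"
    using level_descent[OF b' b5 v2 b(1) 2(2)] by blast
  define t where "t = min d1 d2 / 2"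
  have t: "0 < t" "t < d1" "t < d2" using d1 d2 by (auto simp: t_def)
  have "x + t *\<^sub>R v \<in> \<Omega>" using d1 t a(4) by blast
  moreover have "x + t *\<^sub>R v \<notin> \<Omega>" using d2 t b(4) by force
  ultimately show False by simp
qed

lemma outward_normal_eq:
  assumes "C2_defining_function \<Omega> U \<psi> G" "x \<in> U" "x \<in> frontier \<Omega>"
  shows "outward_normal \<Omega> x = sgn (G x)"
  unfolding outward_normal_def
proof (rule the_equality)
  show "\<exists>U \<psi> G'. x \<in> U \<and> C2_defining_function \<Omega> U \<psi> G' \<and> sgn (G x) = sgn (G' x)"
    by (intro exI[of _ U] exI[of _ \<psi>] exI[of _ G] conjI assms refl)
  show "\<nu> = sgn (G x)" if ex: "\<exists>U \<psi> G. x \<in> U \<and> C2_defining_function \<Omega> U \<psi> G \<and> \<nu> = sgn (G x)" for \<nu>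
  proof -
    obtain U' \<psi>' G' where a: "x \<in> U'" "C2_defining_function \<Omega> U' \<psi>' G'" "\<nu> = sgn (G' x)"
      using ex by blast
    show ?thesis using C2_defining_function_normal_unique[OF a(2,1) assms] a(3) by simp
  qed
qed

lemma continuous_outward_normal:
  assumes "C2_boundary \<Omega>"
  shows "continuous_on (frontier \<Omega>) (outward_normal \<Omega>)"
  unfolding continuous_on_eq_continuous_within
proof
  fix x assume x: "x \<in> frontier \<Omega>"
  obtain U \<psi> G where U: "x \<in> U" "C2_defining_function \<Omega> U \<psi> G"
    using assms x unfolding C2_boundary_def by blast
  note H = C2_defining_functionD[OF U(2)]
  have "continuous (at x within frontier \<Omega>) (\<lambda>y. sgn (G y))"
    by (rule continuous_at_imp_continuous_within[OF isCont_sgn[OF H(4)[OF U(1)] H(3)[OF U(1)]]])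
  then show "continuous (at x within frontier \<Omega>) (outward_normal \<Omega>)"
  proof (rule continuous_transform_within_openin)
    show "openin (top_of_set (frontier \<Omega>)) (frontier \<Omega> \<inter> U)" using H(1) by (simp add: openin_open_Int)
    show "x \<in> frontier \<Omega> \<inter> U" using x U by simp
    show "sgn (G y) = outward_normal \<Omega> y" if "y \<in> frontier \<Omega> \<inter> U" for y
      using outward_normal_eq[OF U(2)] that by simp
  qed
qed

lemma inward_segment:
  assumes "C2_boundary \<Omega>" "x \<in> frontier \<Omega>"
  shows "\<exists>d>0. \<forall>t. 0 < t \<longrightarrow> t < d \<longrightarrow> x - t *\<^sub>R outward_normal \<Omega> x \<in> \<Omega>"
proof -
  obtain U \<psi> G where U: "x \<in> U" "C2_defining_function \<Omega> U \<psi> G"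
    using assms unfolding C2_boundary_def by blast
  have a: "open U" "GDERIV \<psi> x :> G x" "G x \<noteq> 0" "\<Omega> \<inter> U = {x \<in> U. \<psi> x < 0}" "\<psi> x = 0"
    using U assms(2) by (auto simp: C2_defining_function_def)
  have "- sgn (G x) \<bullet> G x < 0" using a(3) by (simp add: sgn_div_norm)
  from level_descent[OF a(2,5) this a(1) U(1)] show ?thesis
    using a(4) outward_normal_eq[OF U(2,1) assms(2)] by fastforce
qed

section \<open>Finite measure of a smooth boundary\<close>

text \<open>Near a point where \<open>\<partial>\<^sub>i \<psi> \<noteq> 0\<close> the mean value theorem, applied to \<open>\<psi>\<close> between two boundary points, bounds the
  difference of their \<open>i\<close>-th coordinates by the others. This is the quantitative part of the implicit function
  theorem, and it suffices for the measure estimate.\<close>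

lemma C2_boundary_locally_graph:
  fixes \<Omega> :: "(real^'n) set"
  assumes "C2_boundary \<Omega>" "x0 \<in> frontier \<Omega>"
  shows "\<exists>r>0. hausdorff_outer (real CARD('n) - 1) (frontier \<Omega> \<inter> ball x0 r) < \<infinity>"
proof -
  obtain U \<psi> G where U: "x0 \<in> U" "C2_defining_function \<Omega> U \<psi> G"
    using assms unfolding C2_boundary_def by blast
  note H = C2_defining_functionD[OF U(2)]
  obtain i where i: "G x0 $ i \<noteq> 0" using H(3)[OF U(1)] by (auto simp: vec_eq_iff)
  \<comment> \<open>on the ball chosen below, \<open>|G $ i| \<ge> m\<close> and all components of \<open>G\<close> are at most \<open>M\<close>\<close>
  define m where "m = \<bar>G x0 $ i\<bar> / 2"
  have m: "m > 0" using i by (simp add: m_def)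
  define M where "M = norm (G x0) + m"
  have M: "0 \<le> M" using m by (simp add: M_def)
  obtain r1 where r1: "r1 > 0" "\<And>y. dist y x0 < r1 \<Longrightarrow> dist (G y) (G x0) < m"
    using m H(4)[OF U(1)] unfolding continuous_at_eps_delta by blast
  obtain r2 where r2: "r2 > 0" "ball x0 r2 \<subseteq> U" using H(1) U(1) open_contains_ball by blast
  define r where "r = min r1 r2"
  have r: "r > 0" using r1 r2 by (simp add: r_def)
  have G1: "m \<le> \<bar>G y $ i\<bar>" and G2: "\<And>j. \<bar>G y $ j\<bar> \<le> M" if "y \<in> ball x0 r" for y
  proof -
    have d: "norm (G y - G x0) < m"
      using r1(2)[of y] that by (simp add: r_def dist_norm norm_minus_commute)
    show "m \<le> \<bar>G y $ i\<bar>" using component_le_norm_cart[of "G y - G x0" i] d by (simp add: m_def)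
    show "\<bar>G y $ j\<bar> \<le> M" for j
      using component_le_norm_cart[of "G y" j] norm_triangle_sub[of "G y" "G x0"] d by (simp add: M_def)
  qed
  have lip: "\<bar>x $ i - y $ i\<bar> \<le> M / m * (\<Sum>j\<in>UNIV - {i}. \<bar>x $ j - y $ j\<bar>)"
    if x: "x \<in> frontier \<Omega> \<inter> ball x0 r" and y: "y \<in> frontier \<Omega> \<inter> ball x0 r" for x y
  proof -
    define v where "v = x - y"
    have seg: "y + t *\<^sub>R v \<in> ball x0 r" if "0 \<le> t" "t \<le> 1" for t
    proof -
      have "(1 - t) *\<^sub>R y + t *\<^sub>R x \<in> ball x0 r"
        by (rule convexD[OF convex_ball]) (use x y that in auto)
      then show ?thesis by (simp add: v_def algebra_simps)
    qed
    have D: "((\<lambda>t. \<psi> (y + t *\<^sub>R v)) has_real_derivative v \<bullet> G (y + t *\<^sub>R v)) (at t)"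
      if "0 \<le> t" "t \<le> 1" for t
    proof -
      have "y + t *\<^sub>R v \<in> U" using seg[OF that] r2 by (auto simp: r_def)
      then have "((\<lambda>s. \<psi> ((y + t *\<^sub>R v) + s *\<^sub>R v)) has_real_derivative v \<bullet> G (y + t *\<^sub>R v)) (at 0)"
        by (intro GDERIV_line H(2))
      moreover have "(\<lambda>s. \<psi> ((y + t *\<^sub>R v) + s *\<^sub>R v)) = (\<lambda>s. \<psi> (y + (s + t) *\<^sub>R v))"
        by (simp add: algebra_simps)
      ultimately show ?thesis using DERIV_shift[of "\<lambda>s. \<psi> (y + s *\<^sub>R v)" _ 0 t] by simp
    qed
    obtain z :: real where z: "0 < z" "z < 1"
        "\<psi> (y + 1 *\<^sub>R v) - \<psi> (y + 0 *\<^sub>R v) = (1 - 0) * (v \<bullet> G (y + z *\<^sub>R v))"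
      using MVT2[of 0 1 "\<lambda>t. \<psi> (y + t *\<^sub>R v)" "\<lambda>t. v \<bullet> G (y + t *\<^sub>R v)"] D by auto
    define g where "g = G (y + z *\<^sub>R v)"
    have "\<psi> x = 0" "\<psi> y = 0" using x y H(6) r2 by (auto simp: r_def)
    then have "v \<bullet> g = 0" using z(3) by (simp add: g_def v_def)
    then have "v $ i * g $ i + (\<Sum>j\<in>UNIV - {i}. v $ j * g $ j) = 0"
      by (simp add: inner_vec_def sum.remove[of UNIV i])
    then have "\<bar>v $ i\<bar> * \<bar>g $ i\<bar> = \<bar>\<Sum>j\<in>UNIV - {i}. v $ j * g $ j\<bar>"
      by (simp add: abs_mult[symmetric])
    also have "\<dots> \<le> (\<Sum>j\<in>UNIV - {i}. \<bar>v $ j\<bar> * \<bar>g $ j\<bar>)"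
      by (rule order_trans[OF sum_abs]) (simp add: abs_mult)
    also have "\<dots> \<le> (\<Sum>j\<in>UNIV - {i}. \<bar>v $ j\<bar> * M)"
      using G2[OF seg, of z] z by (intro sum_mono mult_left_mono) (auto simp: g_def)
    also have "\<dots> = M * (\<Sum>j\<in>UNIV - {i}. \<bar>v $ j\<bar>)" by (simp add: sum_distrib_left mult.commute)
    finally have "\<bar>v $ i\<bar> * \<bar>g $ i\<bar> \<le> M * (\<Sum>j\<in>UNIV - {i}. \<bar>v $ j\<bar>)" .
    moreover have "\<bar>v $ i\<bar> * m \<le> \<bar>v $ i\<bar> * \<bar>g $ i\<bar>"
      using G1[OF seg, of z] z by (intro mult_left_mono) (auto simp: g_def)
    ultimately show ?thesis using m by (simp add: v_def field_simps)
  qed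
  have "hausdorff_outer (real CARD('n) - 1) (frontier \<Omega> \<inter> ball x0 r) < \<infinity>"
    by (rule lipschitz_graph_finite_measure[of _ "M / m" i])
       (use lip M m in \<open>auto intro: bounded_subset[OF bounded_ball]\<close>)
  then show ?thesis using r by blast
qed

lemma C2_boundary_finite_measure:
  fixes \<Omega> :: "(real^'n) set"
  assumes "C2_boundary \<Omega>" "bounded \<Omega>"
  shows "hausdorff_outer (real CARD('n) - 1) (frontier \<Omega>) < \<infinity>"
proof -
  obtain r where r: "\<And>x. x \<in> frontier \<Omega> \<Longrightarrow> r x > 0"
      "\<And>x. x \<in> frontier \<Omega> \<Longrightarrow> hausdorff_outer (real CARD('n) - 1) (frontier \<Omega> \<inter> ball x (r x)) < \<infinity>"
    using C2_boundary_locally_graph[OF assms(1)] by metis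
  have "compact (frontier \<Omega>)"
    using assms(2) by (simp add: compact_frontier_bounded)
  then obtain F where F: "F \<subseteq> frontier \<Omega>" "finite F" "frontier \<Omega> \<subseteq> (\<Union>x\<in>F. ball x (r x))"
    by (rule compactE_image[where C = "frontier \<Omega>" and f = "\<lambda>x. ball x (r x)"]) (use r(1) in auto)
  have "hausdorff_outer (real CARD('n) - 1) (\<Union>x\<in>F'. frontier \<Omega> \<inter> ball x (r x)) < \<infinity>"
    if "finite F'" "F' \<subseteq> frontier \<Omega>" for F'
    using that
  proof (induction F' rule: finite_induct)
    case (insert x F')
    have "hausdorff_outer (real CARD('n) - 1) (\<Union>x\<in>insert x F'. frontier \<Omega> \<inter> ball x (r x))
        \<le> hausdorff_outer (real CARD('n) - 1) (frontier \<Omega> \<inter> ball x (r x))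
          + hausdorff_outer (real CARD('n) - 1) (\<Union>x\<in>F'. frontier \<Omega> \<inter> ball x (r x))"
      using hausdorff_outer_Un_le by simp
    also have "\<dots> < \<infinity>" using insert r(2)[of x] by simp
    finally show ?case .
  qed (simp add: hausdorff_outer_empty)
  from this[OF F(2,1)] have "hausdorff_outer (real CARD('n) - 1) (\<Union>x\<in>F. frontier \<Omega> \<inter> ball x (r x)) < \<infinity>" .
  moreover have "(\<Union>x\<in>F. frontier \<Omega> \<inter> ball x (r x)) = frontier \<Omega>" using F(3) by auto
  ultimately show ?thesis by simp
qed

section \<open>Traces and normal derivatives on the boundary\<close>

locale fe_domain = fe_grid c p for c :: "('n::finite) cut_config" and p +
  assumes C2: "C2_boundary (Omega c)" and dim: "2 \<le> CARD('n)"
begin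

abbreviation nv :: "real^'n \<Rightarrow> real^'n" where
  "nv x \<equiv> outward_normal (Omega c) x"

lemma closed_Gam [simp]: "closed (Gam c)" by (simp add: Gam_def)

lemma Gam_borel [measurable, simp]: "Gam c \<in> sets borel" by (simp add: borel_closed)

lemma Gam_finite: "emeasure surface_measure (Gam c) < \<infinity>"
  using C2_boundary_finite_measure[OF C2 bounded_Omega]
  by (simp add: emeasure_surface_measure Gam_def borel_closed)

lemma Gam_pos: "0 < emeasure surface_measure (Gam c)"
  using frontier_positive_measure[OF open_Omega bounded_Omega Omega_ne dim]
  by (simp add: emeasure_surface_measure Gam_def borel_closed)

lemma Gam_sub_active: "Gam c \<subseteq> active_region c l"
  using closure_minimal[OF Omega_sub_active[of l] closed_active_region] by (auto simp: Gam_def frontier_def)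

text \<open>To the right, the interval of \<open>cell_index\<close> contains \<open>a\<close> and a right neighbourhood of it; to the left, the index
  \<open>\<lceil>(a - origin) / edge\<rceil> - 1\<close> selects the interval that contains \<open>a\<close> and begins strictly below it.\<close>

lemma segment_in_interval: "\<exists>m. \<exists>d>0. \<forall>t. 0 \<le> t \<longrightarrow> t \<le> d \<longrightarrow> a + t * v \<in> iv l i m"
proof (cases "0 \<le> v")
  case True
  define m where "m = cell_index l i a"
  define e where "e = origin c $ i + edge c l * (m + 1) - a"
  have a: "a \<in> iv l i m" unfolding m_def by (rule iv_cell_index)
  have "a \<noteq> origin c $ i + edge c l * (m + 1)"
  proof
    assume "a = origin c $ i + edge c l * (m + 1)"
    then have "cell_index l i a = m + 1" using cell_index_end[of l i m] by simp
    then show False by (simp add: m_def)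
  qed
  then have e: "e > 0" using a by (auto simp: e_def iv_def)
  have "a + t * v \<in> iv l i m" if "0 \<le> t" "t \<le> e / (v + 1)" for t
  proof -
    have "t * (v + 1) \<le> e" using that True by (simp add: pos_le_divide_eq)
    then have "t * v \<le> e" using that by (simp add: algebra_simps)
    moreover have "0 \<le> t * v" using that True by simp
    ultimately show ?thesis using a by (auto simp: iv_def e_def)
  qed
  then show ?thesis using e True by (intro exI[of _ m] exI[of _ "e / (v + 1)"]) auto
next
  case False
  define m where "m = \<lceil>(a - origin c $ i) / edge c l\<rceil> - 1"
  define e where "e = a - (origin c $ i + edge c l * m)"
  let ?z = "(a - origin c $ i) / edge c l"
  have az: "a = origin c $ i + edge c l * ?z" by simp
  have "of_int m < ?z" "?z \<le> of_int (m + 1)" unfolding m_def by linarith+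
  then have "edge c l * of_int m < edge c l * ?z" "edge c l * ?z \<le> edge c l * of_int (m + 1)"
    by (auto intro!: mult_strict_left_mono mult_left_mono less_imp_le[OF edge_pos] simp del: times_divide_eq_right)
  then have e: "e > 0" and a: "a \<le> origin c $ i + edge c l * of_int (m + 1)"
    using az by (auto simp: e_def)
  have "a + t * v \<in> iv l i m" if "0 \<le> t" "t \<le> e / (1 - v)" for t
  proof -
    have "t * (1 - v) \<le> e" using that False by (simp add: pos_le_divide_eq)
    then have "- e \<le> t * v" using that by (simp add: algebra_simps)
    moreover have "t * v \<le> 0" using that False by (simp add: mult_nonneg_nonpos)
    ultimately show ?thesis using a unfolding iv_def e_def by auto
  qed
  then show ?thesis using e False by (intro exI[of _ m] exI[of _ "e / (1 - v)"]) auto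
qed

lemma segment_in_cell:
  fixes x v :: "real^'n"
  shows "\<exists>k. \<exists>d>0. \<forall>t. 0 \<le> t \<longrightarrow> t \<le> d \<longrightarrow> x + t *\<^sub>R v \<in> cell c l k"
proof -
  obtain m d where md: "\<And>i. d i > 0" "\<And>i t. 0 \<le> t \<Longrightarrow> t \<le> d i \<Longrightarrow> x $ i + t * v $ i \<in> iv l i (m i)"
  proof -
    have "\<exists>m. \<exists>d>0. \<forall>t. 0 \<le> t \<longrightarrow> t \<le> d \<longrightarrow> x $ i + t * v $ i \<in> iv l i m" for i
      by (rule segment_in_interval)
    then show ?thesis using that by metis
  qed
  define e where "e = Min (range d)"
  have e: "e > 0" using md(1) by (simp add: e_def)
  have "e \<le> d i" for i by (simp add: e_def)
  then show ?thesis
    using e md(2) by (intro exI[of _ "\<chi> i. m i"] exI[of _ e]) (auto simp: mem_cell intro: order_trans)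
qed

definition gradq :: "nat \<Rightarrow> int^'n \<Rightarrow> (real^'n \<Rightarrow> real) \<Rightarrow> real^'n \<Rightarrow> real^'n" where
  "gradq l k u = (SOME g. continuous_on UNIV g \<and> (\<forall>x. GDERIV (cell_poly p c l k u) x :> g x))"

lemma gradq:
  assumes "u \<in> fe_space p c l" "k \<in> active c l"
  shows "continuous_on S (gradq l k u)" "GDERIV (cell_poly p c l k u) x :> gradq l k u x"
proof -
  have "continuous_on UNIV (gradq l k u) \<and> (\<forall>x. GDERIV (cell_poly p c l k u) x :> gradq l k u x)"
    unfolding gradq_def using Qpoly_GDERIV[OF cell_poly(1)[OF assms]] by (rule someI_ex)
  then show "continuous_on S (gradq l k u)" "GDERIV (cell_poly p c l k u) x :> gradq l k u x"
    using continuous_on_subset by blast+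
qed

lemma gradq_add:
  assumes "u \<in> fe_space p c l" "v \<in> fe_space p c l" "k \<in> active c l"
  shows "gradq l k (u + v) x = gradq l k u x + gradq l k v x"
proof -
  have "GDERIV (cell_poly p c l k (u + v)) x :> gradq l k u x + gradq l k v x"
    unfolding cell_poly_add[OF assms] by (subst plus_fun_def) (intro GDERIV_add gradq assms)
  moreover have "GDERIV (cell_poly p c l k (u + v)) x :> gradq l k (u + v) x"
    by (intro gradq subspace_add[OF subspace_fe] assms)
  ultimately show ?thesis using GDERIV_unique by blast
qed

lemma gradq_scale:
  assumes "u \<in> fe_space p c l" "k \<in> active c l"
  shows "gradq l k (r *\<^sub>R u) x = r *\<^sub>R gradq l k u x"
proof -
  have "GDERIV (\<lambda>x. r) x :> 0" by (rule GDERIV_const)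
  then have "GDERIV (\<lambda>x. r * cell_poly p c l k u x) x :> r *\<^sub>R gradq l k u x + cell_poly p c l k u x *\<^sub>R 0"
    by (rule GDERIV_mult) (rule gradq[OF assms])
  then have "GDERIV (cell_poly p c l k (r *\<^sub>R u)) x :> r *\<^sub>R gradq l k u x"
    by (subst cell_poly_scale[OF assms], subst scaleR_fun_def) simp
  moreover have "GDERIV (cell_poly p c l k (r *\<^sub>R u)) x :> gradq l k (r *\<^sub>R u) x"
    by (intro gradq subspace_scale[OF subspace_fe] assms)
  ultimately show ?thesis using GDERIV_unique by blast
qed

text \<open>The segment from a boundary point in the direction of the inward normal starts in a single cell, and in the domain,
  so that the cell is active. The normal derivative is therefore that of the polynomial on this cell, which is the same for
  all finite element functions; this makes \<open>dn\<close> linear. The limit of difference quotients makes it measurable.\<close>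

lemma dn_cell:
  assumes x: "x \<in> Gam c"
  obtains k where "k \<in> active c l" "x \<in> cell c l k"
    "\<And>u. u \<in> fe_space p c l \<Longrightarrow> dn c u x = nv x \<bullet> gradq l k u x"
    "\<And>u. u \<in> fe_space p c l \<Longrightarrow> (\<lambda>m. (u x - u (x - (1 / real (Suc m)) *\<^sub>R nv x)) * real (Suc m)) \<longlonglongrightarrow> dn c u x"
proof -
  obtain k d1 where k: "d1 > 0" "\<forall>t. 0 \<le> t \<longrightarrow> t \<le> d1 \<longrightarrow> x + t *\<^sub>R (- nv x) \<in> cell c l k"
    using segment_in_cell by blast
  obtain d2 where d2: "d2 > 0" "\<forall>t. 0 < t \<longrightarrow> t < d2 \<longrightarrow> x - t *\<^sub>R nv x \<in> Omega c"
    using inward_segment[OF C2] x by (auto simp: Gam_def)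
  have xk: "x \<in> cell c l k" using k(2)[rule_format, of 0] k(1) by simp
  define s where "s = min d1 d2 / 2"
  have "0 < s" "s < d2" "s \<le> d1" using k d2 by (auto simp: s_def)
  then have "x - s *\<^sub>R nv x \<in> cell c l k \<inter> Omega c" using k(2)[rule_format, of s] d2(2) by simp
  then have ka: "k \<in> active c l" by (auto simp: active_def)
  have D: "((\<lambda>t. u (x + t *\<^sub>R nv x)) has_real_derivative nv x \<bullet> gradq l k u x) (at 0 within {..0})"
    if u: "u \<in> fe_space p c l" for u
  proof -
    have "((\<lambda>t. cell_poly p c l k u (x + t *\<^sub>R nv x)) has_real_derivative nv x \<bullet> gradq l k u x) (at 0 within {..0})"
      by (rule has_field_derivative_at_within[OF GDERIV_line[OF gradq(2)[OF u ka]]])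
    then show ?thesis
    proof (rule has_field_derivative_transform_within)
      show "0 < d1" by (rule k)
      show "cell_poly p c l k u (x + t *\<^sub>R nv x) = u (x + t *\<^sub>R nv x)" if "t \<in> {..0}" "dist t 0 < d1" for t
        using k(2)[rule_format, of "- t"] that by (intro cell_poly(2)[OF u ka]) (auto simp: dist_norm)
    qed simp
  qed
  have dn: "dn c u x = nv x \<bullet> gradq l k u x" if u: "u \<in> fe_space p c l" for u
    unfolding dn_def
  proof (rule vector_derivative_within)
    have "(0::real) islimpt {..0}"
    proof -
      have "(0::real) islimpt {-1..0}" by (simp add: islimpt_Icc)
      then show ?thesis by (rule islimpt_subset) auto
    qed
    then show "at (0::real) within {..0} \<noteq> bot" by (simp add: trivial_limit_within)
    show "((\<lambda>t. u (x + t *\<^sub>R nv x)) has_vector_derivative nv x \<bullet> gradq l k u x) (at 0 within {..0})"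
      using D[OF u] by (simp add: has_real_derivative_iff_has_vector_derivative)
  qed
  have lim: "(\<lambda>m. (u x - u (x - (1 / real (Suc m)) *\<^sub>R nv x)) * real (Suc m)) \<longlonglongrightarrow> dn c u x"
    if u: "u \<in> fe_space p c l" for u
  proof -
    have L: "((\<lambda>t. (u (x + t *\<^sub>R nv x) - u (x + 0 *\<^sub>R nv x)) / (t - 0)) \<longlongrightarrow> dn c u x) (at 0 within {..0})"
      using D[OF u] dn[OF u] by (simp add: has_field_derivative_iff)
    have "filterlim (\<lambda>m. - (1 / real (Suc m))) (at 0 within {..0}) sequentially"
      unfolding filterlim_at
    proof
      show "(\<lambda>m. - (1 / real (Suc m))) \<longlonglongrightarrow> 0"
        using tendsto_minus[OF LIMSEQ_inverse_real_of_nat] by (simp add: inverse_eq_divide)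
      show "\<forall>\<^sub>F m in sequentially. - (1 / real (Suc m)) \<in> {..0} \<and> - (1 / real (Suc m)) \<noteq> 0" by simp
    qed
    from filterlim_compose[OF L this] show ?thesis
      by (rule Lim_transform_eventually) (auto simp: field_simps intro!: always_eventually)
  qed
  show ?thesis using that[OF ka xk dn lim] .
qed

lemma dn_limit:
  assumes "x \<in> Gam c" "u \<in> fe_space p c l"
  shows "(\<lambda>m. (u x - u (x - (1 / real (Suc m)) *\<^sub>R nv x)) * real (Suc m)) \<longlonglongrightarrow> dn c u x"
  by (rule dn_cell[OF assms(1), of l]) (use assms(2) in blast)

lemma dn_add:
  assumes "x \<in> Gam c" "u \<in> fe_space p c l" "v \<in> fe_space p c l"
  shows "dn c (u + v) x = dn c u x + dn c v x"
proof -
  obtain k where k: "k \<in> active c l" "\<And>u. u \<in> fe_space p c l \<Longrightarrow> dn c u x = nv x \<bullet> gradq l k u x"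
    using dn_cell[OF assms(1)] by metis
  show ?thesis
    using k assms subspace_add[OF subspace_fe] by (simp add: gradq_add inner_add_right)
qed

lemma dn_scale:
  assumes "x \<in> Gam c" "u \<in> fe_space p c l"
  shows "dn c (r *\<^sub>R u) x = r * dn c u x"
proof -
  obtain k where k: "k \<in> active c l" "\<And>u. u \<in> fe_space p c l \<Longrightarrow> dn c u x = nv x \<bullet> gradq l k u x"
    using dn_cell[OF assms(1)] by metis
  show ?thesis
    using k assms subspace_scale[OF subspace_fe] by (simp add: gradq_scale)
qed

text \<open>Products of two such functions are integrable on the boundary, because its surface measure is finite.\<close>

definition trace_ok :: "(real^'n \<Rightarrow> real) \<Rightarrow> bool" where
  "trace_ok f \<longleftrightarrow> (\<lambda>x. indicator (Gam c) x * f x) \<in> borel_measurable borel \<and> (\<exists>B. \<forall>x\<in>Gam c. \<bar>f x\<bar> \<le> B)"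

lemma fe_borel:
  assumes u: "u \<in> fe_space p c l"
  shows "u \<in> borel_measurable borel"
proof -
  have "(\<lambda>x. indicator (active_region c l) x *\<^sub>R u x) \<in> borel_measurable borel"
    by (rule borel_measurable_continuous_on_indicator)
       (use u closed_active_region in \<open>auto simp: fe_space_def borel_closed\<close>)
  moreover have "(\<lambda>x. indicator (active_region c l) x *\<^sub>R u x) = u"
    by (rule ext) (use u in \<open>auto simp: fe_space_def indicator_def\<close>)
  ultimately show ?thesis by simp
qed

lemma trace_ok_fe:
  assumes u: "u \<in> fe_space p c l"
  shows "trace_ok u"
proof -
  have "compact (u ` active_region c l)"
    by (rule compact_continuous_image) (use u compact_active_region in \<open>auto simp: fe_space_def\<close>)
  then obtain B where B: "\<forall>x\<in>active_region c l. \<bar>u x\<bar> \<le> B"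
    by (auto simp: bounded_iff dest!: compact_imp_bounded)
  have [measurable]: "u \<in> borel_measurable borel" by (rule fe_borel[OF u])
  show ?thesis unfolding trace_ok_def
  proof
    show "(\<lambda>x. indicator (Gam c) x * u x) \<in> borel_measurable borel" by measurable
    show "\<exists>B. \<forall>x\<in>Gam c. \<bar>u x\<bar> \<le> B" using B Gam_sub_active[of l] by blast
  qed
qed

lemma norm_nv: "x \<in> Gam c \<Longrightarrow> norm (nv x) = 1"
proof -
  assume x: "x \<in> Gam c"
  then obtain U \<psi> G where "x \<in> U" "C2_defining_function (Omega c) U \<psi> G"
    using C2 unfolding C2_boundary_def Gam_def by blast
  then show ?thesis
    using outward_normal_eq[of "Omega c" U \<psi> G x] x
    by (auto simp: Gam_def C2_defining_function_def norm_sgn)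
qed

lemma trace_ok_dn:
  assumes u: "u \<in> fe_space p c l"
  shows "trace_ok (dn c u)"
proof -
  have "\<exists>B. \<forall>x\<in>cell c l k. norm (gradq l k u x) \<le> B" if k: "k \<in> active c l" for k
  proof -
    have "compact (gradq l k u ` cell c l k)"
      by (rule compact_continuous_image[OF gradq(1)[OF u k] compact_cell])
    then show ?thesis by (auto simp: bounded_iff dest!: compact_imp_bounded)
  qed
  then obtain B where B: "\<And>k x. \<lbrakk>k \<in> active c l; x \<in> cell c l k\<rbrakk> \<Longrightarrow> norm (gradq l k u x) \<le> B k" by metis
  define M where "M = (\<Sum>k\<in>active c l. \<bar>B k\<bar>)"
  have BM: "B k \<le> M" if "k \<in> active c l" for k
    using member_le_sum[of k "active c l" "\<lambda>k. \<bar>B k\<bar>"] that by (auto simp: M_def)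
  have bd: "\<bar>dn c u x\<bar> \<le> M" if x: "x \<in> Gam c" for x
  proof -
    obtain k where k: "k \<in> active c l" "x \<in> cell c l k" "dn c u x = nv x \<bullet> gradq l k u x"
      using dn_cell[OF x] u by metis
    have "\<bar>dn c u x\<bar> \<le> norm (nv x) * norm (gradq l k u x)" unfolding k by (rule Cauchy_Schwarz_ineq2)
    also have "\<dots> \<le> M" using norm_nv[OF x] B[OF k(1,2)] BM[OF k(1)] by simp
    finally show ?thesis .
  qed
  have [measurable]: "u \<in> borel_measurable borel" by (rule fe_borel[OF u])
  define \<nu> where "\<nu> x = indicator (Gam c) x *\<^sub>R nv x" for x
  have [measurable]: "\<nu> \<in> borel_measurable borel"
    unfolding \<nu>_def using continuous_outward_normal[OF C2]
    by (intro borel_measurable_continuous_on_indicator) (auto simp: Gam_def borel_closed)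
  have "(\<lambda>x. indicator (Gam c) x * dn c u x) \<in> borel_measurable borel"
  proof (rule borel_measurable_LIMSEQ_real)
    fix x
    show "(\<lambda>m. indicator (Gam c) x * ((u x - u (x - (1 / real (Suc m)) *\<^sub>R \<nu> x)) * real (Suc m)))
        \<longlonglongrightarrow> indicator (Gam c) x * dn c u x"
    proof (cases "x \<in> Gam c")
      case True
      then have "(\<lambda>m. (u x - u (x - (1 / real (Suc m)) *\<^sub>R nv x)) * real (Suc m)) \<longlonglongrightarrow> dn c u x"
        using u by (rule dn_limit)
      then show ?thesis using True by (simp add: \<nu>_def)
    qed simp
  qed measurable
  then show ?thesis using bd by (auto simp: trace_ok_def)
qed

lemma trace_integrable:
  assumes f: "trace_ok f" and g: "trace_ok g"
  shows "set_integrable surface_measure (Gam c) (\<lambda>x. f x * g x)"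
proof -
  obtain B1 B2 where B: "\<And>x. x \<in> Gam c \<Longrightarrow> \<bar>f x\<bar> \<le> B1" "\<And>x. x \<in> Gam c \<Longrightarrow> \<bar>g x\<bar> \<le> B2"
    using f g unfolding trace_ok_def by blast
  have [measurable]: "(\<lambda>x. indicator (Gam c) x * f x) \<in> borel_measurable borel"
    "(\<lambda>x. indicator (Gam c) x * g x) \<in> borel_measurable borel"
    using f g by (auto simp: trace_ok_def)
  have "(\<lambda>x. indicator (Gam c) x *\<^sub>R (f x * g x))
      = (\<lambda>x. (indicator (Gam c) x * f x) * (indicator (Gam c) x * g x))"
    by (auto simp: indicator_def)
  then have "(\<lambda>x. indicator (Gam c) x *\<^sub>R (f x * g x)) \<in> borel_measurable borel"
    by simp
  then have m: "(\<lambda>x. indicator (Gam c) x *\<^sub>R (f x * g x)) \<in> borel_measurable surface_measure"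
    by (subst measurable_cong_sets[OF sets_surface_measure refl])
  have "integrable surface_measure (\<lambda>x. indicator (Gam c) x *\<^sub>R (f x * g x))"
  proof (rule integrableI_bounded_set[where A = "Gam c" and B = "B1 * B2"])
    show "AE x in surface_measure. x \<in> Gam c \<longrightarrow> norm (indicator (Gam c) x *\<^sub>R (f x * g x)) \<le> B1 * B2"
    proof (intro AE_I2 impI)
      fix x assume x: "x \<in> Gam c"
      have "\<bar>f x\<bar> * \<bar>g x\<bar> \<le> B1 * B2" using B[OF x] by (intro mult_mono) auto
      then show "norm (indicator (Gam c) x *\<^sub>R (f x * g x)) \<le> B1 * B2" using x by (simp add: abs_mult)
    qed
  qed (use m Gam_finite in \<open>auto simp: Gam_borel\<close>)
  then show ?thesis by (simp add: set_integrable_def)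
qed

lemma inner_Gam_add_left:
  assumes "trace_ok f" "trace_ok g" "trace_ok w" "\<And>x. x \<in> Gam c \<Longrightarrow> h x = f x + g x"
  shows "inner_Gam c h w = inner_Gam c f w + inner_Gam c g w"
proof -
  have "inner_Gam c h w = (LINT x:Gam c|surface_measure. f x * w x + g x * w x)"
    unfolding inner_Gam_def
    by (rule set_lebesgue_integral_cong) (use assms in \<open>auto simp: algebra_simps\<close>)
  also have "\<dots> = inner_Gam c f w + inner_Gam c g w"
    unfolding inner_Gam_def by (intro set_integral_add(2) trace_integrable assms)
  finally show ?thesis .
qed

lemma inner_Gam_scale_left:
  assumes "\<And>x. x \<in> Gam c \<Longrightarrow> h x = r * f x"
  shows "inner_Gam c h w = r * inner_Gam c f w"
proof -
  have "inner_Gam c h w = (LINT x:Gam c|surface_measure. r * (f x * w x))"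
    unfolding inner_Gam_def
    by (rule set_lebesgue_integral_cong) (use assms in \<open>auto simp: algebra_simps\<close>)
  then show ?thesis unfolding inner_Gam_def by simp
qed

lemma inner_Gam_commute: "inner_Gam c f g = inner_Gam c g f"
  by (simp add: inner_Gam_def mult.commute)

lemma inner_Gam_nonneg: "0 \<le> inner_Gam c f f"
  unfolding inner_Gam_def set_lebesgue_integral_def
  by (rule integral_nonneg_AE) (auto simp: indicator_def)

lemma inner_Gam_zero: "(\<And>x. x \<in> Gam c \<Longrightarrow> f x * g x = 0) \<Longrightarrow> inner_Gam c f g = 0"
  unfolding inner_Gam_def by (subst set_lebesgue_integral_cong[of _ _ _ "\<lambda>_. 0"]) auto

end

section \<open>Bilinearity of the energy form\<close>

definition partial :: "'n::finite \<Rightarrow> (real^'n \<Rightarrow> real) \<Rightarrow> real^'n \<Rightarrow> real" where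
  "partial i q x = deriv (\<lambda>t. q (x + t *\<^sub>R axis i 1)) 0"

lemma partial_Qpoly:
  fixes q :: "real^'n \<Rightarrow> real"
  assumes "q \<in> Qpoly p"
  shows "partial i q \<in> Qpoly p"
    "((\<lambda>t. q (x + t *\<^sub>R axis i 1)) has_real_derivative partial i q (x + t *\<^sub>R axis i 1)) (at t)"
proof -
  obtain q' where q': "q' \<in> Qpoly p"
    "\<And>x t. ((\<lambda>t. q (x + t *\<^sub>R axis i 1)) has_real_derivative q' (x + t *\<^sub>R axis i 1)) (at t)"
    using Qpoly_partial[OF assms] by metis
  have "partial i q = q'"
  proof
    fix x
    show "partial i q x = q' x" using DERIV_imp_deriv[OF q'(2)[of x 0]] by (simp add: partial_def)
  qed
  then show "partial i q \<in> Qpoly p"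
    "((\<lambda>t. q (x + t *\<^sub>R axis i 1)) has_real_derivative partial i q (x + t *\<^sub>R axis i 1)) (at t)"
    using q' by simp_all
qed

lemma partial_add:
  fixes q r :: "real^'n \<Rightarrow> real"
  assumes "q \<in> Qpoly p" "r \<in> Qpoly p"
  shows "partial i (q + r) = partial i q + partial i r"
proof
  fix x
  have "((\<lambda>t. q (x + t *\<^sub>R axis i 1) + r (x + t *\<^sub>R axis i 1)) has_real_derivative partial i q x + partial i r x) (at 0)"
    using partial_Qpoly(2)[OF assms(1), of x i 0] partial_Qpoly(2)[OF assms(2), of x i 0]
    by (intro DERIV_add) simp_all
  then show "partial i (q + r) x = (partial i q + partial i r) x"
    using DERIV_imp_deriv by (fastforce simp: partial_def[of i "q + r"])
qed

lemma partial_scale: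
  fixes q :: "real^'n \<Rightarrow> real"
  assumes "q \<in> Qpoly p"
  shows "partial i (c *\<^sub>R q) = c *\<^sub>R partial i q"
proof
  fix x
  have "((\<lambda>t. c * q (x + t *\<^sub>R axis i 1)) has_real_derivative c * partial i q x) (at 0)"
    using partial_Qpoly(2)[OF assms(1), of x i 0] by (intro DERIV_cmult) simp_all
  then show "partial i (c *\<^sub>R q) x = (c *\<^sub>R partial i q) x"
    using DERIV_imp_deriv by (fastforce simp: partial_def[of i "c *\<^sub>R q"])
qed

lemma partial_power_Qpoly: "q \<in> Qpoly p \<Longrightarrow> (partial i ^^ m) q \<in> Qpoly p"
  by (induction m) (auto intro: partial_Qpoly)

lemma partial_power_add:
  "\<lbrakk>q \<in> Qpoly p; r \<in> Qpoly p\<rbrakk> \<Longrightarrow> (partial i ^^ m) (q + r) = (partial i ^^ m) q + (partial i ^^ m) r"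
  by (induction m) (auto simp: partial_add[OF partial_power_Qpoly partial_power_Qpoly])

lemma partial_power_scale:
  "q \<in> Qpoly p \<Longrightarrow> (partial i ^^ m) (c *\<^sub>R q) = c *\<^sub>R (partial i ^^ m) q"
  by (induction m) (auto simp: partial_scale[OF partial_power_Qpoly])

lemma higher_deriv_partial:
  assumes "q \<in> Qpoly p"
  shows "(deriv ^^ m) (\<lambda>t. q (x + t *\<^sub>R axis i 1)) = (\<lambda>t. (partial i ^^ m) q (x + t *\<^sub>R axis i 1))"
proof (induction m)
  case (Suc m)
  show ?case
    using DERIV_imp_deriv[OF partial_Qpoly(2)[OF partial_power_Qpoly[OF assms]]]
    by (auto simp: Suc fun_eq_iff)
qed simp

context fe_domain
begin

lemma grad_interior:
  assumes u: "u \<in> fe_space p c l" and k: "k \<in> active c l" and x: "x \<in> interior (cell c l k)"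
  shows "grad u x = gradq l k u x"
proof -
  have "GDERIV u x :> gradq l k u x"
    unfolding gderiv_def
  proof (rule has_derivative_transform_within_open[OF _ open_interior x])
    show "(cell_poly p c l k u has_derivative (\<lambda>h. h \<bullet> gradq l k u x)) (at x)"
      using gradq(2)[OF u k] by (simp add: gderiv_def)
    show "cell_poly p c l k u y = u y" if "y \<in> interior (cell c l k)" for y
      using that interior_subset by (intro cell_poly(2)[OF u k]) blast
  qed
  then show ?thesis unfolding grad_def using GDERIV_unique by blast
qed

text \<open>Off this null set a finite element function coincides near each point of the active region with one polynomial.\<close>

definition skeleton :: "nat \<Rightarrow> (real^'n) set" where
  "skeleton l = (\<Union>k\<in>active c l. cell c l k - interior (cell c l k))"

lemma negligible_cell_boundary: "negligible (cell c l k - interior (cell c l k))"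
  unfolding cell_def interior_cbox by (rule negligible_frontier_interval)

lemma negligible_skeleton: "negligible (skeleton l)"
  unfolding skeleton_def by (rule negligible_Union) (auto simp: negligible_cell_boundary)

lemma off_skeleton:
  assumes "x \<in> active_region c l" "x \<notin> skeleton l"
  obtains k where "k \<in> active c l" "x \<in> interior (cell c l k)"
  using assms by (auto simp: skeleton_def active_region_def)

lemma cell_lebesgue [simp]: "cell c l k \<in> sets lebesgue"
  using lmeasurable_cbox by (simp add: cell_def fmeasurableD)

lemma grad_integrable:
  assumes u: "u \<in> fe_space p c l" and v: "v \<in> fe_space p c l"
    and S: "S \<in> sets lebesgue" "S \<subseteq> active_region c l"
  shows "(\<lambda>x. grad u x \<bullet> grad v x) absolutely_integrable_on S"
proof -
  have cellwise: "(\<lambda>x. grad u x \<bullet> grad v x) absolutely_integrable_on (S \<inter> cell c l k)"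
    if k: "k \<in> active c l" for k
  proof -
    have "(\<lambda>x. gradq l k u x \<bullet> gradq l k v x) absolutely_integrable_on cell c l k"
      unfolding cell_def
      by (intro absolutely_integrable_continuous continuous_on_inner gradq(1) u v k)
    then have "(\<lambda>x. gradq l k u x \<bullet> gradq l k v x) absolutely_integrable_on (S \<inter> cell c l k)"
      by (rule set_integrable_subset) (use S in auto)
    then show ?thesis
      by (rule absolutely_integrable_spike[OF _ negligible_cell_boundary[of l k]])
         (use grad_interior[OF u k] grad_interior[OF v k] in auto)
  qed
  have "(\<lambda>x. grad u x \<bullet> grad v x) absolutely_integrable_on (\<Union>k\<in>K. S \<inter> cell c l k)"
    if "finite K" "K \<subseteq> active c l" for K
    using that
  proof (induction K rule: finite_induct)
    case empty
    then show ?case by (simp add: set_integrable_def)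
  next
    case (insert k K)
    have "(\<Union>k\<in>K. S \<inter> cell c l k) \<in> sets lebesgue"
      using insert(1) S by (intro sets.finite_UN sets.Int) auto
    then show ?case
      using insert S cellwise[of k] by (auto intro!: set_integrable_Un)
  qed
  from this[OF finite_active, of l] have
    "(\<lambda>x. grad u x \<bullet> grad v x) absolutely_integrable_on (\<Union>k\<in>active c l. S \<inter> cell c l k)" by simp
  moreover have "(\<Union>k\<in>active c l. S \<inter> cell c l k) = S" using S(2) by (auto simp: active_region_def)
  ultimately show ?thesis by simp
qed

lemma Omega_lebesgue [simp]: "Omega c \<in> sets lebesgue"
  using open_Omega by (simp add: borel_open)

lemmas grad_integrable_Omega = grad_integrable[OF _ _ Omega_lebesgue Omega_sub_active]

lemma inner_Omega_integral:
  assumes u: "u \<in> fe_space p c l" and v: "v \<in> fe_space p c l"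
  shows "inner_Omega c (grad u) (grad v) = integral (Omega c) (\<lambda>x. grad u x \<bullet> grad v x)"
  unfolding inner_Omega_def
  by (rule set_lebesgue_integral_eq_integral(2)[OF grad_integrable_Omega[OF u v]])

lemma inner_Omega_add_left:
  assumes u: "u \<in> fe_space p c l" and v: "v \<in> fe_space p c l" and w: "w \<in> fe_space p c l"
  shows "inner_Omega c (grad (u + v)) (grad w)
    = inner_Omega c (grad u) (grad w) + inner_Omega c (grad v) (grad w)"
proof -
  have uv: "u + v \<in> fe_space p c l" using u v by (rule subspace_add[OF subspace_fe])
  have "integral (Omega c) (\<lambda>x. grad (u + v) x \<bullet> grad w x)
      = integral (Omega c) (\<lambda>x. grad u x \<bullet> grad w x + grad v x \<bullet> grad w x)"
  proof (rule integral_spike[OF negligible_skeleton[of l]])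
    fix x assume "x \<in> Omega c - skeleton l"
    then obtain k where k: "k \<in> active c l" "x \<in> interior (cell c l k)"
      using off_skeleton Omega_sub_active by blast
    show "grad u x \<bullet> grad w x + grad v x \<bullet> grad w x = grad (u + v) x \<bullet> grad w x"
      using k by (simp add: grad_interior[OF _ k] u v w uv gradq_add inner_add_left)
  qed
  also have "\<dots> = integral (Omega c) (\<lambda>x. grad u x \<bullet> grad w x) + integral (Omega c) (\<lambda>x. grad v x \<bullet> grad w x)"
    by (intro Henstock_Kurzweil_Integration.integral_add
          set_lebesgue_integral_eq_integral(1)[OF grad_integrable_Omega[OF u w]]
          set_lebesgue_integral_eq_integral(1)[OF grad_integrable_Omega[OF v w]])
  finally show ?thesis by (simp add: inner_Omega_integral[OF uv w] inner_Omega_integral[OF u w] inner_Omega_integral[OF v w])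
qed

lemma inner_Omega_scale_left:
  assumes u: "u \<in> fe_space p c l" and w: "w \<in> fe_space p c l"
  shows "inner_Omega c (grad (r *\<^sub>R u)) (grad w) = r * inner_Omega c (grad u) (grad w)"
proof -
  have ru: "r *\<^sub>R u \<in> fe_space p c l" using u by (rule subspace_scale[OF subspace_fe])
  have "integral (Omega c) (\<lambda>x. grad (r *\<^sub>R u) x \<bullet> grad w x)
      = integral (Omega c) (\<lambda>x. r * (grad u x \<bullet> grad w x))"
  proof (rule integral_spike[OF negligible_skeleton[of l]])
    fix x assume "x \<in> Omega c - skeleton l"
    then obtain k where k: "k \<in> active c l" "x \<in> interior (cell c l k)"
      using off_skeleton Omega_sub_active by blast
    show "r * (grad u x \<bullet> grad w x) = grad (r *\<^sub>R u) x \<bullet> grad w x"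
      using k by (simp add: grad_interior[OF _ k] u w ru gradq_scale)
  qed
  also have "\<dots> = r * integral (Omega c) (\<lambda>x. grad u x \<bullet> grad w x)" by simp
  finally show ?thesis by (simp add: inner_Omega_integral[OF ru w] inner_Omega_integral[OF u w])
qed

lemma inner_Omega_commute: "inner_Omega c F G = inner_Omega c G F"
  by (simp add: inner_Omega_def inner_commute)

lemma inner_Omega_nonneg: "0 \<le> inner_Omega c F F"
  unfolding inner_Omega_def set_lebesgue_integral_def
  by (rule integral_nonneg_AE) (auto simp: indicator_def)

lemma inner_Omega_zero:
  assumes u: "u \<in> fe_space p c l" and v: "v \<in> fe_space p c l"
    and z: "\<And>k x. \<lbrakk>k \<in> active c l; x \<in> interior (cell c l k)\<rbrakk> \<Longrightarrow> grad u x \<bullet> grad v x = 0"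
  shows "inner_Omega c (grad u) (grad v) = 0"
proof -
  have "integral (Omega c) (\<lambda>x. grad u x \<bullet> grad v x) = integral (Omega c) (\<lambda>x. 0)"
  proof (rule integral_spike[OF negligible_skeleton[of l]])
    fix x assume "x \<in> Omega c - skeleton l"
    then obtain k where k: "k \<in> active c l" "x \<in> interior (cell c l k)"
      using off_skeleton Omega_sub_active by blast
    then show "0 = grad u x \<bullet> grad v x" using z by simp
  qed
  then show ?thesis by (simp add: inner_Omega_integral[OF u v])
qed

lemma face_coordinate:
  assumes "x \<in> face c l k i"
  shows "x $ i = origin c $ i + edge c l * (k $ i + 1)"
proof -
  have "x \<in> cell c l k" "x \<in> cell c l (k + axis i 1)" using assms by (auto simp: face_def)
  then have "x $ i \<in> iv l i (k $ i)" "x $ i \<in> iv l i ((k + axis i 1) $ i)"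
    unfolding mem_cell by blast+
  moreover have "(k + axis i 1) $ i = k $ i + 1" by (simp add: axis_def)
  ultimately show ?thesis using iv_overlap(2)[of "x $ i" l i "k $ i" "k $ i + 1"] by simp
qed

lemma closed_face [simp]: "closed (face c l k i)" and bounded_face [simp]: "bounded (face c l k i)"
  by (auto simp: face_def intro: bounded_subset[OF bounded_cell])

lemma compact_face [simp]: "compact (face c l k i)"
  by (simp add: compact_eq_bounded_closed)

lemma face_finite: "emeasure surface_measure (face c l k i) < \<infinity>"
proof -
  have "hausdorff_outer (real CARD('n) - 1) (face c l k i) < \<infinity>"
    by (rule lipschitz_graph_finite_measure[of _ 0 i]) (simp_all add: face_coordinate)
  then show ?thesis by (simp add: emeasure_surface_measure borel_closed)
qed

lemma jump_dn_eq:
  assumes u: "u \<in> fe_space p c l" and ki: "(k, i) \<in> ghost_faces c l"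
  shows "jump_dn p c l k i m u x
    = (partial i ^^ m) (cell_poly p c l (k + axis i 1) u) x - (partial i ^^ m) (cell_poly p c l k u) x"
  unfolding jump_dn_def
  using ki by (simp add: ghost_faces_def higher_deriv_partial[OF cell_poly(1)[OF u]])

lemma jump_continuous:
  assumes u: "u \<in> fe_space p c l" and ki: "(k, i) \<in> ghost_faces c l"
  shows "continuous_on S (jump_dn p c l k i m u)"
proof -
  have eq: "jump_dn p c l k i m u = (\<lambda>x. (partial i ^^ m) (cell_poly p c l (k + axis i 1) u) x
      - (partial i ^^ m) (cell_poly p c l k u) x)"
    by (rule ext) (rule jump_dn_eq[OF u ki])
  show ?thesis unfolding eq
    using ki by (intro continuous_on_diff Qpoly_continuous[OF partial_power_Qpoly[OF cell_poly(1)[OF u]]])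
      (auto simp: ghost_faces_def)
qed

lemma jump_add:
  assumes "u \<in> fe_space p c l" "v \<in> fe_space p c l" "(k, i) \<in> ghost_faces c l"
  shows "jump_dn p c l k i m (u + v) x = jump_dn p c l k i m u x + jump_dn p c l k i m v x"
  using assms subspace_add[OF subspace_fe assms(1,2)]
  by (simp add: jump_dn_eq) (simp add: ghost_faces_def cell_poly_add partial_power_add[OF cell_poly(1) cell_poly(1)])

lemma jump_scale:
  assumes "u \<in> fe_space p c l" "(k, i) \<in> ghost_faces c l"
  shows "jump_dn p c l k i m (r *\<^sub>R u) x = r * jump_dn p c l k i m u x"
  using assms subspace_scale[OF subspace_fe assms(1)]
  by (simp add: jump_dn_eq)
     (simp add: ghost_faces_def cell_poly_scale partial_power_scale[OF cell_poly(1)] algebra_simps)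

definition face_form where
  "face_form l k i m u v =
     (LINT x:face c l k i|surface_measure. jump_dn p c l k i m u x * jump_dn p c l k i m v x)"

lemma face_integrable:
  assumes "u \<in> fe_space p c l" "v \<in> fe_space p c l" "(k, i) \<in> ghost_faces c l"
  shows "set_integrable surface_measure (face c l k i) (\<lambda>x. jump_dn p c l k i m u x * jump_dn p c l k i m v x)"
proof -
  let ?f = "\<lambda>x. jump_dn p c l k i m u x * jump_dn p c l k i m v x"
  have cont: "continuous_on (face c l k i) ?f"
    by (intro continuous_on_mult jump_continuous assms)
  then have "compact (?f ` face c l k i)" by (rule compact_continuous_image) simp
  then obtain B where B: "\<forall>x\<in>face c l k i. \<bar>?f x\<bar> \<le> B"
    by (auto simp: bounded_iff dest!: compact_imp_bounded)
  have "(\<lambda>x. indicator (face c l k i) x *\<^sub>R ?f x) \<in> borel_measurable borel"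
    by (rule borel_measurable_continuous_on_indicator[OF _ cont]) (simp add: borel_closed)
  then have m: "(\<lambda>x. indicator (face c l k i) x *\<^sub>R ?f x) \<in> borel_measurable surface_measure"
    by (subst measurable_cong_sets[OF sets_surface_measure refl])
  have "integrable surface_measure (\<lambda>x. indicator (face c l k i) x *\<^sub>R ?f x)"
    by (rule integrableI_bounded_set[where A = "face c l k i" and B = B])
       (use m face_finite B in \<open>auto simp: borel_closed\<close>)
  then show ?thesis by (simp add: set_integrable_def)
qed

lemma face_form_add_left:
  assumes "u \<in> fe_space p c l" "v \<in> fe_space p c l" "w \<in> fe_space p c l" "(k, i) \<in> ghost_faces c l"
  shows "face_form l k i m (u + v) w = face_form l k i m u w + face_form l k i m v w"
proof -
  have "face_form l k i m (u + v) w
      = (LINT x:face c l k i|surface_measure. jump_dn p c l k i m u x * jump_dn p c l k i m w x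
          + jump_dn p c l k i m v x * jump_dn p c l k i m w x)"
    unfolding face_form_def by (simp only: jump_add[OF assms(1,2,4)] distrib_right)
  then show ?thesis
    unfolding face_form_def using assms by (simp add: set_integral_add(2) face_integrable)
qed

lemma face_form_scale_left:
  assumes "u \<in> fe_space p c l" "(k, i) \<in> ghost_faces c l"
  shows "face_form l k i m (r *\<^sub>R u) w = r * face_form l k i m u w"
  unfolding face_form_def by (simp only: jump_scale[OF assms] mult.assoc set_integral_mult_right)

lemma face_form_nonneg: "0 \<le> face_form l k i m u u"
  unfolding face_form_def set_lebesgue_integral_def
  by (rule integral_nonneg_AE) (auto simp: indicator_def)

lemma finite_ghost_faces [simp]: "finite (ghost_faces c l)"
  by (rule finite_subset[of _ "active c l \<times> UNIV"]) (auto simp: ghost_faces_def)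

lemma ghost_form_eq:
  "ghost_form p \<gamma> c l u v
    = \<gamma> * (\<Sum>z\<in>ghost_faces c l. \<Sum>m=1..p. edge c l ^ (2 * m - 1) / (fact m)\<^sup>2 * face_form l (fst z) (snd z) m u v)"
  by (simp add: ghost_form_def face_form_def case_prod_beta)

lemma ghost_form_add_left:
  assumes "u \<in> fe_space p c l" "v \<in> fe_space p c l" "w \<in> fe_space p c l"
  shows "ghost_form p \<gamma> c l (u + v) w = ghost_form p \<gamma> c l u w + ghost_form p \<gamma> c l v w"
  unfolding ghost_form_eq distrib_left[symmetric] sum.distrib[symmetric]
  using face_form_add_left[OF assms]
  by (intro arg_cong[where f = "(*) \<gamma>"] sum.cong refl) (simp add: distrib_left)

lemma ghost_form_scale_left:
  assumes "u \<in> fe_space p c l"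
  shows "ghost_form p \<gamma> c l (r *\<^sub>R u) w = r * ghost_form p \<gamma> c l u w"
  unfolding ghost_form_eq mult.left_commute[of r \<gamma>] sum_distrib_left[of r]
  using face_form_scale_left[OF assms]
  by (intro arg_cong[where f = "(*) \<gamma>"] sum.cong refl) (simp add: sum_distrib_left)

lemma ghost_form_commute: "ghost_form p \<gamma> c l u v = ghost_form p \<gamma> c l v u"
  by (simp add: ghost_form_def mult.commute)

lemma ghost_form_nonneg: "0 \<le> \<gamma> \<Longrightarrow> 0 \<le> ghost_form p \<gamma> c l u u"
  unfolding ghost_form_eq
  by (intro mult_nonneg_nonneg sum_nonneg face_form_nonneg) (auto simp: less_imp_le[OF edge_pos])

lemma N_norm_sq_terms_nonneg:
  assumes "0 \<le> \<gamma>"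
  shows "0 \<le> inner_Omega c (grad v) (grad v)" "0 \<le> edge c l * inner_Gam c (dn c v) (dn c v)"
    "0 \<le> inverse (edge c l) * inner_Gam c v v" "0 \<le> ghost_form p \<gamma> c l v v"
  using assms inner_Omega_nonneg inner_Gam_nonneg ghost_form_nonneg
  by (auto intro!: mult_nonneg_nonneg simp: less_imp_le[OF edge_pos])

lemma A_form_commute: "A_form p \<gamma> \<gamma>D c l u v = A_form p \<gamma> \<gamma>D c l v u"
  using inner_Omega_commute[of "grad u" "grad v"] inner_Gam_commute[of u v]
    inner_Gam_commute[of "dn c u" v] inner_Gam_commute[of u "dn c v"] ghost_form_commute[of \<gamma> l u v]
  by (simp add: A_form_def nitsche_form_def)

lemma A_form_add_left:
  assumes u: "u \<in> fe_space p c l" and v: "v \<in> fe_space p c l" and w: "w \<in> fe_space p c l"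
  shows "A_form p \<gamma> \<gamma>D c l (u + v) w = A_form p \<gamma> \<gamma>D c l u w + A_form p \<gamma> \<gamma>D c l v w"
proof -
  have 1: "inner_Gam c (dn c (u + v)) w = inner_Gam c (dn c u) w + inner_Gam c (dn c v) w"
    by (rule inner_Gam_add_left)
       (use u v w in \<open>auto intro: trace_ok_dn trace_ok_fe simp: dn_add[OF _ u v]\<close>)
  have 2: "inner_Gam c (u + v) g = inner_Gam c u g + inner_Gam c v g" if "trace_ok g" for g
    by (rule inner_Gam_add_left) (use u v that in \<open>auto intro: trace_ok_fe\<close>)
  show ?thesis
    unfolding A_form_def nitsche_form_def
    by (simp add: 1 2 trace_ok_fe[OF w] trace_ok_dn[OF w] inner_Omega_add_left[OF u v w]
          ghost_form_add_left[OF u v w] algebra_simps)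
qed

lemma A_form_scale_left:
  assumes u: "u \<in> fe_space p c l" and w: "w \<in> fe_space p c l"
  shows "A_form p \<gamma> \<gamma>D c l (r *\<^sub>R u) w = r * A_form p \<gamma> \<gamma>D c l u w"
proof -
  have 1: "inner_Gam c (dn c (r *\<^sub>R u)) w = r * inner_Gam c (dn c u) w"
    by (rule inner_Gam_scale_left) (rule dn_scale[OF _ u])
  have 2: "inner_Gam c (r *\<^sub>R u) g = r * inner_Gam c u g" for g
    by (rule inner_Gam_scale_left) simp
  show ?thesis
    unfolding A_form_def nitsche_form_def
    by (simp add: 1 2 inner_Omega_scale_left[OF u w] ghost_form_scale_left[OF u] algebra_simps)
qed

section \<open>Definiteness of the energy form\<close>

text \<open>Every active cell meets the connected domain, which is contained in their union.\<close>

lemma connected_active_region: "connected (active_region c l)"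
proof -
  have "connected (\<Union>k\<in>active c l. Omega c \<union> cell c l k)"
  proof (rule connected_Union)
    show "connected S" if "S \<in> (\<lambda>k. Omega c \<union> cell c l k) ` active c l" for S
      using that connected_Omega convex_connected[OF convex_cell]
      by (auto simp: active_def intro!: connected_Un)
    show "\<Inter> ((\<lambda>k. Omega c \<union> cell c l k) ` active c l) \<noteq> {}"
      using Omega_ne by auto
  qed
  moreover have "(\<Union>k\<in>active c l. Omega c \<union> cell c l k) = active_region c l"
    using Omega_sub_active[of l] Omega_ne by (auto simp: active_region_def)
  ultimately show ?thesis by simp
qed

text \<open>The gradient is continuous on each cell, so it vanishes there identically and \<open>v\<close> is constant on the cell. A continuous
  function with finitely many values on a connected set is constant.\<close>

lemma constant_if_grad_zero:
  assumes v: "v \<in> fe_space p c l"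
    and 0: "(LINT x:active_region c l|lebesgue. grad v x \<bullet> grad v x) = 0"
  shows "\<exists>a. \<forall>x\<in>active_region c l. v x = a"
proof -
  have ar: "active_region c l \<in> sets lebesgue"
    using closed_active_region by (simp add: borel_closed)
  have int: "(\<lambda>x. grad v x \<bullet> grad v x) absolutely_integrable_on active_region c l"
    by (rule grad_integrable[OF v v ar]) simp
  then have I0: "integral (active_region c l) (\<lambda>x. grad v x \<bullet> grad v x) = 0"
    using 0 set_lebesgue_integral_eq_integral(2)[OF int] by simp
  have const: "\<exists>a. \<forall>x\<in>cell c l k. v x = a" if k: "k \<in> active c l" for k
  proof -
    have sub: "cell c l k \<subseteq> active_region c l" using k by (auto simp: active_region_def)
    have ik: "(\<lambda>x. grad v x \<bullet> grad v x) absolutely_integrable_on cell c l k"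
      by (rule set_integrable_subset[OF int]) (use sub in auto)
    have "integral (cell c l k) (\<lambda>x. grad v x \<bullet> grad v x) \<le> 0"
      unfolding I0[symmetric]
      by (rule integral_subset_le[OF sub set_lebesgue_integral_eq_integral(1)[OF ik]
            set_lebesgue_integral_eq_integral(1)[OF int]]) simp
    moreover have "0 \<le> integral (cell c l k) (\<lambda>x. grad v x \<bullet> grad v x)"
      by (rule Henstock_Kurzweil_Integration.integral_nonneg[OF set_lebesgue_integral_eq_integral(1)[OF ik]]) simp
    ultimately have "integral (cell c l k) (\<lambda>x. grad v x \<bullet> grad v x) = 0" by simp
    moreover have "integral (cell c l k) (\<lambda>x. grad v x \<bullet> grad v x)
        = integral (cell c l k) (\<lambda>x. gradq l k v x \<bullet> gradq l k v x)"
      by (rule integral_spike[OF negligible_cell_boundary[of l k]])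
         (use grad_interior[OF v k] in auto)
    ultimately have "integral (cell c l k) (\<lambda>x. gradq l k v x \<bullet> gradq l k v x) = 0" by simp
    then have z: "\<forall>x\<in>cell c l k. gradq l k v x \<bullet> gradq l k v x = 0"
      unfolding cell_def
    proof (subst (asm) integral_cbox_eq_0_iff)
      show "box (vertex c l k) (vertex c l (k + (\<chi> i. 1))) \<noteq> {}"
        using interior_cell_ne[of l k] by (simp add: cell_def interior_cbox)
    qed (auto intro!: continuous_on_inner gradq(1) v k)
    have "\<exists>a. \<forall>x\<in>cell c l k. cell_poly p c l k v x = a"
    proof (rule has_derivative_zero_constant[OF convex_cell])
      fix x assume x: "x \<in> cell c l k"
      have "(cell_poly p c l k v has_derivative (\<lambda>h. h \<bullet> gradq l k v x)) (at x)"
        using gradq(2)[OF v k, of x] by (simp add: gderiv_def)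
      then show "(cell_poly p c l k v has_derivative (\<lambda>h. 0)) (at x within cell c l k)"
        using z x by (simp add: has_derivative_at_withinI)
    qed
    then show ?thesis using cell_poly(2)[OF v k] by force
  qed
  then obtain a where a: "\<And>k x. \<lbrakk>k \<in> active c l; x \<in> cell c l k\<rbrakk> \<Longrightarrow> v x = a k" by metis
  have "v ` active_region c l \<subseteq> a ` active c l" using a by (auto simp: active_region_def)
  then have "finite (v ` active_region c l)" by (rule finite_subset) simp
  then have "v constant_on active_region c l"
    using v by (intro continuous_finite_range_constant connected_active_region) (auto simp: fe_space_def)
  then show ?thesis by (auto simp: constant_on_def)
qed

text \<open>If \<open>A v v = 0\<close>, all terms of the stability norm vanish. The exterior estimate of the stability assumption extends
  \<open>\<nabla>v = 0\<close> from the domain to the active region, and the boundary term forces the resulting constant to be zero since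
  the boundary has positive and finite surface measure.\<close>

lemma energy_definite:
  assumes v: "v \<in> fe_space p c l" and \<gamma>: "0 \<le> \<gamma>"
    and cA: "0 < cA" "cA * N_norm_sq p \<gamma> c l v \<le> A_form p \<gamma> \<gamma>D c l v v"
    and C: "(LINT x:(active_region c l - Omega c)|lebesgue. grad v x \<bullet> grad v x)
          \<le> C * (inner_Omega c (grad v) (grad v) + ghost_form p \<gamma> c l v v)"
  shows "0 \<le> A_form p \<gamma> \<gamma>D c l v v" "A_form p \<gamma> \<gamma>D c l v v = 0 \<Longrightarrow> v = 0"
proof -
  have nn: "0 \<le> inner_Omega c (grad v) (grad v)" "0 \<le> edge c l * inner_Gam c (dn c v) (dn c v)"
    "0 \<le> inverse (edge c l) * inner_Gam c v v" "0 \<le> ghost_form p \<gamma> c l v v"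
    by (rule N_norm_sq_terms_nonneg[OF \<gamma>])+
  have N0: "0 \<le> N_norm_sq p \<gamma> c l v" using nn unfolding N_norm_sq_def by linarith
  then show "0 \<le> A_form p \<gamma> \<gamma>D c l v v" using cA by (meson less_imp_le mult_nonneg_nonneg order_trans)
  assume "A_form p \<gamma> \<gamma>D c l v v = 0"
  then have "cA * N_norm_sq p \<gamma> c l v \<le> 0" using cA by simp
  then have "N_norm_sq p \<gamma> c l v = 0" using N0 cA(1) by (metis mult_le_0_iff not_less order_antisym)
  then have z: "inner_Omega c (grad v) (grad v) = 0" "inverse (edge c l) * inner_Gam c v v = 0"
    "ghost_form p \<gamma> c l v v = 0"
    using nn unfolding N_norm_sq_def by linarith+
  have ar: "active_region c l \<in> sets lebesgue" using closed_active_region by (simp add: borel_closed)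
  have "(LINT x:active_region c l|lebesgue. grad v x \<bullet> grad v x)
      = (LINT x:Omega c \<union> (active_region c l - Omega c)|lebesgue. grad v x \<bullet> grad v x)"
    using Omega_sub_active[of l] by (simp add: Un_absorb1)
  also have "\<dots> = (LINT x:Omega c|lebesgue. grad v x \<bullet> grad v x)
      + (LINT x:active_region c l - Omega c|lebesgue. grad v x \<bullet> grad v x)"
    by (rule set_integral_Un[OF _ grad_integrable_Omega[OF v v]
          grad_integrable[OF v v sets.Diff[OF ar Omega_lebesgue]]]) auto
  also have "(LINT x:Omega c|lebesgue. grad v x \<bullet> grad v x) = 0" using z(1) by (simp add: inner_Omega_def)
  finally have "(LINT x:active_region c l|lebesgue. grad v x \<bullet> grad v x) \<le> 0" using C z by simp
  moreover have "0 \<le> (LINT x:active_region c l|lebesgue. grad v x \<bullet> grad v x)"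
    unfolding set_lebesgue_integral_def by (rule integral_nonneg_AE) (auto simp: indicator_def)
  ultimately have "(LINT x:active_region c l|lebesgue. grad v x \<bullet> grad v x) = 0" by simp
  then obtain a where a: "\<forall>x\<in>active_region c l. v x = a" using constant_if_grad_zero[OF v] by blast
  have "inner_Gam c v v = (LINT x:Gam c|surface_measure. a * a)"
    unfolding inner_Gam_def
    by (rule set_lebesgue_integral_cong) (use a Gam_sub_active[of l] in auto)
  also have "\<dots> = measure surface_measure (Gam c) * (a * a)"
    unfolding set_lebesgue_integral_def by simp
  finally have "measure surface_measure (Gam c) * (a * a) = 0" using z(2) by simp
  moreover have "measure surface_measure (Gam c) \<noteq> 0"
    using Gam_pos Gam_finite by (auto simp: measure_def enn2real_eq_0_iff)
  ultimately have "a = 0" by simp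
  then have "v x = 0" for x using a v by (cases "x \<in> active_region c l") (auto simp: fe_space_def)
  then show "v = 0" by (simp add: fun_eq_iff)
qed

end

section \<open>Interaction of patches\<close>

definition near :: "int^'n::finite \<Rightarrow> int^'n \<Rightarrow> bool" where
  "near j k \<longleftrightarrow> (\<forall>i. \<bar>j $ i - k $ i\<bar> \<le> 2)"

lemma near_card:
  fixes J :: "(int^'n::finite) set"
  shows "card {k\<in>J. near j k} \<le> 5 ^ CARD('n)"
proof -
  define B where "B = PiE (UNIV :: 'n set) (\<lambda>i. {j $ i - 2 .. j $ i + 2})"
  have B: "finite B" unfolding B_def by (rule finite_PiE) auto
  have "card {k\<in>J. near j k} \<le> card B"
  proof (rule card_inj_on_le[where f = vec_nth])
    show "inj_on vec_nth {k\<in>J. near j k}" by (rule inj_onI) (simp add: vec_eq_iff)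
    show "vec_nth ` {k\<in>J. near j k} \<subseteq> B"
    proof clarify
      fix k assume "near j k"
      then have "k $ i \<in> {j $ i - 2 .. j $ i + 2}" for i
        unfolding near_def by (metis abs_le_iff atLeastAtMost_iff diff_le_eq le_diff_eq minus_diff_eq add.commute)
      then show "vec_nth k \<in> B" by (auto simp: B_def)
    qed
  qed (rule B)
  also have "card B = 5 ^ CARD('n)" unfolding B_def by (subst card_PiE) auto
  finally show ?thesis .
qed

context fe_domain
begin

text \<open>The indices of the cells that contain the vertex \<open>j\<close>.\<close>

definition star :: "int^'n \<Rightarrow> (int^'n) set" where
  "star j = {k. \<forall>i. k $ i \<le> j $ i \<and> j $ i \<le> k $ i + 1}"

lemma vertex_in_cell_iff: "vertex c l j \<in> cell c l k \<longleftrightarrow> k \<in> star j"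
proof -
  have "origin c $ i + edge c l * j $ i \<in> iv l i (k $ i) \<longleftrightarrow> k $ i \<le> j $ i \<and> j $ i \<le> k $ i + 1" for i
    using mult_le_cancel_left_pos[OF edge_pos[of l], of "of_int (k $ i)" "of_int (j $ i)"]
      mult_le_cancel_left_pos[OF edge_pos[of l], of "of_int (j $ i)" "of_int (k $ i + 1)"]
    unfolding iv_def by (simp del: of_int_add mult_le_cancel_left_pos)
  then show ?thesis by (simp add: mem_cell vertex_nth star_def)
qed

text \<open>A neighbourhood of \<open>y\<close> inside the patch meets the interior of every cell that contains \<open>y\<close>, and cells with overlapping
  interiors coincide.\<close>

lemma interior_patch_cells:
  assumes "y \<in> interior (background_patch c l j)" "y \<in> cell c l k"
  shows "k \<in> star j"
proof -
  have bp: "background_patch c l j = (\<Union>m\<in>star j. cell c l m)"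
    by (auto simp: background_patch_def vertex_in_cell_iff)
  have "interior (background_patch c l j) \<inter> closure (interior (cell c l k)) \<noteq> {}"
    using assms by (auto simp: cell_closure_interior)
  then have "interior (cell c l k) \<inter> interior (background_patch c l j) \<noteq> {}"
    using open_Int_closure_eq_empty[OF open_interior, of "background_patch c l j" "interior (cell c l k)"] by auto
  then show ?thesis
    by (rule cell_sub_Union_cells) (use interior_subset in \<open>auto simp: bp\<close>)
qed

lemma active_patch_cells:
  assumes "active_patch_at c l y \<subseteq> active_patch_at c l (vertex c l j)" "k \<in> active c l" "y \<in> cell c l k"
  shows "k \<in> star j"
proof -
  have "cell c l k \<subseteq> active_patch_at c l y" using assms by (auto simp: active_patch_at_def)
  also have "\<dots> \<subseteq> (\<Union>m\<in>star j. cell c l m)"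
    using assms(1) by (auto simp: active_patch_at_def vertex_in_cell_iff)
  finally have "cell c l k \<subseteq> (\<Union>m\<in>star j. cell c l m)" .
  then show ?thesis
    using interior_cell_ne[of l k] interior_subset[of "cell c l k"]
    by (intro cell_sub_Union_cells[of l k "interior (cell c l k)"]) auto
qed

definition patch_nodes :: "patch_kind \<Rightarrow> nat \<Rightarrow> int^'n \<Rightarrow> (real^'n) set" where
  "patch_nodes \<kappa> l j = (case \<kappa> of
     Classical \<Rightarrow> {x \<in> nodes p c l. x \<in> interior (background_patch c l j)}
   | Full_Residual \<Rightarrow> {x \<in> nodes p c l. active_patch_at c l x \<subseteq> active_patch_at c l (vertex c l j)})"

lemma patch_nodes_sub: "patch_nodes \<kappa> l j \<subseteq> nodes p c l"
  by (cases \<kappa>) (auto simp: patch_nodes_def)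

lemma local_space_span: "local_space \<kappa> p c l j = span (tent l ` patch_nodes \<kappa> l j)"
proof -
  have "local_space \<kappa> p c l j = nodal_span p c l (patch_nodes \<kappa> l j)"
    by (cases \<kappa>) (simp_all add: local_space_def patch_nodes_def)
  then show ?thesis using nodal_span_eq[OF patch_nodes_sub] by simp
qed

lemma finite_patch_nodes: "finite (patch_nodes \<kappa> l j)"
  using patch_nodes_sub finite_nodes by (rule finite_subset)

lemma local_space_sub: "local_space \<kappa> p c l j \<subseteq> fe_space p c l"
  unfolding local_space_span by (rule span_minimal[OF _ subspace_fe]) (auto simp: tent_in_fe)

lemma local_space_support:
  assumes u: "u \<in> local_space \<kappa> p c l j" and k: "k \<in> active c l" "k \<notin> star j" and x: "x \<in> cell c l k"
  shows "u x = 0"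
proof -
  have "span (tent l ` patch_nodes \<kappa> l j) \<subseteq> {u. u x = 0}"
  proof (rule span_minimal)
    show "subspace {u :: real^'n \<Rightarrow> real. u x = 0}" by (rule subspaceI) auto
    show "tent l ` patch_nodes \<kappa> l j \<subseteq> {u. u x = 0}"
    proof clarify
      fix y assume y: "y \<in> patch_nodes \<kappa> l j"
      show "tent l y x = 0"
      proof (rule ccontr)
        assume "tent l y x \<noteq> 0"
        then have yk: "y \<in> cell c l k" using tent_support[OF k(1) x] by blast
        have "k \<in> star j"
          using y interior_patch_cells[OF _ yk] active_patch_cells[OF _ k(1) yk]
          by (cases \<kappa>) (auto simp: patch_nodes_def)
        then show False using k by simp
      qed
    qed
  qed
  then show ?thesis using u by (auto simp: local_space_span)
qed

lemma zero_off_star: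
  assumes u: "u \<in> local_space \<kappa> p c l j" and k: "k \<in> active c l" "k \<notin> star j"
  shows "cell_poly p c l k u = 0" "gradq l k u x = 0"
proof -
  have uV: "u \<in> fe_space p c l" using u local_space_sub by auto
  show cp: "cell_poly p c l k u = 0"
    by (rule cell_poly_zero[OF uV k(1)]) (rule local_space_support[OF u k])
  have "GDERIV (cell_poly p c l k u) x :> 0" unfolding cp zero_fun_def by (rule GDERIV_const)
  then show "gradq l k u x = 0" using gradq(2)[OF uV k(1)] GDERIV_unique by blast
qed

lemma partial_power_zero: "(partial i ^^ m) (0 :: real^'n \<Rightarrow> real) = 0"
  using partial_power_scale[OF subspace_0[OF subspace_Qpoly], where i = i and m = m and c = 0] by simp

text \<open>The volume and boundary integrals see \<open>u\<close> and \<open>v\<close> on one common cell, and a ghost penalty sees them on the two cells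
  adjacent to a face. Each product vanishes unless a cell of one star equals or shares a face with a cell of the other, which puts
  the two vertices within distance \<open>2\<close> in every coordinate.\<close>

lemma locality:
  assumes u: "u \<in> local_space \<kappa> p c l j" and v: "v \<in> local_space \<kappa> p c l j'" and far: "\<not> near j j'"
  shows "A_form p \<gamma> \<gamma>D c l u v = 0"
proof -
  have uV: "u \<in> fe_space p c l" and vV: "v \<in> fe_space p c l" using u v local_space_sub by auto
  have stars: "\<not> (a \<in> star j \<and> b \<in> star j')" if "\<forall>i. \<bar>a $ i - b $ i\<bar> \<le> 1" for a b
  proof
    assume ab: "a \<in> star j \<and> b \<in> star j'"
    have "\<bar>j $ i - j' $ i\<bar> \<le> 2" for i
    proof -
      have "a $ i \<le> j $ i" "j $ i \<le> a $ i + 1" "b $ i \<le> j' $ i" "j' $ i \<le> b $ i + 1" "\<bar>a $ i - b $ i\<bar> \<le> 1"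
        using ab that by (auto simp: star_def)
      then show ?thesis by linarith
    qed
    then show False using far by (simp add: near_def)
  qed
  have same: "k \<notin> star j \<or> k \<notin> star j'" for k using stars[of k k] by auto
  have 1: "inner_Omega c (grad u) (grad v) = 0"
  proof (rule inner_Omega_zero[OF uV vV])
    fix k x assume k: "k \<in> active c l" "x \<in> interior (cell c l k)"
    show "grad u x \<bullet> grad v x = 0"
      using same[of k] zero_off_star(2)[OF u k(1)] zero_off_star(2)[OF v k(1)]
      by (auto simp: grad_interior[OF uV k] grad_interior[OF vV k])
  qed
  have 2: "inner_Gam c (dn c u') v' = 0"
    if u': "u' \<in> local_space \<kappa> p c l a" and v': "v' \<in> local_space \<kappa> p c l b"
      and ab: "\<And>k. k \<notin> star a \<or> k \<notin> star b" for u' v' a b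
  proof (rule inner_Gam_zero)
    fix x assume x: "x \<in> Gam c"
    have u'V: "u' \<in> fe_space p c l" using u' local_space_sub by auto
    obtain k where k: "k \<in> active c l" "x \<in> cell c l k" "dn c u' x = nv x \<bullet> gradq l k u' x"
      using dn_cell[OF x] u'V by metis
    show "dn c u' x * v' x = 0"
      using ab[of k] zero_off_star(2)[OF u' k(1)] local_space_support[OF v' k(1) _ k(2)] k(3) by auto
  qed
  have 3: "inner_Gam c (dn c u) v = 0" using 2[OF u v same] .
  have "k \<notin> star j' \<or> k \<notin> star j" for k using same[of k] by auto
  then have 4: "inner_Gam c u (dn c v) = 0"
    using 2[OF v u] inner_Gam_commute[of u "dn c v"] by simp
  have 5: "inner_Gam c u v = 0"
  proof (rule inner_Gam_zero)
    fix x assume "x \<in> Gam c"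
    then obtain k where k: "k \<in> active c l" "x \<in> cell c l k"
      using Gam_sub_active[of l] by (auto simp: active_region_def)
    show "u x * v x = 0"
      using same[of k] local_space_support[OF u k(1) _ k(2)] local_space_support[OF v k(1) _ k(2)] by auto
  qed
  have 6: "ghost_form p \<gamma> c l u v = 0"
  proof -
    have "face_form l k i m u v = 0" if ki: "(k, i) \<in> ghost_faces c l" for k i m
    proof -
      define k' where "k' = k + axis i 1"
      have act: "k \<in> active c l" "k' \<in> active c l" using ki by (auto simp: ghost_faces_def k'_def)
      have kk: "\<bar>k $ s - k' $ s\<bar> \<le> 1" "\<bar>k' $ s - k $ s\<bar> \<le> 1" for s by (auto simp: k'_def axis_def)
      have "(k \<notin> star j \<and> k' \<notin> star j) \<or> (k \<notin> star j' \<and> k' \<notin> star j')"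
        using same[of k] same[of k'] stars[of k k'] stars[of k' k] kk by blast
      then have "jump_dn p c l k i m u x * jump_dn p c l k i m v x = 0" for x
        using zero_off_star(1)[OF u act(1)] zero_off_star(1)[OF u act(2)]
          zero_off_star(1)[OF v act(1)] zero_off_star(1)[OF v act(2)]
        by (auto simp: jump_dn_eq[OF uV ki] jump_dn_eq[OF vV ki] k'_def[symmetric] partial_power_zero)
      then show ?thesis unfolding face_form_def by (simp only:) simp
    qed
    then have "face_form l (fst z) (snd z) m u v = 0" if "z \<in> ghost_faces c l" for z m using that by simp
    then show ?thesis by (simp add: ghost_form_eq)
  qed
  show ?thesis by (simp add: A_form_def nitsche_form_def 1 3 4 5 6)
qed

lemma constant_in_fe: "(\<lambda>x. if x \<in> active_region c l then 1 else 0) \<in> fe_space p c l"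
proof -
  have "(\<lambda>x :: real^'n. \<Prod>i\<in>UNIV. x $ i ^ 0) \<in> Qpoly p" by (rule monomial_in_Qpoly) simp
  then have q: "(\<lambda>x :: real^'n. 1) \<in> Qpoly p" by simp
  have "continuous_on (active_region c l) (\<lambda>x. if x \<in> active_region c l then 1 else 0 :: real)
      \<longleftrightarrow> continuous_on (active_region c l) (\<lambda>x. 1 :: real)"
    by (rule continuous_on_cong) auto
  then show ?thesis
    unfolding fe_space_def using q
    by (auto intro!: bexI[OF _ q] simp: active_region_def)
qed

lemma active_region_ne: "active_region c l \<noteq> {}"
  using Omega_sub_active[of l] Omega_ne by auto

lemma fe_nontrivial: "\<exists>v\<in>fe_space p c l. v \<noteq> 0"
proof -
  obtain x where x: "x \<in> active_region c l" using active_region_ne by blast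
  have "(\<lambda>x. if x \<in> active_region c l then 1 else 0 :: real) \<noteq> 0"
  proof
    assume "(\<lambda>x. if x \<in> active_region c l then 1 else 0 :: real) = 0"
    from fun_cong[OF this, of x] show False using x by simp
  qed
  then show ?thesis by (rule bexI[OF _ constant_in_fe])
qed

lemma linear_prolong: "linear (prolong c l)"
  by (rule linearI) (auto simp: prolong_def fun_eq_iff)

lemma prolong_in_fe:
  assumes u: "u \<in> fe_space p c (l - 1)" and l: "1 \<le> l"
    and nested: "active_region c l \<subseteq> active_region c (l - 1)"
  shows "prolong c l u \<in> fe_space p c l"
proof -
  have e: "edge c (l - 1) = 2 * edge c l" using l by (cases l) (auto simp: edge_def)
  have "continuous_on (active_region c l) u"
    using u nested continuous_on_subset by (auto simp: fe_space_def)
  then have cont: "continuous_on (active_region c l) (prolong c l u)"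
    by (subst continuous_on_cong[of _ _ _ u]) (auto simp: prolong_def)
  have "\<exists>q\<in>Qpoly p. \<forall>x\<in>cell c l k. prolong c l u x = q x" if k: "k \<in> active c l" for k
  proof -
    \<comment> \<open>the cell of the coarse grid that contains the fine cell \<open>k\<close>\<close>
    define k' where "k' = (\<chi> i. k $ i div 2)"
    have iv: "iv l i m \<subseteq> iv (l - 1) i (m div 2)" for i m
    proof
      fix t assume t: "t \<in> iv l i m"
      have "2 * (m div 2) \<le> m" "m + 1 \<le> 2 * (m div 2) + 2" by presburger+
      then have "real_of_int (2 * (m div 2)) \<le> of_int m" "real_of_int (m + 1) \<le> of_int (2 * (m div 2) + 2)"
        by linarith+
      then have "edge c l * real_of_int (2 * (m div 2)) \<le> edge c l * of_int m"
          "edge c l * real_of_int (m + 1) \<le> edge c l * of_int (2 * (m div 2) + 2)"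
        by (auto intro!: mult_left_mono less_imp_le[OF edge_pos] simp del: of_int_add of_int_mult)
      moreover have "edge c l * real_of_int (2 * (m div 2)) = 2 * edge c l * of_int (m div 2)"
          "edge c l * real_of_int (2 * (m div 2) + 2) = 2 * edge c l * of_int (m div 2 + 1)"
        by (simp_all add: algebra_simps)
      ultimately show "t \<in> iv (l - 1) i (m div 2)"
        using t unfolding iv_def e atLeastAtMost_iff by linarith
    qed
    have sub: "cell c l k \<subseteq> cell c (l - 1) k'" using subsetD[OF iv] by (auto simp: mem_cell k'_def)
    then have "k' \<in> active c (l - 1)" using k by (auto simp: active_def)
    then obtain q where q: "q \<in> Qpoly p" "\<forall>x\<in>cell c (l - 1) k'. u x = q x" using u by (auto simp: fe_space_def)
    have "\<forall>x\<in>cell c l k. prolong c l u x = q x"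
      using q(2) sub k by (auto simp: prolong_def active_region_def)
    then show ?thesis using q(1) by blast
  qed
  then show ?thesis using cont by (auto simp: fe_space_def prolong_def)
qed

end

section \<open>The two-level method\<close>

text \<open>One level of one configuration, with the assumptions on the constants specialised to it and the energy forms on both levels
  known to be inner products.\<close>

locale two_level = fe_domain c p for c :: "('n::finite) cut_config" and p +
  fixes \<gamma> \<gamma>D Csd Cpr N :: real and l :: nat and \<kappa> :: patch_kind
  assumes N_eq: "N = 5 ^ CARD('n)" and l: "1 \<le> l" and nested: "active_region c l \<subseteq> active_region c (l - 1)"
    and fine_energy: "energy_space (fe_space p c l) (A_form p \<gamma> \<gamma>D c l)"
    and coarse_energy: "energy_space (fe_space p c (l - 1)) (A_form p \<gamma> \<gamma>D c (l - 1))"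
    and prol: "\<And>v. v \<in> fe_space p c (l - 1) \<Longrightarrow>
        A_norm p \<gamma> \<gamma>D c l (prolong c l v) \<le> Cpr * A_norm p \<gamma> \<gamma>D c (l - 1) v"
    and dec: "\<And>v. v \<in> fe_space p c l \<Longrightarrow> \<exists>w0\<in>fe_space p c (l - 1). \<exists>w.
          (\<forall>j\<in>admissible_vertices c l. w j \<in> local_space \<kappa> p c l j) \<and>
          v = prolong c l w0 + (\<Sum>j\<in>admissible_vertices c l. w j) \<and>
          A_form p \<gamma> \<gamma>D c l (prolong c l w0) (prolong c l w0)
            + (\<Sum>j\<in>admissible_vertices c l. A_form p \<gamma> \<gamma>D c l (w j) (w j)) \<le> Csd * A_form p \<gamma> \<gamma>D c l v v \<and>
          A_form p \<gamma> \<gamma>D c (l - 1) w0 w0 \<le> Csd * A_form p \<gamma> \<gamma>D c l v v"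
begin

abbreviation "V \<equiv> fe_space p c l"
abbreviation "V' \<equiv> fe_space p c (l - 1)"
abbreviation "A \<equiv> A_form p \<gamma> \<gamma>D c l"
abbreviation "A' \<equiv> A_form p \<gamma> \<gamma>D c (l - 1)"
abbreviation "nrm \<equiv> A_opnorm p \<gamma> \<gamma>D c l"
abbreviation "J \<equiv> admissible_vertices c l"
abbreviation "W j \<equiv> local_space \<kappa> p c l j"
abbreviation "W0 \<equiv> coarse_space p c l"
abbreviation "P j \<equiv> local_proj \<kappa> p \<gamma> \<gamma>D c l j"
abbreviation "P0 \<equiv> coarse_proj p \<gamma> \<gamma>D c l"
abbreviation "R \<equiv> restrict_rediscretized p \<gamma> \<gamma>D c l"
abbreviation "T0 \<equiv> T0_op p \<gamma> \<gamma>D Cpr c l"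

sublocale F: energy_space V A by (rule fine_energy)
sublocale C: energy_space V' A' by (rule coarse_energy)

lemma finite_basis: "finite (tent l ` nodes p c l)" by simp

lemma prolong_V: "u \<in> V' \<Longrightarrow> prolong c l u \<in> V"
  using prolong_in_fe[OF _ l nested] .

lemma A_projection_projects:
  assumes B: "finite B" "B \<subseteq> V"
  shows "F.projects_onto (span B) (A_projection p \<gamma> \<gamma>D c l (span B))"
  unfolding F.projects_onto_def
proof (intro ballI)
  fix v assume v: "v \<in> V"
  have sub: "span B \<subseteq> V" by (rule span_minimal[OF B(2) subspace_fe])
  have "\<exists>u\<in>span B. \<forall>w\<in>span B. A u w = A v w"
    by (rule F.Riesz_exists[OF B])
       (use v sub in \<open>auto simp: F.add_right F.scale_right subset_iff\<close>)
  then obtain u where u: "u \<in> span B" "\<forall>w\<in>span B. A u w = A v w" by blast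
  have "A_projection p \<gamma> \<gamma>D c l (span B) v = u"
    unfolding A_projection_def
    by (rule the_equality) (use u F.eq_by_testing[OF _ _ subspace_span sub] in auto)
  then show "A_projection p \<gamma> \<gamma>D c l (span B) v \<in> span B \<and>
      (\<forall>w\<in>span B. A (A_projection p \<gamma> \<gamma>D c l (span B) v) w = A v w)" using u by simp
qed

lemma local_projects: "F.projects_onto (W j) (P j)"
  unfolding local_proj_def local_space_span
  by (rule A_projection_projects)
     (auto simp: finite_patch_nodes tent_in_fe)

lemma coarse_space_span: "W0 = span (prolong c l ` tent (l - 1) ` nodes p c (l - 1))"
  unfolding coarse_space_def fe_space_span[of "l - 1"] by (rule linear_span_image[OF linear_prolong, symmetric])

lemma coarse_sub: "W0 \<subseteq> V"
  by (auto simp: coarse_space_def prolong_V)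

lemma coarse_projects: "F.projects_onto W0 P0"
  unfolding coarse_proj_def coarse_space_span
  by (rule A_projection_projects) (auto simp: prolong_V tent_in_fe)

sublocale S: patch_space V A J W P near N
proof
  show "near j k \<longleftrightarrow> near k j" for j k :: "int^'n" by (auto simp: near_def abs_minus_commute)
  show "real (card {k \<in> J. near j k}) \<le> N" for j
  proof -
    have "real (card {k \<in> J. near j k}) \<le> real (5 ^ CARD('n))"
      using near_card[of J j] by (simp only: of_nat_le_iff)
    then show ?thesis by (simp add: N_eq)
  qed
  have "(5 :: real) ^ 1 \<le> 5 ^ CARD('n)" by (rule power_increasing) (use dim in auto)
  then show "2 \<le> N" by (simp add: N_eq)
qed (use local_space_sub local_projects in \<open>auto intro: locality\<close>)

lemma R_props:
  assumes u: "u \<in> V"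
  shows "R u \<in> V'" "z \<in> V' \<Longrightarrow> A' (R u) z = A u (prolong c l z)"
proof -
  have "\<exists>w\<in>span (tent (l - 1) ` nodes p c (l - 1)). \<forall>z\<in>span (tent (l - 1) ` nodes p c (l - 1)).
      A' w z = A u (prolong c l z)"
    by (rule C.Riesz_exists)
       (auto simp: tent_in_fe fe_space_span[symmetric] linear_add[OF linear_prolong] linear_scale[OF linear_prolong]
          F.add_right F.scale_right prolong_V u)
  then obtain w where w: "w \<in> V'" "\<forall>z\<in>V'. A' w z = A u (prolong c l z)"
    unfolding fe_space_span[symmetric] by blast
  have "R u = w"
    unfolding restrict_rediscretized_def
    by (rule the_equality) (use w C.eq_by_testing[OF _ _ subspace_fe subset_refl] in auto)
  then show "R u \<in> V'" "z \<in> V' \<Longrightarrow> A' (R u) z = A u (prolong c l z)" using w by auto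
qed

lemma T0_eq: "T0 u = inverse (Cpr\<^sup>2) *\<^sub>R prolong c l (R u)"
  by (simp add: T0_op_def fun_eq_iff)

lemma fine_nontrivial: obtains v where "v \<in> V" "v \<noteq> 0" "0 < A v v"
  using fe_nontrivial F.energy_pos by blast

text \<open>The function \<open>1\<close> on the coarse active region has a nonzero prolongation.\<close>

lemma Cpr_pos: "0 < Cpr"
proof -
  define o1 :: "real^'n \<Rightarrow> real" where "o1 = (\<lambda>x. if x \<in> active_region c (l - 1) then 1 else 0)"
  have o1: "o1 \<in> V'" unfolding o1_def by (rule constant_in_fe)
  obtain x where x: "x \<in> active_region c l" using active_region_ne by blast
  have "prolong c l o1 \<noteq> 0"
  proof
    assume "prolong c l o1 = 0"
    from fun_cong[OF this, of x] show False using x nested by (auto simp: prolong_def o1_def)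
  qed
  then have "0 < A_norm p \<gamma> \<gamma>D c l (prolong c l o1)"
    using F.energy_pos[OF prolong_V[OF o1]] by (simp add: A_norm_def)
  also have "\<dots> \<le> Cpr * A_norm p \<gamma> \<gamma>D c (l - 1) o1" by (rule prol[OF o1])
  finally have "0 < Cpr * A_norm p \<gamma> \<gamma>D c (l - 1) o1" .
  moreover have "0 \<le> A_norm p \<gamma> \<gamma>D c (l - 1) o1" using C.nonneg[OF o1] by (simp add: A_norm_def)
  ultimately show ?thesis by (simp add: zero_less_mult_iff)
qed

lemma prolong_energy:
  assumes z: "z \<in> V'"
  shows "A (prolong c l z) (prolong c l z) \<le> Cpr\<^sup>2 * A' z z"
proof -
  have "(sqrt (A (prolong c l z) (prolong c l z)))\<^sup>2 \<le> (Cpr * sqrt (A' z z))\<^sup>2"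
    using prol[OF z] F.nonneg[OF prolong_V[OF z]] unfolding A_norm_def by (intro power_mono) auto
  then show ?thesis using F.nonneg[OF prolong_V[OF z]] C.nonneg[OF z] by (simp add: power_mult_distrib)
qed

lemma T0_form:
  assumes u: "u \<in> V" and v: "v \<in> V"
  shows "A (T0 u) v = inverse (Cpr\<^sup>2) * A' (R v) (R u)"
proof -
  have "A (T0 u) v = inverse (Cpr\<^sup>2) * A (prolong c l (R u)) v"
    unfolding T0_eq by (rule F.scale_left) (use prolong_V R_props u v in auto)
  also have "A (prolong c l (R u)) v = A v (prolong c l (R u))"
    by (rule F.form_sym) (use prolong_V R_props u v in auto)
  finally show ?thesis using R_props(2)[OF v R_props(1)[OF u]] by simp
qed

lemma T0_self_adjoint: "F.self_adjoint T0"
  unfolding F.self_adjoint_def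
proof (intro conjI ballI)
  show T: "T0 u \<in> V" if "u \<in> V" for u unfolding T0_eq using prolong_V R_props that by auto
  fix u v assume u: "u \<in> V" and v: "v \<in> V"
  have "A u (T0 v) = A (T0 v) u" by (rule F.form_sym[OF u T[OF v]])
  then show "A (T0 u) v = A u (T0 v)"
    using C.form_sym[OF R_props(1)[OF u] R_props(1)[OF v]] by (simp add: T0_form u v)
qed

text \<open>In terms of the restriction \<open>R\<close> the two sides are \<open>Cpr\<^sup>-\<^sup>4 |I (R u)|\<^sup>2\<close> and \<open>Cpr\<^sup>-\<^sup>2\<close> times the coarse energy of \<open>R u\<close>; the damping
  factor in \<open>T0\<close> is chosen for this inequality.\<close>

lemma T0_le:
  assumes u: "u \<in> V"
  shows "A (T0 u) (T0 u) \<le> A (T0 u) u"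
proof -
  let ?q = "prolong c l (R u)"
  have q: "?q \<in> V" using prolong_V R_props(1)[OF u] by auto
  have "A (T0 u) (T0 u) = inverse (Cpr\<^sup>2) * (inverse (Cpr\<^sup>2) * A ?q ?q)"
    unfolding T0_eq using q by (simp add: F.scale_left F.scale_right)
  also have "\<dots> \<le> inverse (Cpr\<^sup>2) * (inverse (Cpr\<^sup>2) * (Cpr\<^sup>2 * A' (R u) (R u)))"
    using prolong_energy[OF R_props(1)[OF u]] by (intro mult_left_mono) auto
  also have "\<dots> = A (T0 u) u" using Cpr_pos by (simp add: T0_form u)
  finally show ?thesis .
qed

lemma additive:
  assumes v: "v \<in> V"
  shows "A v v \<le> Csd * A (P_ad \<kappa> p \<gamma> \<gamma>D c l v) v" "A (P_ad \<kappa> p \<gamma> \<gamma>D c l v) v \<le> (N + 1) * A v v"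
proof -
  have eq: "P_ad \<kappa> p \<gamma> \<gamma>D c l v = P0 v + (\<Sum>j\<in>J. P j v)" by (simp add: P_ad_def fun_eq_iff)
  have split: "\<exists>v0\<in>W0. \<exists>w. (\<forall>j\<in>J. w j \<in> W j) \<and> v = v0 + (\<Sum>j\<in>J. w j) \<and>
        A v0 v0 + (\<Sum>j\<in>J. A (w j) (w j)) \<le> Csd * A v v"
    using dec[OF v] unfolding coarse_space_def by blast
  show "A v v \<le> Csd * A (P_ad \<kappa> p \<gamma> \<gamma>D c l v) v" "A (P_ad \<kappa> p \<gamma> \<gamma>D c l v) v \<le> (N + 1) * A v v"
    unfolding eq using S.additive_bounds[OF coarse_sub coarse_projects split v] by auto
qed

text \<open>Both additive bounds together, applied to some \<open>v \<noteq> 0\<close>. The lower bound for \<open>Csd\<close> absorbs the summand \<open>1\<close> in the contraction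
  constant.\<close>

lemma Csd_pos: "0 < Csd" and Csd_ge: "1 \<le> Csd * (N + 1)"
proof -
  obtain v where v: "v \<in> V" "0 < A v v" using fine_nontrivial by blast
  let ?q = "A (P_ad \<kappa> p \<gamma> \<gamma>D c l v) v"
  have q: "?q = A (P0 v) v + (\<Sum>j\<in>J. A (P j v) v)"
  proof -
    have "P_ad \<kappa> p \<gamma> \<gamma>D c l v = P0 v + (\<Sum>j\<in>J. P j v)" by (simp add: P_ad_def fun_eq_iff)
    moreover have "P0 v \<in> V" "\<And>j. j \<in> J \<Longrightarrow> P j v \<in> V"
      using F.projects_ontoD(2)[OF coarse_projects coarse_sub v(1)] S.P_D(2) v by auto
    ultimately show ?thesis using v by (simp add: F.add_left F.sum_left)
  qed
  have "0 \<le> A (P0 v) v"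
    using F.projects_ontoD(2,5)[OF coarse_projects coarse_sub v(1)] F.nonneg by metis
  then have q0: "0 \<le> ?q" unfolding q using S.P_nonneg v(1) by (intro add_nonneg_nonneg sum_nonneg) auto
  have "0 < Csd * ?q" using additive(1)[OF v(1)] v(2) by linarith
  then show C: "0 < Csd" using q0 by (simp add: zero_less_mult_iff)
  have "A v v \<le> Csd * ((N + 1) * A v v)"
    using additive[OF v(1)] C by (meson less_imp_le mult_left_mono order_trans)
  then have "1 * A v v \<le> (Csd * (N + 1)) * A v v" by (simp add: mult.assoc)
  then show "1 \<le> Csd * (N + 1)" using v(2) mult_le_cancel_right_pos by blast
qed

lemma splitting_exact: "S.stable_splitting P0 1 Csd"
  unfolding S.stable_splitting_def
proof (intro conjI ballI)
  note P0D = F.projects_ontoD[OF coarse_projects coarse_sub]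
  fix e assume e: "e \<in> V"
  obtain w0 w where w0: "w0 \<in> V'" and w: "\<forall>j\<in>J. w j \<in> W j" "e = prolong c l w0 + (\<Sum>j\<in>J. w j)"
    and le: "A (prolong c l w0) (prolong c l w0) + (\<Sum>j\<in>J. A (w j) (w j)) \<le> Csd * A e e"
    using dec[OF e] by blast
  let ?q = "prolong c l w0"
  have q: "?q \<in> V" "?q \<in> W0" using w0 prolong_V by (auto simp: coarse_space_def)
  have wV: "w j \<in> V" if "j \<in> J" for j
    by (rule subsetD[OF local_space_sub]) (use w(1) that in blast)
  have s0: "0 \<le> (\<Sum>j\<in>J. A (w j) (w j))" using wV by (intro sum_nonneg F.nonneg) auto
  have "A ?q e = A ?q (P0 e)" using P0D(4)[OF e q(2)] by simp
  also have "\<dots> \<le> sqrt (A ?q ?q) * sqrt (A (P0 e) (P0 e))" using q P0D(2)[OF e] by (intro F.Cauchy_Schwarz)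
  also have "\<dots> \<le> sqrt (Csd * A e e) * sqrt (1 * A (P0 e) e)"
    using le s0 P0D(5)[OF e] F.nonneg[OF P0D(2)[OF e]] F.nonneg[OF q(1)] by (intro mult_mono real_sqrt_le_mono) auto
  finally have "A ?q e \<le> sqrt (Csd * A e e) * sqrt (1 * A (P0 e) e)" .
  moreover have "(\<Sum>j\<in>J. A (w j) (w j)) \<le> Csd * A e e" using le F.nonneg[OF q(1)] by linarith
  ultimately show "\<exists>e0\<in>V. \<exists>w. (\<forall>j\<in>J. w j \<in> W j) \<and> e = e0 + (\<Sum>j\<in>J. w j) \<and>
        A e0 e \<le> sqrt (Csd * A e e) * sqrt (1 * A (P0 e) e) \<and> (\<Sum>j\<in>J. A (w j) (w j)) \<le> Csd * A e e"
    using q(1) w by blast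
qed (use Csd_pos in auto)

text \<open>The coarse part is tested through the coarse form, \<open>A (I w0) e = A' (R e) w0\<close>, so the bound on the coarse energy of \<open>w0\<close> is the one that
  enters.\<close>

lemma splitting_rediscretized: "S.stable_splitting T0 (Cpr\<^sup>2) Csd"
  unfolding S.stable_splitting_def
proof (intro conjI ballI)
  fix e assume e: "e \<in> V"
  obtain w0 w where w0: "w0 \<in> V'" and w: "\<forall>j\<in>J. w j \<in> W j" "e = prolong c l w0 + (\<Sum>j\<in>J. w j)"
    and le: "A (prolong c l w0) (prolong c l w0) + (\<Sum>j\<in>J. A (w j) (w j)) \<le> Csd * A e e"
    and le0: "A' w0 w0 \<le> Csd * A e e"
    using dec[OF e] by blast
  let ?q = "prolong c l w0"
  have q: "?q \<in> V" using w0 prolong_V by auto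
  have Re: "R e \<in> V'" by (rule R_props(1)[OF e])
  have "A ?q e = A' (R e) w0" using R_props(2)[OF e w0] F.form_sym[OF q e] by simp
  also have "\<dots> \<le> sqrt (A' (R e) (R e)) * sqrt (A' w0 w0)" by (rule C.Cauchy_Schwarz[OF Re w0])
  also have "A' (R e) (R e) = Cpr\<^sup>2 * A (T0 e) e" using Cpr_pos by (simp add: T0_form e)
  also have "sqrt (Cpr\<^sup>2 * A (T0 e) e) * sqrt (A' w0 w0) \<le> sqrt (Cpr\<^sup>2 * A (T0 e) e) * sqrt (Csd * A e e)"
    using le0 C.nonneg[OF Re] by (intro mult_left_mono real_sqrt_le_mono) (auto simp: T0_form e)
  finally have "A ?q e \<le> sqrt (Csd * A e e) * sqrt (Cpr\<^sup>2 * A (T0 e) e)" by (simp add: mult.commute)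
  moreover have "(\<Sum>j\<in>J. A (w j) (w j)) \<le> Csd * A e e" using le F.nonneg[OF q] by linarith
  ultimately show "\<exists>e0\<in>V. \<exists>w. (\<forall>j\<in>J. w j \<in> W j) \<and> e = e0 + (\<Sum>j\<in>J. w j) \<and>
        A e0 e \<le> sqrt (Csd * A e e) * sqrt (Cpr\<^sup>2 * A (T0 e) e) \<and> (\<Sum>j\<in>J. A (w j) (w j)) \<le> Csd * A e e"
    using q w by blast
qed (use Csd_pos in auto)

lemma N2: "2 \<le> N"
  by (rule S.N_ge)

lemma K_exact: "Csd * (1 + N\<^sup>2) + 1 \<le> (2 * N\<^sup>2 + 1) * Csd"
proof -
  have "Csd * (1 + N\<^sup>2) + 1 \<le> Csd * (1 + N\<^sup>2) + Csd * (N + 1)" using Csd_ge by simp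
  also have "\<dots> = Csd * (N\<^sup>2 + N + 2)" by (simp add: algebra_simps)
  also have "\<dots> \<le> Csd * (2 * N\<^sup>2 + 1)"
  proof (rule mult_left_mono)
    have "N * 2 \<le> N * N" using N2 by (intro mult_left_mono) auto
    then show "N\<^sup>2 + N + 2 \<le> 2 * N\<^sup>2 + 1" using N2 unfolding power2_eq_square by linarith
  qed (use Csd_pos in simp)
  finally show ?thesis by (simp add: mult.commute)
qed

lemma K_rediscretized: "Csd * (Cpr\<^sup>2 + N\<^sup>2) + 1 \<le> (2 * N\<^sup>2 + 1) * (1 + Cpr\<^sup>2) * Csd"
proof -
  have "Csd * (Cpr\<^sup>2 + N\<^sup>2) + 1 \<le> Csd * (1 + N\<^sup>2) + 1 + Csd * Cpr\<^sup>2"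
    using Csd_pos by (simp add: algebra_simps)
  also have "\<dots> \<le> (2 * N\<^sup>2 + 1) * Csd + Csd * Cpr\<^sup>2" using K_exact by simp
  also have "\<dots> \<le> (2 * N\<^sup>2 + 1) * Csd + Csd * Cpr\<^sup>2 + Csd * (2 * N\<^sup>2 * Cpr\<^sup>2)" using Csd_pos by simp
  also have "\<dots> = (2 * N\<^sup>2 + 1) * (1 + Cpr\<^sup>2) * Csd" by (simp add: algebra_simps)
  finally show ?thesis .
qed

lemma opnorm_le:
  assumes T: "\<And>v. v \<in> V \<Longrightarrow> T v \<in> V" and \<theta>: "0 \<le> \<theta>"
    and le: "\<And>v. v \<in> V \<Longrightarrow> A (T v) (T v) \<le> \<theta>\<^sup>2 * A v v"
  shows "0 \<le> nrm T" "nrm T \<le> \<theta>"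
proof -
  have eq: "nrm T = (SUP v\<in>{v \<in> V. v \<noteq> 0}. sqrt (A (T v) (T v)) / sqrt (A v v))"
    by (simp add: A_opnorm_def A_norm_def zero_fun_def)
  have ub: "sqrt (A (T v) (T v)) / sqrt (A v v) \<le> \<theta>" if "v \<in> V" "v \<noteq> 0" for v
  proof -
    have p: "0 < A v v" by (rule F.energy_pos[OF that])
    have "sqrt (A (T v) (T v)) \<le> sqrt (\<theta>\<^sup>2 * A v v)" by (rule real_sqrt_le_mono[OF le[OF that(1)]])
    also have "\<dots> = \<theta> * sqrt (A v v)" using \<theta> by (simp add: real_sqrt_mult)
    finally show ?thesis using p by (simp add: pos_divide_le_eq)
  qed
  obtain v where v: "v \<in> V" "v \<noteq> 0" using fe_nontrivial by blast
  show "nrm T \<le> \<theta>" unfolding eq by (rule cSUP_least) (use v ub in auto)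
  have "0 \<le> sqrt (A (T v) (T v)) / sqrt (A v v)"
    using F.nonneg[OF T[OF v(1)]] F.nonneg[OF v(1)] by simp
  also have "\<dots> \<le> nrm T" unfolding eq
    by (rule cSUP_upper) (use v ub in \<open>auto intro!: bdd_aboveI2[of _ _ \<theta>]\<close>)
  finally show "0 \<le> nrm T" .
qed

lemma opnorm_sq_le:
  assumes T: "\<And>v. v \<in> V \<Longrightarrow> T v \<in> V" and \<theta>: "0 \<le> \<theta>"
    and le: "\<And>v. v \<in> V \<Longrightarrow> A (T v) (T v) \<le> \<theta> * A v v"
  shows "(nrm T)\<^sup>2 \<le> \<theta>"
proof -
  have "0 \<le> nrm T" "nrm T \<le> sqrt \<theta>"
    using opnorm_le[of T "sqrt \<theta>"] T \<theta> le by simp_all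
  then have "(nrm T)\<^sup>2 \<le> (sqrt \<theta>)\<^sup>2" by (intro power_mono)
  then show ?thesis using \<theta> by simp
qed

lemma cond_number_le:
  assumes M: "F.self_adjoint M" and a: "0 < a"
    and lo: "\<And>v. v \<in> V \<Longrightarrow> a * A v v \<le> A (M v) v"
    and hi: "\<And>v. v \<in> V \<Longrightarrow> A (M v) v \<le> b * A v v"
  shows "bij_betw M V V" "cond_number p \<gamma> \<gamma>D c l M \<le> b * inverse a"
proof -
  have MV: "M v \<in> V" if "v \<in> V" for v using F.self_adjointD(1)[OF M that] .
  show bij: "bij_betw M V V"
  proof (rule F.coercive_bij[OF M _ finite_basis fe_space_span])
    fix v assume v: "v \<in> V" "v \<noteq> 0"
    have "0 < a * A v v" using a F.energy_pos[OF v] by simp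
    then show "0 < A (M v) v" using lo[OF v(1)] by linarith
  qed
  note bounds = F.spectral_bounds_norm[OF M a lo hi]
  obtain v0 where v0: "v0 \<in> V" "0 < A v0 v0" using fine_nontrivial by blast
  have "0 < a * A v0 v0" using a v0 by simp
  then have "0 < b * A v0 v0" using lo[OF v0(1)] hi[OF v0(1)] by linarith
  then have b: "0 < b" using v0 by (simp add: zero_less_mult_iff)
  have 1: "0 \<le> nrm M" "nrm M \<le> b"
  proof -
    have "A (M v) (M v) \<le> b\<^sup>2 * A v v" if v: "v \<in> V" for v
    proof -
      have "(sqrt (A (M v) (M v)))\<^sup>2 \<le> (b * sqrt (A v v))\<^sup>2"
        using bounds(1)[OF _ _ v] F.nonneg[OF MV[OF v]] by (intro power_mono) auto
      then show ?thesis using F.nonneg[OF MV[OF v]] F.nonneg[OF v] by (simp add: power_mult_distrib)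
    qed
    then show "0 \<le> nrm M" "nrm M \<le> b" using opnorm_le[of M b] MV b by auto
  qed
  have 2: "0 \<le> nrm (inv_into V M)" "nrm (inv_into V M) \<le> inverse a"
  proof -
    have iV: "inv_into V M v \<in> V" and Mi: "M (inv_into V M v) = v" if "v \<in> V" for v
      using bij that by (auto simp: bij_betw_def inv_into_into f_inv_into_f)
    have "A (inv_into V M v) (inv_into V M v) \<le> (inverse a)\<^sup>2 * A v v" if v: "v \<in> V" for v
    proof -
      let ?u = "inv_into V M v"
      have "a * sqrt (A ?u ?u) \<le> sqrt (A v v)" using bounds(2)[OF _ _ iV[OF v]] Mi[OF v] by simp
      then have "sqrt (A ?u ?u) \<le> inverse a * sqrt (A v v)" using a by (simp add: field_simps)
      then have "(sqrt (A ?u ?u))\<^sup>2 \<le> (inverse a * sqrt (A v v))\<^sup>2"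
        using F.nonneg[OF iV[OF v]] by (intro power_mono) auto
      then show ?thesis using F.nonneg[OF iV[OF v]] F.nonneg[OF v] by (simp add: power_mult_distrib)
    qed
    then show "0 \<le> nrm (inv_into V M)" "nrm (inv_into V M) \<le> inverse a"
      using opnorm_le[of "inv_into V M" "inverse a"] iV a by auto
  qed
  show "cond_number p \<gamma> \<gamma>D c l M \<le> b * inverse a"
    unfolding cond_number_def using 1 2 b by (intro mult_mono) auto
qed

lemma iteration_convergesI:
  assumes E: "\<And>v. v \<in> V \<Longrightarrow> E v \<in> V" and \<theta>: "0 \<le> \<theta>" "\<theta> < 1"
    and le: "\<And>v. v \<in> V \<Longrightarrow> A (E v) (E v) \<le> \<theta> * A v v"
  shows "iteration_converges p \<gamma> \<gamma>D c l E"
  unfolding iteration_converges_def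
proof
  fix v assume v: "v \<in> V"
  have EnV: "(E ^^ n) v \<in> V" for n by (induction n) (auto simp: v E)
  have En: "A ((E ^^ n) v) ((E ^^ n) v) \<le> \<theta> ^ n * A v v" for n
  proof (induction n)
    case (Suc n)
    have "A ((E ^^ Suc n) v) ((E ^^ Suc n) v) \<le> \<theta> * A ((E ^^ n) v) ((E ^^ n) v)" using le[OF EnV[of n]] by simp
    also have "\<dots> \<le> \<theta> * (\<theta> ^ n * A v v)" using Suc \<theta> by (intro mult_left_mono)
    finally show ?case by (simp add: mult.assoc)
  qed simp
  have "(\<lambda>n. \<theta> ^ n * A v v) \<longlonglongrightarrow> 0 * A v v"
    using \<theta> by (intro tendsto_mult tendsto_const LIMSEQ_realpow_zero)
  then have up: "(\<lambda>n. sqrt (\<theta> ^ n * A v v)) \<longlonglongrightarrow> 0" using tendsto_real_sqrt by fastforce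
  show "(\<lambda>n. A_norm p \<gamma> \<gamma>D c l ((E ^^ n) v)) \<longlonglongrightarrow> 0"
  proof (rule tendsto_sandwich[OF _ _ tendsto_const up])
    show "\<forall>\<^sub>F n in sequentially. 0 \<le> A_norm p \<gamma> \<gamma>D c l ((E ^^ n) v)"
      using F.nonneg[OF EnV] by (simp add: A_norm_def)
    show "\<forall>\<^sub>F n in sequentially. A_norm p \<gamma> \<gamma>D c l ((E ^^ n) v) \<le> sqrt (\<theta> ^ n * A v v)"
      using En by (simp add: A_norm_def)
  qed
qed

lemma error_op_eq: "error_op Ts = F.sweep Ts"
proof -
  have "(residual_op :: 'n fe_operator \<Rightarrow> 'n fe_operator) = (\<lambda>T v. v - T v)"
    by (simp add: fun_eq_iff residual_op_def)
  then show ?thesis by (simp add: error_op_def F.sweep_def)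
qed

lemma P_ad_self_adjoint: "F.self_adjoint (P_ad \<kappa> p \<gamma> \<gamma>D c l)"
  unfolding F.self_adjoint_def
proof (intro conjI ballI)
  have eq: "P_ad \<kappa> p \<gamma> \<gamma>D c l v = P0 v + (\<Sum>j\<in>J. P j v)" for v by (simp add: P_ad_def fun_eq_iff)
  note P0 = F.self_adjointD[OF F.projection_self_adjoint[OF coarse_projects coarse_sub]]
  note P = F.self_adjointD[OF S.P_self_adjoint]
  show "P_ad \<kappa> p \<gamma> \<gamma>D c l u \<in> V" if "u \<in> V" for u
    unfolding eq using that P0 P by auto
  show "A (P_ad \<kappa> p \<gamma> \<gamma>D c l u) v = A u (P_ad \<kappa> p \<gamma> \<gamma>D c l v)" if "u \<in> V" "v \<in> V" for u v
    unfolding eq using that P0 P by (simp add: F.add_left F.add_right F.sum_left F.sum_right)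
qed

text \<open>The exact and the rediscretized coarse solve are treated together: \<open>T\<close> is either of them, with \<open>\<rho>\<close> its constant in the stable
  splitting.\<close>

context
  fixes js T \<rho> K
  assumes js: "enumerates js J" and T: "F.self_adjoint T"
    and T_le: "\<And>v. v \<in> V \<Longrightarrow> A (T v) (T v) \<le> A (T v) v"
    and split: "S.stable_splitting T \<rho> Csd" and K: "Csd * (\<rho> + N\<^sup>2) + 1 \<le> K"
begin

lemma js': "distinct js" "set js = J"
  using js by (auto simp: enumerates_def)

lemma ops_self_adjoint: "Q \<in> set (T # map P js) \<Longrightarrow> F.self_adjoint Q"
  using T js' S.P_self_adjoint by auto

lemma K_ge_1: "1 \<le> K"
proof -
  have "0 \<le> \<rho>" "0 \<le> Csd" using split by (auto simp: S.stable_splitting_def)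
  then have "0 \<le> Csd * (\<rho> + N\<^sup>2)" by simp
  then show ?thesis using K by linarith
qed

lemma theta: "0 \<le> 1 - 1 / K" "1 - 1 / K < 1"
  using K_ge_1 by auto

lemma error_in_V: "v \<in> V \<Longrightarrow> error_op (T # map P js) v \<in> V"
  unfolding error_op_eq by (intro F.sweep_in_V) (use ops_self_adjoint in auto)

lemma error_contraction:
  assumes v: "v \<in> V"
  shows "A (error_op (T # map P js) v) (error_op (T # map P js) v) \<le> (1 - 1 / K) * A v v"
proof -
  note c = S.sweep_contraction[OF js' T T_le split K v]
  have "A (error_op (T # map P js) v) (error_op (T # map P js) v) \<le> (1 - 1 / K) * A (v - T v) v"
    using c(1) by (simp add: error_op_eq)
  also have "\<dots> \<le> (1 - 1 / K) * A v v" using c(2) theta by (intro mult_left_mono)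
  finally show ?thesis .
qed

lemma reversed_in_V: "v \<in> V \<Longrightarrow> error_op (rev (T # map P js)) v \<in> V"
  unfolding error_op_eq by (intro F.sweep_in_V) (use ops_self_adjoint in auto)

lemma reversed_contraction:
  assumes v: "v \<in> V"
  shows "A (error_op (rev (T # map P js)) v) (error_op (rev (T # map P js)) v) \<le> (1 - 1 / K) * A v v"
proof (rule F.adjoint_contraction[OF error_in_V reversed_in_V _ error_contraction v])
  fix u v assume "u \<in> V" "v \<in> V"
  then show "A (error_op (T # map P js) u) v = A u (error_op (rev (T # map P js)) v)"
    unfolding error_op_eq using ops_self_adjoint by (intro F.sweep_adjoint) auto
qed

lemma symmetrized:
  defines "E \<equiv> F.sweep (rev (map P js) @ T # map P js)"
  shows "F.self_adjoint E" "v \<in> V \<Longrightarrow> 0 \<le> A (E v) v" "v \<in> V \<Longrightarrow> A (E v) v \<le> (1 - 1 / K) * A v v"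
  unfolding E_def by (rule S.symmetrized_sweep[OF js' T T_le split K refl]; assumption)+

lemma symmetrized_contraction:
  assumes v: "v \<in> V"
  defines "E \<equiv> error_op (rev (map P js) @ T # map P js)"
  shows "A (E v) (E v) \<le> (1 - 1 / K) * A v v"
proof -
  have "A (E v) (E v) \<le> (1 - 1 / K) * A (E v) v"
    unfolding E_def error_op_eq by (rule F.energy_operator_le[OF symmetrized(1) symmetrized(2) symmetrized(3) v])
  also have "\<dots> \<le> 1 * A (E v) v"
    using theta symmetrized(2)[OF v] unfolding E_def error_op_eq by (intro mult_right_mono) auto
  also have "\<dots> \<le> (1 - 1 / K) * A v v"
    using symmetrized(3)[OF v] by (simp add: E_def error_op_eq)
  finally show ?thesis .
qed

lemma preconditioner:
  "spd_with_cond_le p \<gamma> \<gamma>D c l (residual_op (error_op (rev (map P js) @ T # map P js))) K"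
proof -
  define E where "E = F.sweep (rev (map P js) @ T # map P js)"
  have M: "residual_op (error_op (rev (map P js) @ T # map P js)) = (\<lambda>v. v - E v)"
    by (simp add: fun_eq_iff residual_op_def error_op_eq E_def)
  note E = symmetrized[folded E_def]
  have sa: "F.self_adjoint (\<lambda>v. v - E v)" by (rule F.self_adjoint_residual[OF E(1)])
  have K0: "0 < 1 / K" using K_ge_1 by simp
  have EV: "E v \<in> V" if "v \<in> V" for v using F.self_adjointD(1)[OF E(1) that] .
  have lo: "1 / K * A v v \<le> A (v - E v) v" and hi: "A (v - E v) v \<le> 1 * A v v" if v: "v \<in> V" for v
    using E(2,3)[OF v] v EV[OF v] by (simp_all add: F.diff_left algebra_simps)
  note cn = cond_number_le[OF sa K0 lo hi]
  show ?thesis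
    unfolding spd_with_cond_le_def M
  proof (intro conjI ballI impI)
    show "bij_betw (\<lambda>v. v - E v) V V" by (rule cn(1))
    show "A (v - E v) w = A v (w - E w)" if "v \<in> V" "w \<in> V" for v w
      using F.self_adjointD(2)[OF sa that] .
    show "0 < A (v - E v) v" if v: "v \<in> V" "v \<noteq> (\<lambda>x. 0)" for v
    proof -
      have "0 < A v v" using v by (intro F.energy_pos) (auto simp: zero_fun_def)
      then have "0 < 1 / K * A v v" using K0 by (rule mult_pos_pos[rotated])
      then show ?thesis using lo[OF v(1)] by linarith
    qed
    show "cond_number p \<gamma> \<gamma>D c l (\<lambda>v. v - E v) \<le> K" using cn(2) by simp
  qed
qed

end

end

section \<open>Convergence and preconditioning\<close>

lemma energy_space_fe:
  assumes dom: "fe_domain c p" and \<gamma>: "0 < \<gamma>" and cA: "0 < cA"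
    and lower: "\<And>v. v \<in> fe_space p c l \<Longrightarrow> cA * N_norm_sq p \<gamma> c l v \<le> A_form p \<gamma> \<gamma>D c l v v"
    and exterior: "\<And>v. v \<in> fe_space p c l \<Longrightarrow>
        (LINT x:(active_region c l - Omega c)|lebesgue. grad v x \<bullet> grad v x)
          \<le> C * (inner_Omega c (grad v) (grad v) + ghost_form p \<gamma> c l v v)"
  shows "energy_space (fe_space p c l) (A_form p \<gamma> \<gamma>D c l)"
proof -
  interpret fe_domain c p by (rule dom)
  have \<gamma>0: "0 \<le> \<gamma>" using \<gamma> by simp
  show ?thesis
  proof
    show "subspace (fe_space p c l)" by (rule subspace_fe)
    show "A_form p \<gamma> \<gamma>D c l (u + v) w = A_form p \<gamma> \<gamma>D c l u w + A_form p \<gamma> \<gamma>D c l v w"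
      if "u \<in> fe_space p c l" "v \<in> fe_space p c l" "w \<in> fe_space p c l" for u v w
      using that by (rule A_form_add_left)
    show "A_form p \<gamma> \<gamma>D c l (r *\<^sub>R u) w = r * A_form p \<gamma> \<gamma>D c l u w"
      if "u \<in> fe_space p c l" "w \<in> fe_space p c l" for u w r
      using that by (rule A_form_scale_left)
    show "A_form p \<gamma> \<gamma>D c l u w = A_form p \<gamma> \<gamma>D c l w u" for u w by (rule A_form_commute)
    fix u assume u: "u \<in> fe_space p c l"
    note d = energy_definite[OF u \<gamma>0 cA lower[OF u] exterior[OF u]]
    show "0 \<le> A_form p \<gamma> \<gamma>D c l u u" by (rule d(1))
    show "u = 0" if "A_form p \<gamma> \<gamma>D c l u u = 0" by (rule d(2)[OF that])
  qed
qed

theorem theorem2: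
  fixes \<C> :: "('n::finite) cut_config set"
    and \<kappa> :: patch_kind and p :: nat and \<gamma> \<gamma>D Csd Cpr NO :: real
  assumes dim: "CARD('n) = 2 \<or> CARD('n) = 3"
    and degree: "1 \<le> p"
    and gamma: "0 < \<gamma>" "\<gamma> \<le> 1"
    and geometry: "\<forall>c\<in>\<C>. geometric_assumption c"
    and stability: "stability_assumption p \<gamma> \<gamma>D \<C>"
    and covering: "\<forall>c\<in>\<C>. \<forall>l\<in>{1..levels c}. covering_assumption \<kappa> p c l"
    and Csd: "is_decomposition_constant \<kappa> p \<gamma> \<gamma>D \<C> Csd"
    and Cpr: "is_prolongation_constant p \<gamma> \<gamma>D \<C> Cpr"
    and NO: "NO = 5 ^ CARD('n)"
  shows "\<forall>c\<in>\<C>. \<forall>l\<in>{1..levels c}.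
    (let V = fe_space p c l; A = A_form p \<gamma> \<gamma>D c l; nrm = A_opnorm p \<gamma> \<gamma>D c l;
         Pad = P_ad \<kappa> p \<gamma> \<gamma>D c l
     in (\<forall>v\<in>V. inverse Csd * A v v \<le> A (Pad v) v \<and> A (Pad v) v \<le> (NO + 1) * A v v) \<and>
        bij_betw Pad V V \<and> cond_number p \<gamma> \<gamma>D c l Pad \<le> (NO + 1) * Csd \<and>
        (\<forall>js. enumerates js (admissible_vertices c l) \<longrightarrow>
          (let P0 = coarse_proj p \<gamma> \<gamma>D c l; T0 = T0_op p \<gamma> \<gamma>D Cpr c l;
               Ps = map (local_proj \<kappa> p \<gamma> \<gamma>D c l) js;
               E = error_op (P0 # Ps);
               Erev = error_op (rev (P0 # Ps));
               Esym = error_op (rev Ps @ P0 # Ps);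
               E' = error_op (T0 # Ps);
               Esym' = error_op (rev Ps @ T0 # Ps);
               K = (2 * NO\<^sup>2 + 1) * Csd;
               K' = (2 * NO\<^sup>2 + 1) * (1 + Cpr\<^sup>2) * Csd
           in (nrm E)\<^sup>2 \<le> 1 - 1 / K \<and> (nrm Erev)\<^sup>2 \<le> 1 - 1 / K \<and> (nrm Esym)\<^sup>2 \<le> 1 - 1 / K \<and>
              1 - 1 / K < 1 \<and>
              (nrm E')\<^sup>2 \<le> 1 - 1 / K' \<and> 1 - 1 / K' < 1 \<and>
              iteration_converges p \<gamma> \<gamma>D c l E \<and>
              iteration_converges p \<gamma> \<gamma>D c l E' \<and>
              spd_with_cond_le p \<gamma> \<gamma>D c l (residual_op Esym) K \<and>
              spd_with_cond_le p \<gamma> \<gamma>D c l (residual_op Esym') K')))"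
proof (intro ballI)
  fix c l assume c: "c \<in> \<C>" and l: "l \<in> {1..levels c}"
  have geo: "geometric_assumption c" using geometry c by blast
  interpret fe_domain c p
    by unfold_locales (use geo dim degree in \<open>auto simp: geometric_assumption_def\<close>)
  have nested: "active_region c l \<subseteq> active_region c (l - 1)"
    using geo l by (auto simp: geometric_assumption_def)
  obtain cA CA Cx where cA: "cA > 0" and st: "\<And>l u v. \<lbrakk>l \<le> levels c; u \<in> fe_space p c l; v \<in> fe_space p c l\<rbrakk> \<Longrightarrow>
        cA * N_norm_sq p \<gamma> c l v \<le> A_form p \<gamma> \<gamma>D c l v v \<and>
        A_form p \<gamma> \<gamma>D c l u v \<le> CA * sqrt (N_norm_sq p \<gamma> c l u) * sqrt (N_norm_sq p \<gamma> c l v) \<and>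
        (LINT x:(active_region c l - Omega c)|lebesgue. grad v x \<bullet> grad v x)
          \<le> Cx * (inner_Omega c (grad v) (grad v) + ghost_form p \<gamma> c l v v)"
    using stability c unfolding stability_assumption_def by meson
  have energy: "energy_space (fe_space p c k) (A_form p \<gamma> \<gamma>D c k)" if "k \<le> levels c" for k
    by (rule energy_space_fe[OF fe_domain_axioms gamma(1) cA, of k \<gamma>D Cx]) (use st[OF that] in blast)+
  have fine: "energy_space (fe_space p c l) (A_form p \<gamma> \<gamma>D c l)"
    by (rule energy) (use l in simp)
  have coarse: "energy_space (fe_space p c (l - 1)) (A_form p \<gamma> \<gamma>D c (l - 1))"
    by (rule energy) (use l in auto)
  interpret two_level c p \<gamma> \<gamma>D Csd Cpr NO l \<kappa>
  proof (intro two_level.intro two_level_axioms.intro fe_domain_axioms)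
    show "NO = 5 ^ CARD('n)" by (rule NO)
    show "1 \<le> l" using l by simp
    show "active_region c l \<subseteq> active_region c (l - 1)" by (rule nested)
    show "energy_space (fe_space p c l) (A_form p \<gamma> \<gamma>D c l)" by (rule fine)
    show "energy_space (fe_space p c (l - 1)) (A_form p \<gamma> \<gamma>D c (l - 1))" by (rule coarse)
    show "A_norm p \<gamma> \<gamma>D c l (prolong c l v) \<le> Cpr * A_norm p \<gamma> \<gamma>D c (l - 1) v"
      if "v \<in> fe_space p c (l - 1)" for v
      using Cpr c l that unfolding is_prolongation_constant_def by blast
    fix v assume v: "v \<in> fe_space p c l"
    obtain w0 w where w0: "w0 \<in> fe_space p c (l - 1)"
      and w: "\<forall>j\<in>admissible_vertices c l. w j \<in> local_space \<kappa> p c l j"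
      and eq: "v = (\<lambda>x. prolong c l w0 x + (\<Sum>j\<in>admissible_vertices c l. w j x))"
      and le: "(A_norm p \<gamma> \<gamma>D c l (prolong c l w0))\<^sup>2
            + (\<Sum>j\<in>admissible_vertices c l. (A_norm p \<gamma> \<gamma>D c l (w j))\<^sup>2)
            \<le> Csd * (A_norm p \<gamma> \<gamma>D c l v)\<^sup>2"
      and le0: "(A_norm p \<gamma> \<gamma>D c (l - 1) w0)\<^sup>2 \<le> Csd * (A_norm p \<gamma> \<gamma>D c l v)\<^sup>2"
      using Csd c l v unfolding is_decomposition_constant_def by meson
    have sq: "(A_norm p \<gamma> \<gamma>D c l u)\<^sup>2 = A_form p \<gamma> \<gamma>D c l u u" if "u \<in> fe_space p c l" for u
      using psd_form.nonneg[OF energy_space.axioms(1)[OF fine] that] by (simp add: A_norm_def)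
    have sq': "(A_norm p \<gamma> \<gamma>D c (l - 1) w0)\<^sup>2 = A_form p \<gamma> \<gamma>D c (l - 1) w0 w0"
      using psd_form.nonneg[OF energy_space.axioms(1)[OF coarse] w0] by (simp add: A_norm_def)
    have wV: "w j \<in> fe_space p c l" if "j \<in> admissible_vertices c l" for j
      by (rule subsetD[OF local_space_sub]) (use w that in blast)
    have pV: "prolong c l w0 \<in> fe_space p c l" by (rule prolong_in_fe[OF w0 _ nested]) (use l in simp)
    show "\<exists>w0\<in>fe_space p c (l - 1). \<exists>w.
          (\<forall>j\<in>admissible_vertices c l. w j \<in> local_space \<kappa> p c l j) \<and>
          v = prolong c l w0 + (\<Sum>j\<in>admissible_vertices c l. w j) \<and>
          A_form p \<gamma> \<gamma>D c l (prolong c l w0) (prolong c l w0)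
            + (\<Sum>j\<in>admissible_vertices c l. A_form p \<gamma> \<gamma>D c l (w j) (w j)) \<le> Csd * A_form p \<gamma> \<gamma>D c l v v \<and>
          A_form p \<gamma> \<gamma>D c (l - 1) w0 w0 \<le> Csd * A_form p \<gamma> \<gamma>D c l v v"
    proof (intro bexI[OF _ w0] exI[of _ w] conjI w)
      show "v = prolong c l w0 + (\<Sum>j\<in>admissible_vertices c l. w j)"
        by (simp add: eq fun_eq_iff)
      show "A_form p \<gamma> \<gamma>D c l (prolong c l w0) (prolong c l w0)
            + (\<Sum>j\<in>admissible_vertices c l. A_form p \<gamma> \<gamma>D c l (w j) (w j)) \<le> Csd * A_form p \<gamma> \<gamma>D c l v v"
        using le by (simp add: sq pV wV v)
      show "A_form p \<gamma> \<gamma>D c (l - 1) w0 w0 \<le> Csd * A_form p \<gamma> \<gamma>D c l v v"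
        using le0 unfolding sq' sq[OF v] .
    qed
  qed
  have lo: "inverse Csd * A v v \<le> A (P_ad \<kappa> p \<gamma> \<gamma>D c l v) v" if "v \<in> V" for v
    using additive(1)[OF that] Csd_pos by (simp add: field_simps)
  note cond = cond_number_le[OF P_ad_self_adjoint _ lo additive(2)]
  have iC: "0 < inverse Csd" using Csd_pos by simp
  have a1: "bij_betw (P_ad \<kappa> p \<gamma> \<gamma>D c l) V V" by (rule cond(1)[OF iC])
  have a2: "cond_number p \<gamma> \<gamma>D c l (P_ad \<kappa> p \<gamma> \<gamma>D c l) \<le> (NO + 1) * Csd" using cond(2)[OF iC] by simp
  have a0: "\<forall>v\<in>V. inverse Csd * A v v \<le> A (P_ad \<kappa> p \<gamma> \<gamma>D c l v) v \<and>
      A (P_ad \<kappa> p \<gamma> \<gamma>D c l v) v \<le> (NO + 1) * A v v"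
    using lo additive(2) by blast
  note exact = F.projection_self_adjoint[OF coarse_projects coarse_sub]
  have exact_le: "A (P0 v) (P0 v) \<le> A (P0 v) v" if "v \<in> V" for v
    using F.projects_ontoD(5)[OF coarse_projects coarse_sub that] by simp
  define K where "K = (2 * NO\<^sup>2 + 1) * Csd"
  define K' where "K' = (2 * NO\<^sup>2 + 1) * (1 + Cpr\<^sup>2) * Csd"
  have "(let P0 = coarse_proj p \<gamma> \<gamma>D c l; T0 = T0_op p \<gamma> \<gamma>D Cpr c l;
               Ps = map (local_proj \<kappa> p \<gamma> \<gamma>D c l) js;
               E = error_op (P0 # Ps);
               Erev = error_op (rev (P0 # Ps));
               Esym = error_op (rev Ps @ P0 # Ps);
               E' = error_op (T0 # Ps);
               Esym' = error_op (rev Ps @ T0 # Ps)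
           in (nrm E)\<^sup>2 \<le> 1 - 1 / K \<and> (nrm Erev)\<^sup>2 \<le> 1 - 1 / K \<and> (nrm Esym)\<^sup>2 \<le> 1 - 1 / K \<and>
              1 - 1 / K < 1 \<and>
              (nrm E')\<^sup>2 \<le> 1 - 1 / K' \<and> 1 - 1 / K' < 1 \<and>
              iteration_converges p \<gamma> \<gamma>D c l E \<and>
              iteration_converges p \<gamma> \<gamma>D c l E' \<and>
              spd_with_cond_le p \<gamma> \<gamma>D c l (residual_op Esym) K \<and>
              spd_with_cond_le p \<gamma> \<gamma>D c l (residual_op Esym') K')"
    if js: "enumerates js J" for js
  proof -
    note e = js exact exact_le splitting_exact K_exact[folded K_def]
    note r = js T0_self_adjoint T0_le splitting_rediscretized K_rediscretized[folded K'_def]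
    have \<theta>: "0 \<le> 1 - 1 / K" "1 - 1 / K < 1" by (rule theta[OF e]; assumption)+
    have \<theta>': "0 \<le> 1 - 1 / K'" "1 - 1 / K' < 1" by (rule theta[OF r]; assumption)+
    have inV: "error_op (P0 # map P js) v \<in> V" "error_op (rev (P0 # map P js)) v \<in> V"
        "error_op (T0 # map P js) v \<in> V" "error_op (rev (map P js) @ P0 # map P js) v \<in> V"
      if v: "v \<in> V" for v
      using error_in_V[OF e] reversed_in_V[OF e] error_in_V[OF r] v
        F.self_adjointD(1)[OF symmetrized(1)[OF e] v]
      by (auto simp: error_op_eq)
    show ?thesis
      unfolding Let_def
    proof (intro conjI)
      show "(nrm (error_op (P0 # map P js)))\<^sup>2 \<le> 1 - 1 / K"
        by (rule opnorm_sq_le[OF inV(1) \<theta>(1) error_contraction[OF e]])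
      show "(nrm (error_op (rev (P0 # map P js))))\<^sup>2 \<le> 1 - 1 / K"
        by (rule opnorm_sq_le[OF inV(2) \<theta>(1) reversed_contraction[OF e]])
      show "(nrm (error_op (rev (map P js) @ P0 # map P js)))\<^sup>2 \<le> 1 - 1 / K"
        by (rule opnorm_sq_le[OF inV(4) \<theta>(1) symmetrized_contraction[OF e]])
      show "(nrm (error_op (T0 # map P js)))\<^sup>2 \<le> 1 - 1 / K'"
        by (rule opnorm_sq_le[OF inV(3) \<theta>'(1) error_contraction[OF r]])
      show "1 - 1 / K < 1" "1 - 1 / K' < 1" by (rule \<theta>(2) \<theta>'(2))+
      show "iteration_converges p \<gamma> \<gamma>D c l (error_op (P0 # map P js))"
        by (rule iteration_convergesI[OF inV(1) \<theta> error_contraction[OF e]])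
      show "iteration_converges p \<gamma> \<gamma>D c l (error_op (T0 # map P js))"
        by (rule iteration_convergesI[OF inV(3) \<theta>' error_contraction[OF r]])
      show "spd_with_cond_le p \<gamma> \<gamma>D c l (residual_op (error_op (rev (map P js) @ P0 # map P js))) K"
        by (rule preconditioner[OF e])
      show "spd_with_cond_le p \<gamma> \<gamma>D c l (residual_op (error_op (rev (map P js) @ T0 # map P js))) K'"
        by (rule preconditioner[OF r])
    qed
  qed
  then show "(let V = fe_space p c l; A = A_form p \<gamma> \<gamma>D c l; nrm = A_opnorm p \<gamma> \<gamma>D c l;
         Pad = P_ad \<kappa> p \<gamma> \<gamma>D c l
     in (\<forall>v\<in>V. inverse Csd * A v v \<le> A (Pad v) v \<and> A (Pad v) v \<le> (NO + 1) * A v v) \<and>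
        bij_betw Pad V V \<and> cond_number p \<gamma> \<gamma>D c l Pad \<le> (NO + 1) * Csd \<and>
        (\<forall>js. enumerates js (admissible_vertices c l) \<longrightarrow>
          (let P0 = coarse_proj p \<gamma> \<gamma>D c l; T0 = T0_op p \<gamma> \<gamma>D Cpr c l;
               Ps = map (local_proj \<kappa> p \<gamma> \<gamma>D c l) js;
               E = error_op (P0 # Ps);
               Erev = error_op (rev (P0 # Ps));
               Esym = error_op (rev Ps @ P0 # Ps);
               E' = error_op (T0 # Ps);
               Esym' = error_op (rev Ps @ T0 # Ps);
               K = (2 * NO\<^sup>2 + 1) * Csd;
               K' = (2 * NO\<^sup>2 + 1) * (1 + Cpr\<^sup>2) * Csd
           in (nrm E)\<^sup>2 \<le> 1 - 1 / K \<and> (nrm Erev)\<^sup>2 \<le> 1 - 1 / K \<and> (nrm Esym)\<^sup>2 \<le> 1 - 1 / K \<and>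
              1 - 1 / K < 1 \<and>
              (nrm E')\<^sup>2 \<le> 1 - 1 / K' \<and> 1 - 1 / K' < 1 \<and>
              iteration_converges p \<gamma> \<gamma>D c l E \<and>
              iteration_converges p \<gamma> \<gamma>D c l E' \<and>
              spd_with_cond_le p \<gamma> \<gamma>D c l (residual_op Esym) K \<and>
              spd_with_cond_le p \<gamma> \<gamma>D c l (residual_op Esym') K')))"
    unfolding Let_def K_def K'_def
    by (intro conjI[OF a0 conjI[OF a1 conjI[OF a2]]] allI impI)
qed

end
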